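(* Let $X$ be a Banach space with norm $\Vert\cdot\Vert_X$, and let the following hold. (i) For each $0<h<1$, $X_h\subseteq X$ is a closed linear subspace. (ii) $\pi_h:X\to X_h$ is bounded and linear, $\Vert\pi_h\Vert_{L(X)}$ is bounded independently of $h$, and $\pi_h x=x$ for all $x\in X_h$. (iii) $A:D(A)\subseteq X\to X$ is a closed, densely defined linear operator. There are $\lambda\ge 0$, $\delta\in(0,\pi/2)$ and $M\ge 1$ such that $\sigma(\lambda+A)\subseteq\Sigma_\delta$ and $\Vert(z-\lambda-A)^{-1}x\Vert_X\le \frac{M}{|z|}\Vert x\Vert_X$ for all $x\in X$ and all $z\notin\Sigma_\delta$. (iv) $A_h:X_h\to X_h$ are linear operators such that, for every $0<h<1$ and with the same $\lambda,\delta,M$, we have $\sigma(\lambda+A_h)\subseteq\Sigma_\delta$ and $\Vert(z-\lambda-A_h)^{-1}x\Vert_X\le \frac{M}{|z|}\Vert x\Vert_X$ for all $x\in X_h$ and all $z\notin\Sigma_\delta$. (v) For some $r>0$ and some $C>0$, $\Vert((\lambda+A)^{-1}-(\lambda+A_h)^{-1}\pi_h)x\Vert_X\le Ch^r\Vert x\Vert_X$ for all $x\in X$. Let $u(t):=S(t)x$, where $S$ is the analytic semigroup generated by $-A$ on $X$. Let $u_h(t):=S_h(t)\pi_h x$, where $S_h$ is the analytic semigroup generated by $-A_h$ on $X_h$. Then there is $C=C_{\lambda,T}>0$ such that $$\Vert u(t)-u_h(t)\Vert_X\le C\,t^{-\theta/r+\rho/r}h^\theta\Vert(\lambda+A)^{\rho/r}x\Vert_X$$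 for all $x\in D((\lambda+A)^{\rho/r})$, all $\theta\in[0,r]$, all $\rho\in[0,\theta]$, and all $t\in[0,T]$.
   Context: $\Sigma_\delta:=\{z\in\mathbb{C}\setminus\{0\}:|\arg z|<\delta\}$. $\sigma(\cdot)$ denotes the spectrum, and $L(X)$ denotes the bounded linear operators on $X$. $T>0$ is a fixed terminal time. The constant $C$ may depend on $\lambda$ and $T$ but not on $h$ or $t$. Fractional powers are defined as follows. For $\alpha>0$, $$(\lambda+A)^{-\alpha}=\frac1{\Gamma(\alpha)}\int_0^\infty t^{\alpha-1}e^{-\lambda t}S(t)\,dt.$$ For $\alpha\in(0,1)$, $$(\lambda+A)^{\alpha}=\frac{\sin(\alpha\pi)}{\pi}\int_0^\infty t^{\alpha-1}(t+\lambda+A)^{-1}(\lambda+A)\,dt,$$ which agrees with the inverse of $(\lambda+A)^{-\alpha}$. Moreover $(\lambda+A)^0=I$. *)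

theory Defs
  imports "HOL-Analysis.Analysis"
begin

text \<open>The library has no class of complex normed vector spaces.  A complex Banach
space is encoded as a real Banach space together with a complex scalar
multiplication extending the real one and satisfying the vector space axioms
and the norm identity.\<close>

class cbanach = banach +
  fixes cmult :: "complex \<Rightarrow> 'a \<Rightarrow> 'a"  (infixr \<open>*\<^sub>C\<close> 75)
  assumes cmult_of_real: "cmult (complex_of_real r) x = r *\<^sub>R x"
    and cmult_add_right: "cmult a (x + y) = cmult a x + cmult a y"
    and cmult_add_left: "cmult (a + b) x = cmult a x + cmult b x"
    and cmult_cmult: "cmult a (cmult b x) = cmult (a * b) x"
    and norm_cmult: "norm (cmult a x) = cmod a * norm x"

definition csubspace :: "'a::cbanach set \<Rightarrow> bool" where
  "csubspace V \<longleftrightarrow> 0 \<in> V \<and> (\<forall>x\<in>V. \<forall>y\<in>V. x + y \<in> V) \<and> (\<forall>c. \<forall>x\<in>V. c *\<^sub>C x \<in> V)"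

definition clinear_op :: "'a::cbanach set \<Rightarrow> 'a set \<Rightarrow> ('a \<Rightarrow> 'a) \<Rightarrow> bool" where
  "clinear_op D V B \<longleftrightarrow> csubspace D \<and> (\<forall>x\<in>D. B x \<in> V)
     \<and> (\<forall>x\<in>D. \<forall>y\<in>D. B (x + y) = B x + B y) \<and> (\<forall>c. \<forall>x\<in>D. B (c *\<^sub>C x) = c *\<^sub>C B x)"

definition closed_op :: "'a::cbanach set \<Rightarrow> ('a \<Rightarrow> 'a) \<Rightarrow> bool" where
  "closed_op D B \<longleftrightarrow> closed {(x, B x) | x. x \<in> D}"

definition bounded_on :: "'a::cbanach set \<Rightarrow> ('a \<Rightarrow> 'a) \<Rightarrow> bool" where
  "bounded_on V B \<longleftrightarrow> (\<exists>K. \<forall>x\<in>V. norm (B x) \<le> K * norm x)"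

definition resolvent_set :: "'a::cbanach set \<Rightarrow> 'a set \<Rightarrow> ('a \<Rightarrow> 'a) \<Rightarrow> complex set" where
  "resolvent_set V D B = {z. bij_betw (\<lambda>x. z *\<^sub>C x - B x) D V
      \<and> bounded_on V (inv_into D (\<lambda>x. z *\<^sub>C x - B x))}"

definition spectrum_op :: "'a::cbanach set \<Rightarrow> 'a set \<Rightarrow> ('a \<Rightarrow> 'a) \<Rightarrow> complex set" where
  "spectrum_op V D B = UNIV - resolvent_set V D B"

definition resolvent :: "'a::cbanach set \<Rightarrow> ('a \<Rightarrow> 'a) \<Rightarrow> complex \<Rightarrow> 'a \<Rightarrow> 'a" where
  "resolvent D B z = inv_into D (\<lambda>x. z *\<^sub>C x - B x)"

definition sector :: "real \<Rightarrow> complex set" where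
  "sector \<delta> = {z. z \<noteq> 0 \<and> \<bar>Arg z\<bar> < \<delta>}"

definition generates_semigroup ::
  "'a::cbanach set \<Rightarrow> 'a set \<Rightarrow> ('a \<Rightarrow> 'a) \<Rightarrow> (real \<Rightarrow> 'a \<Rightarrow> 'a) \<Rightarrow> bool" where
  "generates_semigroup V D G S \<longleftrightarrow>
     (\<forall>t\<ge>0. clinear_op V V (S t) \<and> bounded_on V (S t))
   \<and> (\<forall>x\<in>V. S 0 x = x)
   \<and> (\<forall>s\<ge>0. \<forall>t\<ge>0. \<forall>x\<in>V. S (s + t) x = S s (S t x))
   \<and> (\<forall>x\<in>V. ((\<lambda>t. S t x) \<longlongrightarrow> x) (at_right 0))
   \<and> D = {x\<in>V. \<exists>y. ((\<lambda>t. (1 / t) *\<^sub>R (S t x - x)) \<longlongrightarrow> y) (at_right 0)}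
   \<and> (\<forall>x\<in>D. ((\<lambda>t. (1 / t) *\<^sub>R (S t x - x)) \<longlongrightarrow> G x) (at_right 0))"

text \<open>(\<lambda>+A)^{-\<alpha>} x = 1/\<Gamma>(\<alpha>) \<integral>_0^\<infinity> t^{\<alpha>-1} e^{-\<lambda>t} S(t) x dt, where S is
the semigroup generated by -A.\<close>
definition frac_neg :: "(real \<Rightarrow> 'a::cbanach \<Rightarrow> 'a) \<Rightarrow> real \<Rightarrow> real \<Rightarrow> 'a \<Rightarrow> 'a" where
  "frac_neg S lam \<alpha> x =
     (1 / Gamma \<alpha>) *\<^sub>R integral {0..} (\<lambda>t. (t powr (\<alpha> - 1) * exp (- lam * t)) *\<^sub>R S t x)"

definition frac_dom :: "(real \<Rightarrow> 'a::cbanach \<Rightarrow> 'a) \<Rightarrow> real \<Rightarrow> real \<Rightarrow> 'a set" where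
  "frac_dom S lam \<alpha> = (if \<alpha> = 0 then UNIV else range (frac_neg S lam \<alpha>))"

definition frac_pow :: "(real \<Rightarrow> 'a::cbanach \<Rightarrow> 'a) \<Rightarrow> real \<Rightarrow> real \<Rightarrow> 'a \<Rightarrow> 'a" where
  "frac_pow S lam \<alpha> x = (if \<alpha> = 0 then x else inv_into UNIV (frac_neg S lam \<alpha>) x)"

end

theory Submission
  imports Defs "HOL-Probability.Sinc_Integral"
begin

text \<open>Put \<open>E(t) = exp(-\<lambda>t) S(t)\<close> and \<open>R(z) = (z - \<lambda> - A)\<^sup>-\<^sup>1\<close>, and likewise
\<open>E\<^sub>h(t) = exp(-\<lambda>t) S\<^sub>h(t) \<pi>\<^sub>h\<close> and \<open>R\<^sub>h(z)\<close> composed with \<open>\<pi>\<^sub>h\<close>.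
Only the resolvent bound on \<open>Re z \<le> 0\<close> matters.  On the line \<open>Re z = -1/t\<close> the inversion formula
\<open>-2\<pi> E(t)w = lim \<integral> exp(-zt) R(z)w dy\<close> (\<open>z = -1/t + iy\<close>, \<open>|y| \<le> N \<rightarrow> \<infinity>\<close>), integrated by parts once or
twice, becomes an absolutely convergent integral of \<open>R(z)\<^sup>2\<close> or \<open>R(z)\<^sup>3\<close>; this yields
\<open>|E(t)w| \<le> C |w|\<close> and \<open>|E(t)w| \<le> (C/t) |R(0)w|\<close> with \<open>C\<close> depending on \<open>M\<close> only, hence
uniformly in \<open>h\<close>.  The inversion formula itself comes from the exact identity
\<open>exp(-zt) R(z)w = E(t)R(z)w - \<integral>\<^sub>0\<^sup>t exp(-zs) E(t-s)w ds\<close>, whose \<open>y\<close>-integral is a Dirichlet kernel.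

Differentiating \<open>E\<^sub>h(t-s) R\<^sub>h(0) E(s) R(0) v\<close> in \<open>s\<close> and splitting at \<open>t/2\<close> then bounds
\<open>G = E(t) - E\<^sub>h(t)\<close> by \<open>|G R(0)y| \<le> C h\<^sup>r |y|\<close> and \<open>t |G x| \<le> C h\<^sup>r |x|\<close>.
The intermediate powers follow from the moment inequality
\<open>|G (\<lambda>+A)\<^sup>-\<^sup>\<alpha>| \<le> C |G|\<^sup>1\<^sup>-\<^sup>\<alpha> |G R(0)|\<^sup>\<alpha>\<close>, uniformly in \<open>0 < \<alpha> \<le> 1\<close>.\<close>

text \<open>Analyticity enters only as a bound of order 1/t for the generator applied to the
  semigroup, so no contour around the sector is required: on Re z = -1/t the factor |exp(-zt)| is
  the constant e, and the integral of |z|^-2 over the line is pi t. No constant may be taken from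
  the semigroups themselves, since the bound that strong continuity gives for \<open>Sh h\<close>
  can depend on h. Boundedness near 0 therefore serves continuity alone, and every quantitative
  bound is rebuilt from M. The two generators are not comparable, only their inverses are. The
  factors \<open>R 0\<close> and its discrete counterpart around the product of semigroups turn the
  difference of generators into the difference of inverses, which hypothesis (v) controls. Cutting
  [0,t] at t/2 avoids a logarithm: the discrete semigroup supplies the smoothing for the first half
  and the exact one for the second, so 1/s is never integrated down to 0. Absorbing \<lambda> into
  exp(-\<lambda>t) makes all these bounds uniform in t \<ge> 0.\<close>

lemma cmult_scaleR_right: "c *\<^sub>C (r *\<^sub>R x) = r *\<^sub>R (c *\<^sub>C (x::'a::cbanach))"
  by (simp add: cmult_of_real[symmetric] cmult_cmult mult.commute)

lemma bounded_bilinear_cmult: "bounded_bilinear ((*\<^sub>C) :: complex \<Rightarrow> 'a \<Rightarrow> 'a::cbanach)"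
proof
  fix r :: real and a :: complex and b :: 'a
  have "(r *\<^sub>R a) *\<^sub>C b = (complex_of_real r * a) *\<^sub>C b"
    by (simp add: scaleR_conv_of_real)
  then show "(r *\<^sub>R a) *\<^sub>C b = r *\<^sub>R a *\<^sub>C b"
    by (simp only: cmult_cmult[symmetric] cmult_of_real)
  show "\<exists>K. \<forall>a (b::'a). norm (a *\<^sub>C b) \<le> norm a * norm b * K"
    by (rule exI[of _ 1]) (simp add: norm_cmult)
qed (simp_all add: cmult_add_right cmult_add_left cmult_scaleR_right)

interpretation cmult: bounded_bilinear "(*\<^sub>C) :: complex \<Rightarrow> 'a \<Rightarrow> 'a::cbanach"
  by (rule bounded_bilinear_cmult)

lemma cmult_one [simp]: "1 *\<^sub>C (x::'a::cbanach) = x"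
  using cmult_of_real[of 1 x] by simp

section \<open>Vector-valued calculus and uniform boundedness\<close>

lemma has_vector_derivative_iff_quotient:
  fixes f :: "real \<Rightarrow> 'a::real_normed_vector"
  shows "(f has_vector_derivative D) (at x within S) \<longleftrightarrow>
    ((\<lambda>y. (1 / (y - x)) *\<^sub>R (f y - f x)) \<longlongrightarrow> D) (at x within S)"
proof -
  let ?q = "\<lambda>y. (1 / norm (y - x)) *\<^sub>R (f y - (f x + (y - x) *\<^sub>R D))"
  have eq: "norm (?q y) = norm ((1 / (y - x)) *\<^sub>R (f y - f x) - D)" if "y \<noteq> x" for y
  proof -
    have "(1 / (y - x)) *\<^sub>R (f y - f x) - D = (1 / (y - x)) *\<^sub>R (f y - (f x + (y - x) *\<^sub>R D))"
      using that by (simp add: scaleR_diff_right scaleR_add_right)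
    then show ?thesis by simp
  qed
  have "(f has_vector_derivative D) (at x within S) \<longleftrightarrow> (?q \<longlongrightarrow> 0) (at x within S)"
    unfolding has_vector_derivative_def has_derivative_within
    by (simp add: bounded_linear_scaleR_left)
  also have "\<dots> \<longleftrightarrow> ((\<lambda>y. norm (?q y)) \<longlongrightarrow> 0) (at x within S)"
    by (rule tendsto_norm_zero_iff[symmetric])
  also have "\<dots> \<longleftrightarrow> ((\<lambda>y. norm ((1 / (y - x)) *\<^sub>R (f y - f x) - D)) \<longlongrightarrow> 0) (at x within S)"
    by (intro filterlim_cong[OF refl refl]) (use eq in \<open>auto simp only: eventually_at_filter intro!: always_eventually\<close>)
  also have "\<dots> \<longleftrightarrow> ((\<lambda>y. (1 / (y - x)) *\<^sub>R (f y - f x)) \<longlongrightarrow> D) (at x within S)"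
    by (subst tendsto_norm_zero_iff) (rule Lim_null[symmetric])
  finally show ?thesis .
qed

lemma norm_diff_le_vector_derivative_bound:
  fixes f :: "real \<Rightarrow> 'a::real_normed_vector"
  assumes "a \<le> b" and f: "\<And>x. x \<in> {a..b} \<Longrightarrow> (f has_vector_derivative f' x) (at x within {a..b})"
    and B: "\<And>x. x \<in> {a..b} \<Longrightarrow> norm (f' x) \<le> B"
  shows "norm (f b - f a) \<le> B * (b - a)"
proof -
  have "norm (f b - f a) \<le> B * norm (b - a)"
  proof (rule differentiable_bound[where S="{a..b}" and f'="\<lambda>x h. h *\<^sub>R f' x"])
    fix x assume x: "x \<in> {a..b}"
    show "(f has_derivative (\<lambda>h. h *\<^sub>R f' x)) (at x within {a..b})"
      using f[OF x] by (simp add: has_vector_derivative_def)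
    show "onorm (\<lambda>h. h *\<^sub>R f' x) \<le> B"
      by (rule onorm_le) (use B[OF x] in \<open>simp add: mult.commute[of B] mult_left_mono\<close>)
  qed (use assms(1) in auto)
  then show ?thesis using assms(1) by simp
qed

text \<open>Banach-Steinhaus by Baire category, for sequences. It converts pointwise convergence of
  \<open>E\<close> along times tending to 0 into an operator bound.\<close>

lemma uniform_boundedness:
  fixes T :: "nat \<Rightarrow> 'a::banach \<Rightarrow> 'b::real_normed_vector"
  assumes lin: "\<And>n. bounded_linear (T n)" and pw: "\<And>x. \<exists>K. \<forall>n. norm (T n x) \<le> K"
  shows "\<exists>K. \<forall>n x. norm (T n x) \<le> K * norm x"
proof -
  define F where "F k = {x. \<forall>n. norm (T n x) \<le> real k}" for k
  have closed: "closed (F k)" for k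
  proof -
    have "F k = (\<Inter>n. {x. norm (T n x) \<le> real k})" by (auto simp: F_def)
    moreover have "closed {x. norm (T n x) \<le> real k}" for n
      by (intro closed_Collect_le continuous_intros linear_continuous_on[OF lin])
    ultimately show ?thesis by auto
  qed
  have "(\<Union>k. F k) = UNIV"
  proof -
    have "\<exists>k. x \<in> F k" for x
    proof -
      obtain K where "\<And>n. norm (T n x) \<le> K" using pw by blast
      moreover obtain k where "K \<le> real k" using real_arch_simple by blast
      ultimately show ?thesis unfolding F_def by (auto intro: order_trans)
    qed
    then show ?thesis by auto
  qed
  have "\<exists>k. interior (F k) \<noteq> {}"
  proof (rule ccontr)
    assume "\<not> ?thesis"
    then have "(euclidean :: 'a topology) interior_of \<Union>(range F) = {}"
      using closed
      by (intro Baire_category_alt disjI1) (auto simp: completely_metrizable_space_euclidean)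
    then show False using \<open>(\<Union>k. F k) = UNIV\<close> by simp
  qed
  then obtain k x0 e where "e > 0" and ball: "cball x0 e \<subseteq> F k"
    by (meson all_not_in_conv mem_interior_cball)
  have "norm (T n x) \<le> (2 * real k / e) * norm x" for n x
  proof (cases "x = 0")
    case True
    then show ?thesis using linear_0[OF bounded_linear.linear[OF lin]] by simp
  next
    case False
    interpret bounded_linear "T n" by (rule lin)
    define v where "v = (e / norm x) *\<^sub>R x"
    have "norm v = e" using False \<open>e > 0\<close> by (simp add: v_def)
    then have "x0 + v \<in> F k" "x0 \<in> F k" using ball \<open>e > 0\<close> by (auto simp: subset_iff dist_norm)
    then have "norm (T n (x0 + v)) \<le> k" "norm (T n x0) \<le> k" by (auto simp: F_def)
    then have "norm (T n v) \<le> 2 * real k"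
      using norm_triangle_ineq4[of "T n (x0 + v)" "T n x0"] by (simp add: add)
    moreover have "norm (T n v) = (e / norm x) * norm (T n x)"
      using False \<open>e > 0\<close> by (simp add: v_def scaleR)
    ultimately show ?thesis using False \<open>e > 0\<close> by (simp add: field_simps)
  qed
  then show ?thesis by blast
qed

section \<open>Semigroups with resolvents on the left half-plane\<close>

text \<open>\<open>E 0\<close> is only a projection, which allows a semigroup on a complemented subspace to be treated
as a family of operators on the whole space.  The generator \<open>-B\<close> enters through \<open>R 0 = -B\<^sup>-\<^sup>1\<close>
alone.\<close>

locale resolvent_semigroup =
  fixes E :: "real \<Rightarrow> 'a::cbanach \<Rightarrow> 'a" and R :: "complex \<Rightarrow> 'a \<Rightarrow> 'a" and M :: real
  assumes M_ge_1: "1 \<le> M"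
    and E_bounded_linear: "0 \<le> t \<Longrightarrow> bounded_linear (E t)"
    and E_cmult: "0 \<le> t \<Longrightarrow> E t (c *\<^sub>C x) = c *\<^sub>C E t x"
    and E_add: "0 \<le> s \<Longrightarrow> 0 \<le> t \<Longrightarrow> E (s + t) x = E s (E t x)"
    and E_tendsto_0: "((\<lambda>t. E t x) \<longlongrightarrow> E 0 x) (at_right 0)"
    and norm_E_0: "norm (E 0 x) \<le> M * norm x"
    and R_bounded_linear: "Re z \<le> 0 \<Longrightarrow> bounded_linear (R z)"
    and R_bound: "Re z \<le> 0 \<Longrightarrow> cmod z * norm (R z x) \<le> M * norm x"
    and R_cmult: "Re z \<le> 0 \<Longrightarrow> R z (c *\<^sub>C x) = c *\<^sub>C R z x"
    and resolvent_identity: "Re z \<le> 0 \<Longrightarrow> Re w \<le> 0 \<Longrightarrow> R z x - R w x = (w - z) *\<^sub>C R z (R w x)"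
    and E_R_0: "0 \<le> t \<Longrightarrow> E t (R 0 x) = R 0 (E t x)"
    and R_0_E_0: "R 0 (E 0 x) = R 0 x"
    and E_R_0_deriv_0: "((\<lambda>t. (1 / t) *\<^sub>R (E t (R 0 x) - R 0 x)) \<longlongrightarrow> E 0 x) (at_right 0)"
    and range_E_0_subset: "range (E 0) \<subseteq> closure (range (R 0))"
begin

lemma E_E_0: "0 \<le> t \<Longrightarrow> E t (E 0 x) = E t x"
  using E_add[of t 0 x] by simp

lemma E_0_R_0: "E 0 (R 0 x) = R 0 x"
  by (simp add: E_R_0 R_0_E_0)

text \<open>Otherwise some times \<open>\<tau> n\<close> tending to 0 have operator norms exceeding
  n, while strong continuity at 0 keeps every orbit along them bounded.\<close>

lemma E_locally_bounded_near_0: "\<exists>d>0. \<exists>K. \<forall>t\<in>{0..d}. \<forall>x. norm (E t x) \<le> K * norm x"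
proof (rule ccontr)
  assume neg: "\<not> ?thesis"
  have "\<exists>t\<in>{0..1 / real (Suc n)}. \<exists>x. norm (E t x) > real n * norm x" for n
  proof -
    have "(0::real) < 1 / real (Suc n)" by simp
    then show ?thesis using neg by (meson not_le)
  qed
  then obtain \<tau> where \<tau>: "\<And>n. \<tau> n \<in> {0..1 / real (Suc n)}" "\<And>n. \<exists>x. norm (E (\<tau> n) x) > real n * norm x"
    by metis
  have \<tau>0: "\<And>n. 0 \<le> \<tau> n" using \<tau>(1) by auto
  have "\<tau> \<longlonglongrightarrow> 0"
  proof (rule tendsto_sandwich[of "\<lambda>_. 0" _ _ "\<lambda>n. 1 / real (Suc n)"])
    show "(\<lambda>n. 1 / real (Suc n)) \<longlonglongrightarrow> 0"
      using LIMSEQ_inverse_real_of_nat by (simp add: inverse_eq_divide)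
  qed (use \<tau>(1) in auto)
  have "(\<lambda>n. E (\<tau> n) x) \<longlonglongrightarrow> E 0 x" for x
  proof -
    have "((\<lambda>t. E t x) \<longlongrightarrow> E 0 x) (at 0 within {0..})"
      using E_tendsto_0[of x] by (simp add: at_within_Ici_at_right)
    then have "continuous (at 0 within {0..}) (\<lambda>t. E t x)"
      by (simp add: continuous_within)
    then show ?thesis
      using \<open>\<tau> \<longlonglongrightarrow> 0\<close> \<tau>0 by (auto simp: continuous_within_sequentially comp_def)
  qed
  then have "\<exists>K. \<forall>n. norm (E (\<tau> n) x) \<le> K" for x
    by (metis Bseq_def convergentI convergent_imp_Bseq)
  then obtain K where K: "\<And>n x. norm (E (\<tau> n) x) \<le> K * norm x"
    using uniform_boundedness[of "\<lambda>n. E (\<tau> n)"] E_bounded_linear[OF \<tau>0] by blast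
  obtain n where "K \<le> real n" using real_arch_simple by blast
  obtain x where "norm (E (\<tau> n) x) > real n * norm x" using \<tau>(2) by blast
  moreover have "norm (E (\<tau> n) x) \<le> real n * norm x"
    using K[of n x] mult_right_mono[OF \<open>K \<le> real n\<close> norm_ge_zero[of x]] by linarith
  ultimately show False by simp
qed

text \<open>Steps of length d multiply the bound near 0. The resulting constant depends on the
  semigroup and is used for continuity only; the quantitative bound is
  \<open>norm_E_le\<close>.\<close>

lemma E_locally_bounded: "\<exists>K>0. \<forall>t\<in>{0..b}. \<forall>x. norm (E t x) \<le> K * norm x"
proof -
  obtain d K0 where "d > 0" and K0: "\<And>t x. t \<in> {0..d} \<Longrightarrow> norm (E t x) \<le> K0 * norm x"
    using E_locally_bounded_near_0 by blast
  define K where "K = max 1 K0"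
  have K: "norm (E t x) \<le> K * norm x" if "t \<in> {0..d}" for t x
    using K0[OF that, of x] mult_right_mono[of K0 K "norm x"] by (auto simp: K_def)
  have "K \<ge> 1" by (simp add: K_def)
  have *: "norm (E t x) \<le> K ^ Suc n * norm x" if "t \<in> {0..real n * d}" for t n x
    using that
  proof (induction n arbitrary: t x)
    case 0
    then show ?case using K[of t x] \<open>d > 0\<close> by simp
  next
    case (Suc n)
    show ?case
    proof (cases "t \<le> d")
      case True
      have "norm (E t x) \<le> K * norm x" using K[of t x] True Suc.prems by auto
      also have "\<dots> \<le> K ^ Suc (Suc n) * norm x"
        using \<open>K \<ge> 1\<close> power_increasing[of 1 "Suc (Suc n)" K] by (intro mult_right_mono) auto
      finally show ?thesis .
    next
      case False
      have "E t x = E d (E (t - d) x)" using E_add[of d "t - d" x] False \<open>d > 0\<close> by simp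
      also have "norm \<dots> \<le> K * norm (E (t - d) x)" using K[of d] \<open>d > 0\<close> by simp
      also have "\<dots> \<le> K * (K ^ Suc n * norm x)"
        using False Suc.prems \<open>K \<ge> 1\<close> by (intro mult_left_mono Suc.IH) (auto simp: algebra_simps)
      finally show ?thesis by (simp add: mult.assoc)
    qed
  qed
  obtain n where "b / d \<le> real n" using real_arch_simple by blast
  then have "b \<le> real n * d" using \<open>d > 0\<close> by (simp add: field_simps)
  then have "\<forall>t\<in>{0..b}. \<forall>x. norm (E t x) \<le> K ^ Suc n * norm x" using * by auto
  moreover have "K ^ Suc n > 0" using \<open>K \<ge> 1\<close> by simp
  ultimately show ?thesis by blast
qed

text \<open>Joint strong continuity. Factoring out \<open>E\<close> at the smaller of the two times
  leaves \<open>E\<close> at a time tending to 0. As \<open>E 0\<close> is a projection, the other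
  term is first rewritten with \<open>E_E_0\<close>.\<close>

lemma tendsto_E:
  assumes f: "(f \<longlongrightarrow> a) F" and g: "(g \<longlongrightarrow> x) F" and nn: "\<forall>\<^sub>F k in F. 0 \<le> f k" and a: "0 \<le> a"
  shows "((\<lambda>k. E (f k) (g k)) \<longlongrightarrow> E a x) F"
proof -
  obtain K where "K > 0" and K: "\<And>t x. t \<in> {0..a + 1} \<Longrightarrow> norm (E t x) \<le> K * norm x"
    using E_locally_bounded by blast
  \<comment> \<open>The absolute value treats times below and above a with the one-sided continuity
    at 0.\<close>
  define \<phi> where "\<phi> k = norm (E \<bar>f k - a\<bar> x - E 0 x)" for k
  have "((\<lambda>t. E t x) \<longlongrightarrow> E 0 x) (at 0 within {0..})"
    using E_tendsto_0[of x] by (simp add: at_within_Ici_at_right)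
  then have cont: "continuous (at 0 within {0..}) (\<lambda>t. E t x)" by (simp add: continuous_within)
  have "((\<lambda>k. \<bar>f k - a\<bar>) \<longlongrightarrow> 0) F" using f tendsto_rabs_zero LIM_zero by blast
  then have "((\<lambda>k. E \<bar>f k - a\<bar> x) \<longlongrightarrow> E 0 x) F"
    by (intro continuous_within_tendsto_compose[OF cont]) auto
  then have "((\<lambda>k. E \<bar>f k - a\<bar> x - E 0 x) \<longlongrightarrow> 0) F" using LIM_zero by blast
  then have \<phi>: "(\<phi> \<longlongrightarrow> 0) F" unfolding \<phi>_def using tendsto_norm_zero by blast
  have g0: "((\<lambda>k. norm (g k - x)) \<longlongrightarrow> 0) F" using g tendsto_norm_zero LIM_zero by blast
  have "((\<lambda>k. K * norm (g k - x) + K * \<phi> k) \<longlongrightarrow> 0) F"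
    using tendsto_add[OF tendsto_mult_left[OF g0, of K] tendsto_mult_left[OF \<phi>, of K]] by simp
  moreover have "\<forall>\<^sub>F k in F. norm (E (f k) (g k) - E a x) \<le> K * norm (g k - x) + K * \<phi> k"
    using nn order_tendstoD(2)[OF f, of "a + 1", simplified]
  proof eventually_elim
    case (elim k)
    interpret Ef: bounded_linear "E (f k)" using elim by (intro E_bounded_linear) auto
    have "norm (E (f k) x - E a x) \<le> K * \<phi> k"
    proof (cases "f k \<le> a")
      case True
      have "E a x = E (f k) (E \<bar>f k - a\<bar> x)"
        using E_add[of "f k" "a - f k" x] True elim by simp
      moreover have "E (f k) x = E (f k) (E 0 x)" using elim by (simp add: E_E_0)
      ultimately have "E (f k) x - E a x = E (f k) (E 0 x - E \<bar>f k - a\<bar> x)" by (simp only: Ef.diff)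
      also have "norm \<dots> \<le> K * norm (E 0 x - E \<bar>f k - a\<bar> x)" using elim by (intro K) auto
      finally show ?thesis by (simp add: \<phi>_def norm_minus_commute)
    next
      case False
      have "E (f k) x = E a (E \<bar>f k - a\<bar> x)"
        using E_add[of a "f k - a" x] False a by simp
      moreover have "E a x = E a (E 0 x)" using a by (simp add: E_E_0)
      ultimately have "E (f k) x - E a x = E a (E \<bar>f k - a\<bar> x - E 0 x)"
        by (simp only: linear_diff[OF bounded_linear.linear[OF E_bounded_linear[OF a]]])
      also have "norm \<dots> \<le> K * norm (E \<bar>f k - a\<bar> x - E 0 x)" using a by (intro K) auto
      finally show ?thesis by (simp add: \<phi>_def)
    qed
    moreover have "norm (E (f k) (g k - x)) \<le> K * norm (g k - x)" using elim by (intro K) auto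
    moreover have "E (f k) (g k) - E a x = E (f k) (g k - x) + (E (f k) x - E a x)"
      by (simp add: Ef.diff)
    ultimately show ?case by (metis add_mono norm_triangle_le)
  qed
  ultimately have "((\<lambda>k. E (f k) (g k) - E a x) \<longlongrightarrow> 0) F"
    by (rule Lim_null_comparison[rotated])
  then show ?thesis by (rule LIM_zero_cancel)
qed

lemma continuous_on_E:
  assumes "continuous_on S f" "continuous_on S g" "\<And>s. s \<in> S \<Longrightarrow> 0 \<le> f s"
  shows "continuous_on S (\<lambda>s. E (f s) (g s))"
  using assms unfolding continuous_on_def
  by (auto intro!: tendsto_E simp: eventually_at_filter)

text \<open>The right derivative at 0 propagates to both sides of t: with \<open>E (min y t)\<close>
  factored out, either difference quotient becomes the quotient at 0 taken at
  \<open>\<bar>y - t\<bar>\<close>, and \<open>tendsto_E\<close> passes to the limit.\<close>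

lemma E_R_0_has_vector_derivative:
  assumes "0 \<le> t"
  shows "((\<lambda>t. E t (R 0 x)) has_vector_derivative E t x) (at t within {0..})"
proof -
  define \<phi> where "\<phi> h = (1 / h) *\<^sub>R (E h (R 0 x) - R 0 x)" for h
  have "filterlim (\<lambda>y. \<bar>y - t\<bar>) (at_right 0) (at t within {0..})"
  proof -
    have "((\<lambda>y. \<bar>y - t\<bar>) \<longlongrightarrow> 0) (at t within {0..})"
      by (auto intro!: tendsto_eq_intros)
    then show ?thesis unfolding filterlim_at by (auto simp: eventually_at_filter)
  qed
  then have \<phi>: "((\<lambda>y. \<phi> \<bar>y - t\<bar>) \<longlongrightarrow> E 0 x) (at t within {0..})"
    using filterlim_compose[OF E_R_0_deriv_0[of x]] by (simp add: \<phi>_def)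
  have "((\<lambda>y. min y t) \<longlongrightarrow> t) (at t within {0..})"
    using tendsto_min[OF tendsto_ident_at[of t "{0..}"] tendsto_const[of t]] by simp
  then have lim: "((\<lambda>y. E (min y t) (\<phi> \<bar>y - t\<bar>)) \<longlongrightarrow> E t (E 0 x)) (at t within {0..})"
    using assms by (intro tendsto_E \<phi>) (auto simp: eventually_at_filter)
  have eq: "E (min y t) (\<phi> \<bar>y - t\<bar>) = (1 / (y - t)) *\<^sub>R (E y (R 0 x) - E t (R 0 x))"
    if "0 \<le> y" "y \<noteq> t" for y
  proof -
    interpret bounded_linear "E (min y t)" using that assms by (intro E_bounded_linear) auto
    have *: "E (min y t) (\<phi> \<bar>y - t\<bar>) = (1 / \<bar>y - t\<bar>) *\<^sub>R (E (min y t) (E \<bar>y - t\<bar> (R 0 x)) - E (min y t) (R 0 x))"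
      by (simp add: \<phi>_def scaleR diff)
    show ?thesis
    proof (cases "y < t")
      case True
      then have "E t (R 0 x) = E (min y t) (E \<bar>y - t\<bar> (R 0 x))"
        using E_add[of y "t - y" "R 0 x"] that by simp
      moreover have "1 / (y - t) = - (1 / \<bar>y - t\<bar>)" "min y t = y" using True by (simp_all add: field_simps)
      ultimately show ?thesis using * by (simp add: algebra_simps)
    next
      case False
      then have "E y (R 0 x) = E (min y t) (E \<bar>y - t\<bar> (R 0 x))"
        using E_add[of t "y - t" "R 0 x"] that assms by simp
      then show ?thesis using * False by simp
    qed
  qed
  have "((\<lambda>y. (1 / (y - t)) *\<^sub>R (E y (R 0 x) - E t (R 0 x))) \<longlongrightarrow> E t (E 0 x)) (at t within {0..})"
    by (rule Lim_transform_eventually[OF lim]) (auto simp: eventually_at_filter eq)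
  then show ?thesis
    using assms by (simp add: has_vector_derivative_iff_quotient E_E_0)
qed

text \<open>A product rule from strong limits alone. The increment of g is carried by
  \<open>E (t - y)\<close> and handled by joint continuity; the increment in time acts on the fixed
  vector \<open>R 0 (g s)\<close>, whose orbit is differentiable.\<close>

lemma E_reverse_R_0_has_vector_derivative:
  assumes g: "(g has_vector_derivative g') (at s within {a..t})" and s: "s \<in> {a..t}"
  shows "((\<lambda>s. E (t - s) (R 0 (g s))) has_vector_derivative E (t - s) (R 0 g') - E (t - s) (g s))
    (at s within {a..t})"
proof -
  interpret R0: bounded_linear "R 0" by (rule R_bounded_linear) simp
  have "((\<lambda>y. (1 / (y - s)) *\<^sub>R (g y - g s)) \<longlongrightarrow> g') (at s within {a..t})"
    using g by (simp add: has_vector_derivative_iff_quotient)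
  then have "((\<lambda>y. R 0 ((1 / (y - s)) *\<^sub>R (g y - g s))) \<longlongrightarrow> R 0 g') (at s within {a..t})"
    by (rule R0.tendsto)
  then have 1: "((\<lambda>y. E (t - y) (R 0 ((1 / (y - s)) *\<^sub>R (g y - g s)))) \<longlongrightarrow> E (t - s) (R 0 g')) (at s within {a..t})"
    using s by (intro tendsto_E tendsto_intros) (auto simp: eventually_at_filter)
  have "((\<lambda>y. t - y) has_vector_derivative - 1) (at s within {a..t})"
    by (auto intro!: derivative_eq_intros)
  moreover have "((\<lambda>r. E r (R 0 (g s))) has_vector_derivative E (t - s) (g s)) (at (t - s) within (\<lambda>y. t - y) ` {a..t})"
    by (rule has_vector_derivative_within_subset[OF E_R_0_has_vector_derivative]) (use s in auto)
  ultimately have "(((\<lambda>r. E r (R 0 (g s))) \<circ> (\<lambda>y. t - y)) has_vector_derivative (- 1) *\<^sub>R E (t - s) (g s)) (at s within {a..t})"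
    by (rule vector_diff_chain_within)
  then have 2: "((\<lambda>y. (1 / (y - s)) *\<^sub>R (E (t - y) (R 0 (g s)) - E (t - s) (R 0 (g s)))) \<longlongrightarrow> - E (t - s) (g s)) (at s within {a..t})"
    by (simp add: has_vector_derivative_iff_quotient comp_def)
  have "E (t - y) (R 0 ((1 / (y - s)) *\<^sub>R (g y - g s))) + (1 / (y - s)) *\<^sub>R (E (t - y) (R 0 (g s)) - E (t - s) (R 0 (g s)))
     = (1 / (y - s)) *\<^sub>R (E (t - y) (R 0 (g y)) - E (t - s) (R 0 (g s)))" if "y \<in> {a..t}" for y
  proof -
    interpret Ey: bounded_linear "E (t - y)" using that by (intro E_bounded_linear) auto
    show ?thesis by (simp only: R0.scaleR R0.diff Ey.scaleR Ey.diff) (simp add: algebra_simps)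
  qed
  then have "((\<lambda>y. (1 / (y - s)) *\<^sub>R (E (t - y) (R 0 (g y)) - E (t - s) (R 0 (g s)))) \<longlongrightarrow>
      E (t - s) (R 0 g') + - E (t - s) (g s)) (at s within {a..t})"
    by (intro Lim_transform_eventually[OF tendsto_add[OF 1 2]]) (auto simp: eventually_at_filter)
  then show ?thesis by (simp add: has_vector_derivative_iff_quotient)
qed

end

section \<open>The Dirichlet kernel and an arctangent integral\<close>

lemma dirichlet_kernel_tendsto:
  fixes f :: "real \<Rightarrow> 'a::banach"
  assumes t: "0 < t" and f: "\<And>s. s \<in> {0..t} \<Longrightarrow> (f has_vector_derivative f' s) (at s within {0..t})"
    and f': "continuous_on {0..t} f'"
  shows "(\<lambda>n. integral {0..t} (\<lambda>s. (real n * sinc (real n * s)) *\<^sub>R f s)) \<longlonglongrightarrow> (pi / 2) *\<^sub>R f 0"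
proof -
  have cf: "continuous_on {0..t} f" using f by (meson continuous_on_vector_derivative)
  have cSi: "continuous_on A (\<lambda>s. Si (real n * s))" for n A
    by (rule continuous_on_compose2[of UNIV Si])
       (auto intro!: continuous_at_imp_continuous_on isCont_Si continuous_intros)
  obtain K where K: "\<And>s. s \<in> {0..t} \<Longrightarrow> norm (f' s) \<le> K" 
    using compact_imp_bounded[OF compact_continuous_image[OF f' compact_Icc]]
    unfolding bounded_iff by (metis image_eqI)
  define g where "g n = integral {0..t} (\<lambda>s. \<bar>Si (real n * s) - pi / 2\<bar>)" for n
  have Si0: "Si 0 = 0" using Si_neg[of 0] by simp
  obtain B where B: "\<And>u. \<bar>Si u\<bar> \<le> B" using bounded_Si by blast
  have lim_Si: "(\<lambda>n. Si (real n * s)) \<longlonglongrightarrow> pi / 2" if "s > 0" for s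
  proof -
    have "filterlim (\<lambda>n. real n * s) at_top sequentially"
      using filterlim_tendsto_pos_mult_at_top[OF tendsto_const that filterlim_real_sequentially]
      by (simp add: mult.commute)
    then show ?thesis by (rule filterlim_compose[OF Si_at_top])
  qed
  \<comment> \<open>Convergence to 0 fails at s = 0 only, where \<open>Si\<close> vanishes for every
    n; a single point does not affect the integral.\<close>
  have "g \<longlonglongrightarrow> integral {0..t} (\<lambda>s. if s = 0 then pi / 2 else 0)"
    unfolding g_def
  proof (rule dominated_convergence(2)[where h="\<lambda>_. B + pi / 2"])
    show "(\<lambda>s. \<bar>Si (real n * s) - pi / 2\<bar>) integrable_on {0..t}" for n
      by (intro integrable_continuous_real continuous_intros cSi)
    show "norm \<bar>Si (real n * s) - pi / 2\<bar> \<le> B + pi / 2" for n s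
      using B[of "real n * s"] pi_ge_zero unfolding real_norm_def abs_le_iff by linarith
    show "(\<lambda>n. \<bar>Si (real n * s) - pi / 2\<bar>) \<longlonglongrightarrow> (if s = 0 then pi / 2 else 0)" if "s \<in> {0..t}" for s
    proof (cases "s = 0")
      case False
      then have "s > 0" using that by auto
      from tendsto_rabs[OF tendsto_diff[OF lim_Si[OF this] tendsto_const[of "pi / 2"]]]
      show ?thesis using False by simp
    qed (simp add: Si0)
  qed (rule integrable_const_ivl)
  also have "integral {0..t} (\<lambda>s. if s = 0 then pi / 2 else 0) = integral {0..t} (\<lambda>s. 0::real)"
    by (rule integral_spike[of "{0}"]) auto
  finally have g: "g \<longlonglongrightarrow> 0" by simp
  have bound: "norm (integral {0..t} (\<lambda>s. (real n * sinc (real n * s)) *\<^sub>R f s) - (pi / 2) *\<^sub>R f 0)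
    \<le> \<bar>Si (real n * t) - pi / 2\<bar> * norm (f t) + K * g n" for n
  proof -
    \<comment> \<open>Subtracting \<open>pi / 2\<close> selects the primitive of the kernel that
      tends to 0 away from s = 0. After integration by parts only the boundary value at 0 survives
      the limit, at the price of one derivative of f.\<close>
    have D: "((\<lambda>s. (Si (real n * s) - pi / 2) *\<^sub>R f s) has_vector_derivative
       (Si (real n * s) - pi / 2) *\<^sub>R f' s + (real n * sinc (real n * s)) *\<^sub>R f s) (at s within {0..t})"
      if "s \<in> {0..t}" for s
    proof -
      have "((\<lambda>s. Si (real n * s)) has_real_derivative sinc (real n * s) * real n) (at s within {0..t})"
        by (intro DERIV_chain'[where f="\<lambda>s. real n * s"] has_field_derivative_at_within[OF DERIV_Si])
           (auto intro!: derivative_eq_intros)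
      then have "((\<lambda>s. Si (real n * s) - pi / 2) has_vector_derivative real n * sinc (real n * s)) (at s within {0..t})"
        unfolding has_real_derivative_iff_has_vector_derivative[symmetric]
        by (auto intro!: derivative_eq_intros simp: mult.commute)
      from has_vector_derivative_scaleR[OF this[folded has_real_derivative_iff_has_vector_derivative] f[OF that]]
      show ?thesis by simp
    qed
    have i1: "(\<lambda>s. (Si (real n * s) - pi / 2) *\<^sub>R f' s) integrable_on {0..t}"
      by (intro integrable_continuous_real continuous_intros cSi f')
    have i2: "(\<lambda>s. (real n * sinc (real n * s)) *\<^sub>R f s) integrable_on {0..t}"
      by (intro integrable_continuous_real continuous_on_scaleR cf continuous_on_mult continuous_on_const continuous_on_sinc continuous_on_id)
    have "((\<lambda>s. (Si (real n * s) - pi / 2) *\<^sub>R f' s + (real n * sinc (real n * s)) *\<^sub>R f s) has_integral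
      (Si (real n * t) - pi / 2) *\<^sub>R f t - (Si (real n * 0) - pi / 2) *\<^sub>R f 0) {0..t}"
      by (rule fundamental_theorem_of_calculus) (use t D in auto)
    then have "integral {0..t} (\<lambda>s. (Si (real n * s) - pi / 2) *\<^sub>R f' s) + integral {0..t} (\<lambda>s. (real n * sinc (real n * s)) *\<^sub>R f s)
      = (Si (real n * t) - pi / 2) *\<^sub>R f t + (pi / 2) *\<^sub>R f 0"
      using integral_add[OF i1 i2] by (simp add: integral_unique Si0)
    then have eq: "integral {0..t} (\<lambda>s. (real n * sinc (real n * s)) *\<^sub>R f s) - (pi / 2) *\<^sub>R f 0
      = (Si (real n * t) - pi / 2) *\<^sub>R f t - integral {0..t} (\<lambda>s. (Si (real n * s) - pi / 2) *\<^sub>R f' s)"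
      by (simp add: algebra_simps del: mult_eq_0_iff)
    have "norm (integral {0..t} (\<lambda>s. (Si (real n * s) - pi / 2) *\<^sub>R f' s)) \<le> integral {0..t} (\<lambda>s. \<bar>Si (real n * s) - pi / 2\<bar> * K)"
      using K by (intro integral_norm_bound_integral i1 integrable_continuous_real continuous_intros cSi) (auto intro!: mult_left_mono)
    then have "norm (integral {0..t} (\<lambda>s. (Si (real n * s) - pi / 2) *\<^sub>R f' s)) \<le> K * g n"
      by (simp add: g_def mult.commute)
    then show ?thesis unfolding eq by (intro order_trans[OF norm_triangle_ineq4]) simp
  qed
  have "(\<lambda>n. \<bar>Si (real n * t) - pi / 2\<bar> * norm (f t) + K * g n) \<longlonglongrightarrow> 0"
    using tendsto_add[OF tendsto_mult_right[OF tendsto_rabs[OF tendsto_diff[OF lim_Si[OF t] tendsto_const[of "pi / 2"]]], of "norm (f t)"]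
      tendsto_mult_left[OF g, of K]] by simp
  then have "(\<lambda>n. integral {0..t} (\<lambda>s. (real n * sinc (real n * s)) *\<^sub>R f s) - (pi / 2) *\<^sub>R f 0) \<longlonglongrightarrow> 0"
    by (rule Lim_null_comparison[OF always_eventually, rotated]) (use bound in blast)
  then show ?thesis by (rule LIM_zero_cancel)
qed

text \<open>The bound is independent of N, and its factor \<open>1 / \<omega>\<close> becomes t for
  the later choice \<open>\<omega> = 1 / t\<close>.\<close>

lemma integral_inverse_sum_squares_le:
  assumes "0 < \<omega>" "0 \<le> N" "0 \<le> c"
  shows "(\<lambda>y. c / (\<omega>\<^sup>2 + y\<^sup>2)) integrable_on {-N..N}"
    and "integral {-N..N} (\<lambda>y. c / (\<omega>\<^sup>2 + y\<^sup>2)) \<le> c * pi / \<omega>"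
proof -
  have "((\<lambda>y. c / (\<omega>\<^sup>2 + y\<^sup>2)) has_integral c / \<omega> * arctan (N / \<omega>) - c / \<omega> * arctan (- N / \<omega>)) {-N..N}"
  proof (rule fundamental_theorem_of_calculus)
    fix y assume "y \<in> {-N..N}"
    have \<omega>0: "\<omega> \<noteq> 0" using assms by simp
    have "\<omega>\<^sup>2 + y\<^sup>2 > 0" using assms by (simp add: add_pos_nonneg)
    have "((\<lambda>y. c / \<omega> * arctan (y / \<omega>)) has_real_derivative c / (\<omega>\<^sup>2 + y\<^sup>2)) (at y within {-N..N})"
      by (rule derivative_eq_intros refl \<omega>0)+
         (use assms \<open>\<omega>\<^sup>2 + y\<^sup>2 > 0\<close> in \<open>simp add: divide_simps power2_eq_square\<close>)
    then show "((\<lambda>y. c / \<omega> * arctan (y / \<omega>)) has_vector_derivative c / (\<omega>\<^sup>2 + y\<^sup>2)) (at y within {-N..N})"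
      by (simp add: has_real_derivative_iff_has_vector_derivative)
  qed (use assms in auto)
  moreover have "c / \<omega> * arctan (N / \<omega>) - c / \<omega> * arctan (- N / \<omega>) = c / \<omega> * (2 * arctan (N / \<omega>))"
    by (simp add: arctan_minus)
  moreover have "\<dots> \<le> c / \<omega> * pi"
    using assms arctan_ubound[of "N / \<omega>"] by (intro mult_left_mono) auto
  ultimately show "(\<lambda>y. c / (\<omega>\<^sup>2 + y\<^sup>2)) integrable_on {-N..N}"
    and "integral {-N..N} (\<lambda>y. c / (\<omega>\<^sup>2 + y\<^sup>2)) \<le> c * pi / \<omega>"
    by (auto simp: integral_unique integrable_on_def)
qed

section \<open>Inverse Laplace transform on a vertical line\<close>

definition vline :: "real \<Rightarrow> real \<Rightarrow> complex" where
  "vline \<omega> y = - complex_of_real \<omega> + \<i> * complex_of_real y"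

lemma Re_vline [simp]: "Re (vline \<omega> y) = - \<omega>"
  and Im_vline [simp]: "Im (vline \<omega> y) = y"
  by (simp_all add: vline_def)

lemma cmod_vline_square: "(cmod (vline \<omega> y))\<^sup>2 = \<omega>\<^sup>2 + y\<^sup>2"
  by (simp add: cmod_power2)

lemma vline_nonzero: "\<omega> > 0 \<Longrightarrow> vline \<omega> y \<noteq> 0"
  by (metis Re_vline neg_equal_0_iff_equal order_less_irrefl zero_complex.simps(1))

lemma vline_has_vector_derivative: "(vline \<omega> has_vector_derivative \<i>) (at y within S)"
  unfolding vline_def by (auto intro!: derivative_eq_intros)

lemma continuous_on_vline [continuous_intros]:
  "continuous_on S f \<Longrightarrow> continuous_on S g \<Longrightarrow> continuous_on S (\<lambda>s. vline (f s) (g s))"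
  unfolding vline_def by (intro continuous_intros)

lemma norm_exp_vline: "cmod (exp (- vline \<omega> y * complex_of_real t)) = exp (\<omega> * t)"
  by simp

lemma exp_vline_has_vector_derivative:
  "((\<lambda>y. exp (- vline \<omega> y * complex_of_real t)) has_vector_derivative
     - \<i> * complex_of_real t * exp (- vline \<omega> y * complex_of_real t)) (at y within S)"
proof -
  have "((\<lambda>y. - vline \<omega> y * complex_of_real t) has_vector_derivative - \<i> * complex_of_real t) (at y within S)"
    unfolding vline_def by (auto intro!: derivative_eq_intros)
  then have "(exp \<circ> (\<lambda>y. - vline \<omega> y * complex_of_real t) has_vector_derivative
     (- \<i> * complex_of_real t) * exp (- vline \<omega> y * complex_of_real t)) (at y within S)"
    by (rule field_vector_diff_chain_within) (auto intro!: derivative_eq_intros)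
  then show ?thesis by (simp add: comp_def)
qed

text \<open>The y-integral of the exponential is the Dirichlet kernel; written with
  \<open>sinc\<close>, the formula includes s = 0, where the value is 2N.\<close>

lemma integral_exp_vline:
  assumes "0 \<le> N"
  shows "((\<lambda>y. exp (- vline \<omega> y * complex_of_real s)) has_integral
      complex_of_real (2 * exp (\<omega> * s) * (N * sinc (N * s)))) {-N..N}"
proof (cases "s = 0")
  case True
  have "((\<lambda>y::real. 1::complex) has_integral complex_of_real (2 * N)) {-N..N}"
    using has_integral_const_real[of "1::complex" "-N" N] assms by (simp add: scaleR_conv_of_real)
  then show ?thesis using True by simp
next
  case False
  define F where "F y = exp (- vline \<omega> y * complex_of_real s) / (- \<i> * complex_of_real s)" for y
  have "((\<lambda>y. exp (- vline \<omega> y * complex_of_real s)) has_integral F N - F (- N)) {-N..N}"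
  proof (rule fundamental_theorem_of_calculus)
    fix y
    show "(F has_vector_derivative exp (- vline \<omega> y * complex_of_real s)) (at y within {-N..N})"
      unfolding F_def
      using has_vector_derivative_divide[OF exp_vline_has_vector_derivative[of \<omega> s y "{-N..N}"], of "- \<i> * complex_of_real s"] False
      by simp
  qed (use assms in auto)
  moreover have "F N - F (- N) = complex_of_real (2 * exp (\<omega> * s) * (sin (N * s) / s))"
  proof -
    have *: "exp (- vline \<omega> y * complex_of_real s)
        = complex_of_real (exp (\<omega> * s)) * (complex_of_real (cos (y * s)) - \<i> * complex_of_real (sin (y * s)))" for y
      by (simp add: complex_eq_iff Re_exp Im_exp)
    show ?thesis unfolding F_def * using False by (simp add: field_simps)
  qed
  moreover have "N * sinc (N * s) = sin (N * s) / s" using False by auto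
  ultimately show ?thesis by simp
qed

lemma integral_inverse_vline:
  assumes "0 < \<omega>" "0 \<le> N"
  shows "((\<lambda>y. 1 / vline \<omega> y) has_integral complex_of_real (- 2 * arctan (N / \<omega>))) {-N..N}"
proof -
  \<comment> \<open>Up to an additive constant this is -i log z with the argument taken in (pi/2, 3
    pi/2), a branch that is smooth along the line although the line crosses the negative axis. The
    logarithmic part is even in y and cancels between the end points.\<close>
  define F where "F y = complex_of_real (- arctan (y / \<omega>)) - \<i> * complex_of_real (ln (\<omega>\<^sup>2 + y\<^sup>2) / 2)" for y
  have "((\<lambda>y. 1 / vline \<omega> y) has_integral F N - F (- N)) {-N..N}"
  proof (rule fundamental_theorem_of_calculus)
    fix y
    have \<omega>0: "\<omega> \<noteq> 0" using assms by simp
    have p: "\<omega>\<^sup>2 + y\<^sup>2 > 0" using assms by (simp add: add_pos_nonneg)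
    have 1: "((\<lambda>y. - arctan (y / \<omega>)) has_real_derivative - \<omega> / (\<omega>\<^sup>2 + y\<^sup>2)) (at y within {-N..N})"
      by (rule derivative_eq_intros refl \<omega>0)+
         (use assms p in \<open>simp add: divide_simps power2_eq_square\<close>)
    have 2: "((\<lambda>y. ln (\<omega>\<^sup>2 + y\<^sup>2) / 2) has_real_derivative y / (\<omega>\<^sup>2 + y\<^sup>2)) (at y within {-N..N})"
      by (rule derivative_eq_intros refl p zero_neq_numeral[symmetric])+ (use p in \<open>simp add: divide_simps\<close>)
    have "1 / vline \<omega> y = complex_of_real (- \<omega> / (\<omega>\<^sup>2 + y\<^sup>2)) - \<i> * complex_of_real (y / (\<omega>\<^sup>2 + y\<^sup>2))"
      using p by (simp add: complex_eq_iff Re_divide Im_divide power2_eq_square[of "_ + _"])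
    moreover have "(F has_vector_derivative complex_of_real (- \<omega> / (\<omega>\<^sup>2 + y\<^sup>2)) - \<i> * complex_of_real (y / (\<omega>\<^sup>2 + y\<^sup>2))) (at y within {-N..N})"
      unfolding F_def
      by (intro has_vector_derivative_diff has_vector_derivative_mult_right has_vector_derivative_of_real 1 2)
    ultimately show "(F has_vector_derivative 1 / vline \<omega> y) (at y within {-N..N})" by simp
  qed (use assms in auto)
  then show ?thesis by (simp add: F_def arctan_minus)
qed

section \<open>Calculus of the resolvent and the inversion formula\<close>

context resolvent_semigroup
begin

text \<open>Places the values of every resolvent in the range of \<open>R 0\<close>, where orbits of
  \<open>E\<close> are differentiable.\<close>

lemma R_eq_R_0: "Re z \<le> 0 \<Longrightarrow> R z x = R 0 (x - z *\<^sub>C R z x)"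
  using resolvent_identity[of 0 z x]
  by (simp add: linear_diff[OF bounded_linear.linear[OF R_bounded_linear[of 0]]] R_cmult diff_eq_eq eq_diff_eq add.commute)

text \<open>Read backwards: \<open>R z (R 0 x)\<close> is \<open>(R 0 x - R z x)\<close> divided by
  z, an explicit 1/z term plus a remainder of order |z|^-2.\<close>

lemma R_eq_R_R_0: "Re z \<le> 0 \<Longrightarrow> R z x = R 0 x - z *\<^sub>C R z (R 0 x)"
  using resolvent_identity[of z 0 x] by (simp add: algebra_simps cmult.minus_left)

lemma norm_R_le: "Re z \<le> 0 \<Longrightarrow> z \<noteq> 0 \<Longrightarrow> norm (R z x) \<le> M / cmod z * norm x"
  using R_bound[of z x] by (simp add: field_simps)

text \<open>The bound M/|z| is at most doubled near z, and the resolvent identity then gives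
  continuity. The point 0 is excluded because \<open>R_bound\<close> carries no information
  there.\<close>

lemma tendsto_R:
  assumes f: "(f \<longlongrightarrow> z) F" and g: "(g \<longlongrightarrow> x) F" and f0: "\<forall>\<^sub>F k in F. Re (f k) \<le> 0" and z: "Re z \<le> 0" "z \<noteq> 0"
  shows "((\<lambda>k. R (f k) (g k)) \<longlongrightarrow> R z x) F"
proof -
  define K where "K = M / (cmod z / 2)"
  have "((\<lambda>k. cmod (f k)) \<longlongrightarrow> cmod z) F" using f by (rule tendsto_norm)
  then have ev: "\<forall>\<^sub>F k in F. cmod z / 2 < cmod (f k)" using z order_tendstoD(1)[of _ "cmod z" F "cmod z / 2"] by simp
  have "((\<lambda>k. K * norm (g k - x) + cmod (z - f k) * (K * norm (R z x))) \<longlongrightarrow> K * norm (x - x) + cmod (z - z) * (K * norm (R z x))) F"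
    by (intro tendsto_intros f g)
  then have "((\<lambda>k. K * norm (g k - x) + cmod (z - f k) * (K * norm (R z x))) \<longlongrightarrow> 0) F" by simp
  moreover have "\<forall>\<^sub>F k in F. norm (R (f k) (g k) - R z x) \<le> K * norm (g k - x) + cmod (z - f k) * (K * norm (R z x))"
    using ev f0
  proof eventually_elim
    case (elim k)
    interpret bounded_linear "R (f k)" using elim by (intro R_bounded_linear)
    have K: "norm (R (f k) y) \<le> K * norm y" for y
    proof -
      have "f k \<noteq> 0" using elim(1) by auto
      then have "norm (R (f k) y) \<le> M / cmod (f k) * norm y" using elim by (intro norm_R_le)
      also have "\<dots> \<le> K * norm y" unfolding K_def
        using elim z M_ge_1 by (intro mult_right_mono divide_left_mono mult_pos_pos) (auto simp: \<open>f k \<noteq> 0\<close>)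
      finally show ?thesis .
    qed
    have "R (f k) (g k) - R z x = R (f k) (g k - x) + (R (f k) x - R z x)" by (simp add: diff)
    also have "\<dots> = R (f k) (g k - x) + (z - f k) *\<^sub>C R (f k) (R z x)"
      using elim z by (simp add: resolvent_identity)
    also have "norm \<dots> \<le> K * norm (g k - x) + cmod (z - f k) * (K * norm (R z x))"
      by (intro norm_triangle_mono K) (auto simp: norm_cmult intro!: mult_left_mono K)
    finally show ?case .
  qed
  ultimately have "((\<lambda>k. R (f k) (g k) - R z x) \<longlongrightarrow> 0) F"
    by (rule Lim_null_comparison[rotated])
  then show ?thesis by (rule LIM_zero_cancel)
qed

lemma continuous_on_R:
  assumes "continuous_on S f" "continuous_on S g" "\<And>s. s \<in> S \<Longrightarrow> Re (f s) \<le> 0" "\<And>s. s \<in> S \<Longrightarrow> f s \<noteq> 0"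
  shows "continuous_on S (\<lambda>s. R (f s) (g s))"
  using assms unfolding continuous_on_def
  by (auto intro!: tendsto_R simp: eventually_at_filter)

text \<open>Holomorphy in the form of derivatives along real curves, R' = -R^2 by the resolvent
  identity. Both motion along a vertical line and the horizontal shift of that line are such
  curves.\<close>

lemma R_has_vector_derivative:
  assumes \<gamma>: "(\<gamma> has_vector_derivative \<gamma>') (at s within S)" and g: "(g has_vector_derivative g') (at s within S)"
    and S: "\<And>s. s \<in> S \<Longrightarrow> Re (\<gamma> s) \<le> 0" and s: "s \<in> S" "\<gamma> s \<noteq> 0"
  shows "((\<lambda>s. R (\<gamma> s) (g s)) has_vector_derivative
     R (\<gamma> s) g' - \<gamma>' *\<^sub>C R (\<gamma> s) (R (\<gamma> s) (g s))) (at s within S)"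
proof -
  let ?F = "at s within S"
  have c: "(\<gamma> \<longlongrightarrow> \<gamma> s) ?F"
    using has_vector_derivative_continuous[OF \<gamma>] by (simp add: continuous_within)
  have ev: "\<forall>\<^sub>F y in ?F. Re (\<gamma> y) \<le> 0" using S by (auto simp: eventually_at_filter)
  have 1: "((\<lambda>y. R (\<gamma> y) ((1 / (y - s)) *\<^sub>R (g y - g s))) \<longlongrightarrow> R (\<gamma> s) g') ?F"
    using g s S by (intro tendsto_R c ev) (auto simp: has_vector_derivative_iff_quotient)
  have "((\<lambda>y. (1 / (y - s)) *\<^sub>R (\<gamma> y - \<gamma> s)) \<longlongrightarrow> \<gamma>') ?F"
    using \<gamma> by (simp add: has_vector_derivative_iff_quotient)
  then have 2: "((\<lambda>y. ((1 / (y - s)) *\<^sub>R (\<gamma> y - \<gamma> s)) *\<^sub>C R (\<gamma> y) (R (\<gamma> s) (g s))) \<longlongrightarrow> \<gamma>' *\<^sub>C R (\<gamma> s) (R (\<gamma> s) (g s))) ?F"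
    using s S by (intro cmult.tendsto tendsto_R c ev tendsto_const) auto
  have "R (\<gamma> y) ((1 / (y - s)) *\<^sub>R (g y - g s)) - ((1 / (y - s)) *\<^sub>R (\<gamma> y - \<gamma> s)) *\<^sub>C R (\<gamma> y) (R (\<gamma> s) (g s))
     = (1 / (y - s)) *\<^sub>R (R (\<gamma> y) (g y) - R (\<gamma> s) (g s))" if "y \<in> S" for y
  proof -
    interpret bounded_linear "R (\<gamma> y)" using that S by (intro R_bounded_linear)
    have "R (\<gamma> y) (g s) - R (\<gamma> s) (g s) = - ((\<gamma> y - \<gamma> s) *\<^sub>C R (\<gamma> y) (R (\<gamma> s) (g s)))"
      using that s S by (subst resolvent_identity) (auto simp: cmult.diff_left)
    then have "R (\<gamma> y) (g y) - R (\<gamma> s) (g s) = R (\<gamma> y) (g y - g s) - (\<gamma> y - \<gamma> s) *\<^sub>C R (\<gamma> y) (R (\<gamma> s) (g s))"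
      by (simp add: diff algebra_simps)
    then show ?thesis by (simp only: scaleR cmult.scaleR_left scaleR_diff_right[symmetric])
  qed
  then have "((\<lambda>y. (1 / (y - s)) *\<^sub>R (R (\<gamma> y) (g y) - R (\<gamma> s) (g s))) \<longlongrightarrow>
      R (\<gamma> s) g' - \<gamma>' *\<^sub>C R (\<gamma> s) (R (\<gamma> s) (g s))) ?F"
    by (intro Lim_transform_eventually[OF tendsto_diff[OF 1 2]]) (auto simp: eventually_at_filter)
  then show ?thesis by (simp add: has_vector_derivative_iff_quotient)
qed

text \<open>The integrand is the derivative of -exp(-zs) E(t-s) R(z)x: differentiating the
  exponential produces the z-term that cancels the one in \<open>u\<close>, leaving x alone.\<close>

lemma truncated_laplace:
  assumes t: "0 \<le> t" and z: "Re z \<le> 0"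
  shows "((\<lambda>s. exp (- z * complex_of_real s) *\<^sub>C E (t - s) x) has_integral
     E t (R z x) - exp (- z * complex_of_real t) *\<^sub>C R z x) {0..t}"
proof -
  \<comment> \<open>This is minus the generator's operator B applied to \<open>R z x\<close>,
    expressed without reference to B.\<close>
  define u where "u = x - z *\<^sub>C R z x"
  have Rz: "R z x = R 0 u" unfolding u_def using R_eq_R_0[OF z] by simp
  define F where "F s = - (exp (- z * complex_of_real s) *\<^sub>C E (t - s) (R 0 u))" for s
  have "((\<lambda>s. exp (- z * complex_of_real s) *\<^sub>C E (t - s) x) has_integral F t - F 0) {0..t}"
  proof (rule fundamental_theorem_of_calculus[OF t])
    fix s assume s: "s \<in> {0..t}"
    interpret Es: bounded_linear "E (t - s)" using s by (intro E_bounded_linear) auto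
    have "((\<lambda>s. exp (- z * complex_of_real s)) has_vector_derivative - z * exp (- z * complex_of_real s)) (at s within {0..t})"
    proof -
      have "((\<lambda>s. - z * complex_of_real s) has_vector_derivative - z) (at s within {0..t})"
        by (auto intro!: derivative_eq_intros)
      then have "(exp \<circ> (\<lambda>s. - z * complex_of_real s) has_vector_derivative - z * exp (- z * complex_of_real s)) (at s within {0..t})"
        by (rule field_vector_diff_chain_within) (auto intro!: derivative_eq_intros)
      then show ?thesis by (simp add: comp_def)
    qed
    moreover have "((\<lambda>s. E (t - s) (R 0 u)) has_vector_derivative E (t - s) (R 0 0) - E (t - s) u) (at s within {0..t})"
      by (rule E_reverse_R_0_has_vector_derivative) (use s in auto)
    ultimately have "((\<lambda>s. exp (- z * complex_of_real s) *\<^sub>C E (t - s) (R 0 u)) has_vector_derivative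
        exp (- z * complex_of_real s) *\<^sub>C (E (t - s) (R 0 0) - E (t - s) u)
        + (- z * exp (- z * complex_of_real s)) *\<^sub>C E (t - s) (R 0 u)) (at s within {0..t})"
      by (rule cmult.has_vector_derivative)
    moreover have "exp (- z * complex_of_real s) *\<^sub>C (E (t - s) (R 0 0) - E (t - s) u)
        + (- z * exp (- z * complex_of_real s)) *\<^sub>C E (t - s) (R 0 u) = - (exp (- z * complex_of_real s) *\<^sub>C E (t - s) x)"
    proof -
      have "E (t - s) (R 0 0) = 0"
        using linear_0[OF bounded_linear.linear[OF R_bounded_linear[of 0]]] by (simp add: Es.zero)
      moreover have "E (t - s) u = E (t - s) x - z *\<^sub>C E (t - s) (R 0 u)"
        using s by (subst (1) u_def) (simp add: Es.diff E_cmult Rz[symmetric])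
      moreover have "(- z * exp (- z * complex_of_real s)) *\<^sub>C E (t - s) (R 0 u) = - (exp (- z * complex_of_real s) *\<^sub>C z *\<^sub>C E (t - s) (R 0 u))"
        by (simp add: cmult_cmult cmult.minus_left mult.commute)
      ultimately show ?thesis by (simp add: cmult.diff_right cmult.minus_right)
    qed
    ultimately show "(F has_vector_derivative exp (- z * complex_of_real s) *\<^sub>C E (t - s) x) (at s within {0..t})"
      unfolding F_def using has_vector_derivative_minus by fastforce
  qed
  \<comment> \<open>At s = t the value involves the projection \<open>E 0\<close>, which is the
    identity on the range of \<open>R 0\<close>.\<close>
  then show ?thesis by (simp add: F_def Rz E_0_R_0)
qed

text \<open>The integral hardly changes when the segment is shifted from \<open>Re z = -\<omega>\<close> to \<open>Re z = -N\<close>, where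
the integrand is \<open>O(N\<^sup>-\<^sup>2)\<close>.\<close>

lemma integral_R_over_z_vanishes:
  assumes \<omega>: "0 < \<omega>" "\<omega> \<le> N"
  shows "norm (integral {-N..N} (\<lambda>y. (1 / vline \<omega> y) *\<^sub>C R (vline \<omega> y) v)) \<le> 4 * M * norm v / N"
proof -
  have N: "0 < N" using \<omega> by simp
  define g where "g z = (1 / z) *\<^sub>C R z v" for z
  define g' where "g' z = (1 / z) *\<^sub>C (- R z (R z v)) + (- 1 / z\<^sup>2) *\<^sub>C R z v" for z
  have deriv: "((\<lambda>s. g (\<gamma> s)) has_vector_derivative \<gamma>' *\<^sub>C g' (\<gamma> s)) (at s within S)"
    if "(\<gamma> has_vector_derivative \<gamma>') (at s within S)" "\<And>s. s \<in> S \<Longrightarrow> Re (\<gamma> s) \<le> 0" "s \<in> S" "\<gamma> s \<noteq> 0" for \<gamma> \<gamma>' s S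
  proof -
    interpret bounded_linear "R (\<gamma> s)" using that by (intro R_bounded_linear)
    have "((\<lambda>z. 1 / z) \<circ> \<gamma> has_vector_derivative \<gamma>' * (- 1 / (\<gamma> s)\<^sup>2)) (at s within S)"
      using that(1) by (rule field_vector_diff_chain_within)
        (use that in \<open>auto intro!: derivative_eq_intros simp: power2_eq_square\<close>)
    moreover have "((\<lambda>s. R (\<gamma> s) v) has_vector_derivative R (\<gamma> s) 0 - \<gamma>' *\<^sub>C R (\<gamma> s) (R (\<gamma> s) v)) (at s within S)"
      using that by (intro R_has_vector_derivative) auto
    ultimately have "((\<lambda>s. ((\<lambda>z. 1 / z) \<circ> \<gamma>) s *\<^sub>C R (\<gamma> s) v) has_vector_derivative
      ((\<lambda>z. 1 / z) \<circ> \<gamma>) s *\<^sub>C (R (\<gamma> s) 0 - \<gamma>' *\<^sub>C R (\<gamma> s) (R (\<gamma> s) v)) + (\<gamma>' * (- 1 / (\<gamma> s)\<^sup>2)) *\<^sub>C R (\<gamma> s) v) (at s within S)"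
      by (rule cmult.has_vector_derivative)
    then show ?thesis
      by (simp add: g_def g'_def comp_def zero cmult.add_right cmult.diff_right cmult_cmult cmult.minus_right cmult.minus_left mult.commute)
  qed
  have norm_g: "norm (g z) \<le> M * norm v / N\<^sup>2" if "Re z \<le> 0" "N \<le> cmod z" for z
  proof -
    have "z \<noteq> 0" using that N by auto
    have "norm (g z) = norm (R z v) / cmod z" by (simp add: g_def norm_cmult norm_divide)
    also have "\<dots> \<le> (M / cmod z * norm v) / cmod z"
      using norm_R_le[OF that(1) \<open>z \<noteq> 0\<close>] by (intro divide_right_mono) auto
    also have "\<dots> = M * norm v / (cmod z)\<^sup>2" by (simp add: power2_eq_square)
    also have "\<dots> \<le> M * norm v / N\<^sup>2"
      using that N M_ge_1 by (intro divide_left_mono mult_nonneg_nonneg power_mono mult_pos_pos) auto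
    finally show ?thesis .
  qed
  define J where "J x = integral {-N..N} (\<lambda>y. g (vline x y))" for x
  have cont: "continuous_on ({\<omega>..N} \<times> {-N..N}) (\<lambda>p. g' (vline (fst p) (snd p)))"
    unfolding g'_def using \<omega>
    by (intro continuous_intros continuous_on_R cmult.continuous_on) (auto simp: vline_nonzero)
  \<comment> \<open>Cauchy's theorem for a rectangle in differential form: shifting the line changes
    J only through values of g on the two horizontal sides, where |z| \<ge> N.\<close>
  have "(J has_vector_derivative integral {-N..N} (\<lambda>y. - 1 *\<^sub>C g' (vline x y))) (at x within {\<omega>..N})"
    if x: "x \<in> {\<omega>..N}" for x
    unfolding J_def box_real[symmetric]
  proof (rule leibniz_rule_vector_derivative[where U="cbox \<omega> N" and fx="\<lambda>x y. - 1 *\<^sub>C g' (vline x y)"])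
    show "((\<lambda>x. g (vline x y)) has_vector_derivative - 1 *\<^sub>C g' (vline x y)) (at x within cbox \<omega> N)"
      if "x \<in> cbox \<omega> N" for x y
      using that \<omega> by (intro deriv) (auto simp: vline_nonzero vline_def intro!: derivative_eq_intros)
    show "(\<lambda>y. g (vline x y)) integrable_on cbox (- N) N" if "x \<in> cbox \<omega> N" for x
      unfolding g_def using that \<omega>
      by (intro integrable_continuous continuous_intros continuous_on_R cmult.continuous_on) (auto simp: vline_nonzero)
    show "continuous_on (cbox \<omega> N \<times> cbox (- N) N) (\<lambda>(x, y). - 1 *\<^sub>C g' (vline x y))"
      using cont by (auto simp: case_prod_unfold intro!: cmult.continuous_on continuous_intros)
  qed (use x in auto)
  moreover have "norm (integral {-N..N} (\<lambda>y. - 1 *\<^sub>C g' (vline x y))) \<le> 2 * (M * norm v / N\<^sup>2)" if x: "x \<in> {\<omega>..N}" for x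
  proof -
    \<comment> \<open>Along the vertical line the derivative of g is
      \<open>\<i> *\<^sub>C g'\<close>; one more factor i turns its integral into the integral of
      -g', the derivative of J.\<close>
    have "((\<lambda>y. \<i> *\<^sub>C g' (vline x y)) has_integral g (vline x N) - g (vline x (- N))) {-N..N}"
      using x \<omega> by (intro fundamental_theorem_of_calculus deriv vline_has_vector_derivative) (auto simp: vline_nonzero)
    from has_integral_linear[OF this cmult.bounded_linear_right[of \<i>]]
    have "integral {-N..N} (\<lambda>y. - 1 *\<^sub>C g' (vline x y)) = \<i> *\<^sub>C (g (vline x N) - g (vline x (- N)))"
      by (intro integral_unique) (simp add: comp_def cmult_cmult)
    then have "norm (integral {-N..N} (\<lambda>y. - 1 *\<^sub>C g' (vline x y))) = norm (g (vline x N) - g (vline x (- N)))"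
      by (simp add: norm_cmult)
    also have "\<dots> \<le> M * norm v / N\<^sup>2 + M * norm v / N\<^sup>2"
      using x \<omega> abs_Im_le_cmod[of "vline x N"] abs_Im_le_cmod[of "vline x (- N)"]
      by (intro order_trans[OF norm_triangle_ineq4] add_mono norm_g) auto
    finally show ?thesis by simp
  qed
  ultimately have 1: "norm (J N - J \<omega>) \<le> 2 * (M * norm v / N\<^sup>2) * (N - \<omega>)"
    using \<omega> by (intro norm_diff_le_vector_derivative_bound) auto
  \<comment> \<open>On the far line |z| \<ge> N as well, so the integrand is small against the
    length 2N. This and the two horizontal sides contribute 2 each to the constant 4.\<close>
  have 2: "norm (J N) \<le> M * norm v / N\<^sup>2 * (N - (- N))"
    unfolding J_def
  proof (rule integral_bound)
    show "continuous_on {- N..N} (\<lambda>y. g (vline N y))"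
      unfolding g_def using N
      by (intro continuous_intros continuous_on_R cmult.continuous_on) (auto simp: vline_nonzero)
    show "norm (g (vline N y)) \<le> M * norm v / N\<^sup>2" for y
      using N abs_Re_le_cmod[of "vline N y"] by (intro norm_g) auto
  qed (use N in auto)
  have "norm (J \<omega>) \<le> norm (J N) + norm (J N - J \<omega>)"
    by (metis norm_minus_commute norm_triangle_sub)
  also have "\<dots> \<le> M * norm v / N\<^sup>2 * (N - (- N)) + 2 * (M * norm v / N\<^sup>2) * N"
  proof -
    have "2 * (M * norm v / N\<^sup>2) * (N - \<omega>) \<le> 2 * (M * norm v / N\<^sup>2) * N"
      using \<omega> M_ge_1 by (intro mult_left_mono) auto
    then show ?thesis using 1 2 by linarith
  qed
  also have "\<dots> = 4 * M * norm v / N" using N by (simp add: field_simps power2_eq_square)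
  finally show ?thesis by (simp add: J_def g_def)
qed

text \<open>By \<open>R_eq_R_R_0\<close> the integrand splits into (1/z) R(0)v, whose integral tends
  to -pi R(0)v through the arctangent, and a part that vanishes. This is the inversion formula at
  the jump t = 0, hence half of the factor -2 pi.\<close>

lemma integral_R_tendsto:
  assumes \<omega>: "0 < \<omega>"
  shows "(\<lambda>n. integral {- real n..real n} (\<lambda>y. R (vline \<omega> y) (R 0 v))) \<longlonglongrightarrow> (- pi) *\<^sub>R R 0 v"
proof -
  have eq: "integral {- real n..real n} (\<lambda>y. R (vline \<omega> y) (R 0 v)) =
    (- 2 * arctan (real n / \<omega>)) *\<^sub>R R 0 v - integral {- real n..real n} (\<lambda>y. (1 / vline \<omega> y) *\<^sub>C R (vline \<omega> y) v)" for n
  proof -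
    have "R (vline \<omega> y) (R 0 v) = (1 / vline \<omega> y) *\<^sub>C R 0 v - (1 / vline \<omega> y) *\<^sub>C R (vline \<omega> y) v" for y
    proof -
      have "vline \<omega> y *\<^sub>C R (vline \<omega> y) (R 0 v) = R 0 v - R (vline \<omega> y) v"
        using \<omega> R_eq_R_R_0[of "vline \<omega> y" v] by (simp add: algebra_simps)
      then have "(1 / vline \<omega> y) *\<^sub>C vline \<omega> y *\<^sub>C R (vline \<omega> y) (R 0 v) = (1 / vline \<omega> y) *\<^sub>C (R 0 v - R (vline \<omega> y) v)" by simp
      then show ?thesis using vline_nonzero[OF \<omega>] by (simp add: cmult_cmult cmult.diff_right)
    qed
    moreover have "((\<lambda>y. (1 / vline \<omega> y) *\<^sub>C R 0 v) has_integral (- 2 * arctan (real n / \<omega>)) *\<^sub>R R 0 v) {- real n..real n}"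
      using has_integral_linear[OF integral_inverse_vline[OF \<omega>, of "real n"] cmult.bounded_linear_left[of "R 0 v"]]
      by (simp add: comp_def cmult_of_real[symmetric])
    moreover have "(\<lambda>y. (1 / vline \<omega> y) *\<^sub>C R (vline \<omega> y) v) integrable_on {- real n..real n}"
      using \<omega> by (intro integrable_continuous_real continuous_intros continuous_on_R cmult.continuous_on) (auto simp: vline_nonzero)
    ultimately show ?thesis by (simp add: integral_diff integral_unique has_integral_integrable)
  qed
  have "(\<lambda>n. integral {- real n..real n} (\<lambda>y. (1 / vline \<omega> y) *\<^sub>C R (vline \<omega> y) v)) \<longlonglongrightarrow> 0"
  proof (rule Lim_null_comparison)
    show "\<forall>\<^sub>F n in sequentially. norm (integral {- real n..real n} (\<lambda>y. (1 / vline \<omega> y) *\<^sub>C R (vline \<omega> y) v)) \<le> 4 * M * norm v / real n"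
      using eventually_ge_at_top[of "nat \<lceil>\<omega>\<rceil>"]
      by eventually_elim (use \<omega> in \<open>intro integral_R_over_z_vanishes, auto simp: nat_le_iff ceiling_le_iff\<close>)
    show "(\<lambda>n. 4 * M * norm v / real n) \<longlonglongrightarrow> 0" by (rule lim_const_over_n)
  qed
  moreover have "(\<lambda>n. (- 2 * arctan (real n / \<omega>)) *\<^sub>R R 0 v) \<longlonglongrightarrow> (- 2 * (pi / 2)) *\<^sub>R R 0 v"
  proof -
    have "filterlim (\<lambda>n. real n / \<omega>) at_top sequentially"
      using filterlim_tendsto_pos_mult_at_top[OF tendsto_const[of "1 / \<omega>"] _ filterlim_real_sequentially] \<omega> by simp
    then have "(\<lambda>n. arctan (real n / \<omega>)) \<longlonglongrightarrow> pi / 2"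
      by (rule filterlim_compose[OF tendsto_arctan_at_top])
    then show ?thesis by (intro tendsto_intros)
  qed
  ultimately show ?thesis unfolding eq using tendsto_diff by fastforce
qed

text \<open>Integrating \<open>truncated_laplace\<close> in y and exchanging the integrals leaves
  \<open>E t\<close> applied to the integral of the resolvent, and a Dirichlet integral of the
  orbit. Vectors \<open>R 0 v\<close> are taken because the Dirichlet limit asks for a continuously
  differentiable orbit.\<close>

lemma inverse_laplace_tendsto:
  assumes \<omega>: "0 < \<omega>" and t: "0 < t"
  shows "(\<lambda>n. integral {- real n..real n} (\<lambda>y. exp (- vline \<omega> y * complex_of_real t) *\<^sub>C R (vline \<omega> y) (R 0 v)))
     \<longlonglongrightarrow> (- 2 * pi) *\<^sub>R E t (R 0 v)"
proof -
  interpret Et: bounded_linear "E t" using t by (intro E_bounded_linear) auto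
  define w where "w = R 0 v"
  define f where "f s = exp (\<omega> * s) *\<^sub>R E (t - s) w" for s
  have eq: "integral {- real n..real n} (\<lambda>y. exp (- vline \<omega> y * complex_of_real t) *\<^sub>C R (vline \<omega> y) w)
    = E t (integral {- real n..real n} (\<lambda>y. R (vline \<omega> y) w))
      - 2 *\<^sub>R integral {0..t} (\<lambda>s. (real n * sinc (real n * s)) *\<^sub>R f s)" for n
  proof -
    let ?h = "\<lambda>y s. exp (- vline \<omega> y * complex_of_real s) *\<^sub>C E (t - s) w"
    have i1: "(\<lambda>y. R (vline \<omega> y) w) integrable_on {- real n..real n}"
      using \<omega> by (intro integrable_continuous_real continuous_intros continuous_on_R) (auto simp: vline_nonzero)
    have c: "continuous_on (cbox (- real n, 0) (real n, t)) (\<lambda>(y, s). ?h y s)"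
      unfolding case_prod_unfold
      by (intro cmult.continuous_on continuous_intros continuous_on_E) (auto simp: cbox_Pair_eq)
    have "integral {- real n..real n} (\<lambda>y. exp (- vline \<omega> y * complex_of_real t) *\<^sub>C R (vline \<omega> y) w)
      = integral {- real n..real n} (\<lambda>y. E t (R (vline \<omega> y) w) - integral {0..t} (?h y))"
      using integral_unique[OF truncated_laplace[of t "vline \<omega> _" w]] t \<omega> by (intro integral_cong) simp
    also have "\<dots> = integral {- real n..real n} (\<lambda>y. E t (R (vline \<omega> y) w)) - integral {- real n..real n} (\<lambda>y. integral {0..t} (?h y))"
    proof (rule integral_diff)
      show "(\<lambda>y. E t (R (vline \<omega> y) w)) integrable_on {- real n..real n}"
        using integrable_linear[OF i1 Et.bounded_linear_axioms] by (simp add: comp_def)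
      show "(\<lambda>y. integral {0..t} (?h y)) integrable_on {- real n..real n}"
        using integral_integrable_2dim[OF c] by simp
    qed
    also have "integral {- real n..real n} (\<lambda>y. E t (R (vline \<omega> y) w)) = E t (integral {- real n..real n} (\<lambda>y. R (vline \<omega> y) w))"
      using integral_linear[OF i1 Et.bounded_linear_axioms] by (simp add: comp_def)
    also have "integral {- real n..real n} (\<lambda>y. integral {0..t} (?h y)) = integral {0..t} (\<lambda>s. integral {- real n..real n} (\<lambda>y. ?h y s))"
      using integral_swap_continuous[OF c] by simp
    also have "\<dots> = integral {0..t} (\<lambda>s. 2 *\<^sub>R ((real n * sinc (real n * s)) *\<^sub>R f s))"
    proof (rule integral_cong)
      fix s
      have "((\<lambda>y. ?h y s) has_integral complex_of_real (2 * exp (\<omega> * s) * (real n * sinc (real n * s))) *\<^sub>C E (t - s) w) {- real n..real n}"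
        using has_integral_linear[OF integral_exp_vline[of "real n" \<omega> s] cmult.bounded_linear_left[of "E (t - s) w"]]
        by (simp only: comp_def)
      then show "integral {- real n..real n} (\<lambda>y. ?h y s) = 2 *\<^sub>R ((real n * sinc (real n * s)) *\<^sub>R f s)"
        unfolding cmult_of_real f_def by (simp add: integral_unique mult_ac)
    qed
    also have "\<dots> = 2 *\<^sub>R integral {0..t} (\<lambda>s. (real n * sinc (real n * s)) *\<^sub>R f s)"
      by (rule integral_cmul)
    finally show ?thesis .
  qed
  have "(\<lambda>n. integral {0..t} (\<lambda>s. (real n * sinc (real n * s)) *\<^sub>R f s)) \<longlonglongrightarrow> (pi / 2) *\<^sub>R f 0"
  proof (rule dirichlet_kernel_tendsto[OF t])
    fix s assume s: "s \<in> {0..t}"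
    have "((\<lambda>s. E (t - s) (R 0 v)) has_vector_derivative E (t - s) (R 0 0) - E (t - s) v) (at s within {0..t})"
      by (rule E_reverse_R_0_has_vector_derivative) (use s in auto)
    moreover have "((\<lambda>s. exp (\<omega> * s)) has_real_derivative \<omega> * exp (\<omega> * s)) (at s within {0..t})"
      by (auto intro!: derivative_eq_intros)
    ultimately show "(f has_vector_derivative exp (\<omega> * s) *\<^sub>R (E (t - s) (R 0 0) - E (t - s) v) + (\<omega> * exp (\<omega> * s)) *\<^sub>R E (t - s) (R 0 v)) (at s within {0..t})"
      unfolding f_def w_def by (intro has_vector_derivative_scaleR)
  next
    show "continuous_on {0..t} (\<lambda>s. exp (\<omega> * s) *\<^sub>R (E (t - s) (R 0 0) - E (t - s) v) + (\<omega> * exp (\<omega> * s)) *\<^sub>R E (t - s) (R 0 v))"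
      by (intro continuous_intros continuous_on_E) auto
  qed
  then have "(\<lambda>n. E t (integral {- real n..real n} (\<lambda>y. R (vline \<omega> y) w))
      - 2 *\<^sub>R integral {0..t} (\<lambda>s. (real n * sinc (real n * s)) *\<^sub>R f s)) \<longlonglongrightarrow> E t ((- pi) *\<^sub>R w) - 2 *\<^sub>R ((pi / 2) *\<^sub>R f 0)"
    unfolding w_def by (intro tendsto_intros Et.tendsto integral_R_tendsto[OF \<omega>])
  \<comment> \<open>The two limits contribute -pi E(t)w each.\<close>
  moreover have "E t ((- pi) *\<^sub>R w) - 2 *\<^sub>R ((pi / 2) *\<^sub>R f 0) = (- 2 * pi) *\<^sub>R E t w"
  proof -
    have "(- 2 * pi) *\<^sub>R E t w = (- pi) *\<^sub>R E t w - pi *\<^sub>R E t w"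
      unfolding scaleR_diff_left[symmetric] by simp
    then show ?thesis by (simp add: f_def Et.scaleR linear_neg[OF Et.linear])
  qed
  ultimately show ?thesis unfolding eq[symmetric] by (simp add: w_def)
qed

end

text \<open>The exponential has y-derivative -it times itself, so each integration by parts gains a
  factor t at the cost of end point values, which are O(1/N) for the resolvent.\<close>

lemma oscillatory_by_parts:
  fixes F :: "real \<Rightarrow> 'a::cbanach"
  assumes N: "0 \<le> N" and t: "0 \<le> t"
    and F: "\<And>y. y \<in> {-N..N} \<Longrightarrow> (F has_vector_derivative F' y) (at y within {-N..N})"
    and F': "continuous_on {-N..N} F'"
  shows "t * norm (integral {-N..N} (\<lambda>y. exp (- vline \<omega> y * complex_of_real t) *\<^sub>C F y))
    \<le> exp (\<omega> * t) * (norm (F N) + norm (F (- N)))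
      + norm (integral {-N..N} (\<lambda>y. exp (- vline \<omega> y * complex_of_real t) *\<^sub>C F' y))"
proof -
  define e where "e y = exp (- vline \<omega> y * complex_of_real t)" for y
  have cF: "continuous_on {-N..N} F" using F by (meson continuous_on_vector_derivative)
  have ce: "continuous_on {-N..N} e" unfolding e_def by (intro continuous_intros)
  have i1: "(\<lambda>y. e y *\<^sub>C F' y) integrable_on {-N..N}" and i2: "(\<lambda>y. e y *\<^sub>C F y) integrable_on {-N..N}"
    by (intro integrable_continuous_real cmult.continuous_on ce cF F')+
  have i3: "(\<lambda>y. (- \<i> * complex_of_real t * e y) *\<^sub>C F y) integrable_on {-N..N}"
    by (intro integrable_continuous_real cmult.continuous_on continuous_intros ce cF)
  have "((\<lambda>y. e y *\<^sub>C F' y + (- \<i> * complex_of_real t * e y) *\<^sub>C F y) has_integral e N *\<^sub>C F N - e (- N) *\<^sub>C F (- N)) {-N..N}"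
    unfolding e_def using N
    by (intro fundamental_theorem_of_calculus cmult.has_vector_derivative exp_vline_has_vector_derivative F) auto
  then have "integral {-N..N} (\<lambda>y. e y *\<^sub>C F' y) + integral {-N..N} (\<lambda>y. (- \<i> * complex_of_real t * e y) *\<^sub>C F y) = e N *\<^sub>C F N - e (- N) *\<^sub>C F (- N)"
    using integral_add[OF i1 i3] by (simp add: integral_unique)
  moreover have "integral {-N..N} (\<lambda>y. (- \<i> * complex_of_real t * e y) *\<^sub>C F y) = (- \<i> * complex_of_real t) *\<^sub>C integral {-N..N} (\<lambda>y. e y *\<^sub>C F y)"
    using integral_linear[OF i2 cmult.bounded_linear_right[of "- \<i> * complex_of_real t"]] by (simp add: comp_def cmult_cmult)
  ultimately have "(- \<i> * complex_of_real t) *\<^sub>C integral {-N..N} (\<lambda>y. e y *\<^sub>C F y) = e N *\<^sub>C F N - e (- N) *\<^sub>C F (- N) - integral {-N..N} (\<lambda>y. e y *\<^sub>C F' y)"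
    by (simp add: algebra_simps)
  moreover have "t * norm (integral {-N..N} (\<lambda>y. e y *\<^sub>C F y)) = norm ((- \<i> * complex_of_real t) *\<^sub>C integral {-N..N} (\<lambda>y. e y *\<^sub>C F y))"
    using t by (simp add: norm_cmult norm_mult)
  ultimately have "t * norm (integral {-N..N} (\<lambda>y. e y *\<^sub>C F y)) = norm (e N *\<^sub>C F N - e (- N) *\<^sub>C F (- N) - integral {-N..N} (\<lambda>y. e y *\<^sub>C F' y))"
    by simp
  also have "\<dots> \<le> norm (e N *\<^sub>C F N) + norm (e (- N) *\<^sub>C F (- N)) + norm (integral {-N..N} (\<lambda>y. e y *\<^sub>C F' y))"
    by (intro order_trans[OF norm_triangle_ineq4] add_right_mono norm_triangle_ineq4)
  finally show ?thesis by (simp add: e_def norm_cmult algebra_simps)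
qed

section \<open>Decay of resolvent powers along the line\<close>

context resolvent_semigroup
begin

lemma norm_R_vline_le: "0 < \<omega> \<Longrightarrow> norm (R (vline \<omega> y) x) \<le> M / cmod (vline \<omega> y) * norm x"
  by (intro norm_R_le) (auto simp: vline_nonzero)

lemma norm_integral_exp_vline_le:
  assumes \<omega>: "0 < \<omega>" and N: "0 \<le> N" and c: "0 \<le> c" and F: "continuous_on {-N..N} F"
    and le: "\<And>y. norm (F y) \<le> c / (cmod (vline \<omega> y))\<^sup>2"
  shows "norm (integral {-N..N} (\<lambda>y. exp (- vline \<omega> y * complex_of_real t) *\<^sub>C F y)) \<le> exp (\<omega> * t) * c * pi / \<omega>"
proof -
  have "norm (integral {-N..N} (\<lambda>y. exp (- vline \<omega> y * complex_of_real t) *\<^sub>C F y))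
    \<le> integral {-N..N} (\<lambda>y. (exp (\<omega> * t) * c) / (\<omega>\<^sup>2 + y\<^sup>2))"
  proof (rule integral_norm_bound_integral)
    show "(\<lambda>y. exp (- vline \<omega> y * complex_of_real t) *\<^sub>C F y) integrable_on {-N..N}"
      by (intro integrable_continuous_real cmult.continuous_on continuous_intros F)
    show "(\<lambda>y. (exp (\<omega> * t) * c) / (\<omega>\<^sup>2 + y\<^sup>2)) integrable_on {-N..N}"
      using \<omega> N c by (intro integral_inverse_sum_squares_le) auto
    show "norm (exp (- vline \<omega> y * complex_of_real t) *\<^sub>C F y) \<le> exp (\<omega> * t) * c / (\<omega>\<^sup>2 + y\<^sup>2)" for y
      using mult_left_mono[OF le[of y], of "exp (\<omega> * t)"] unfolding norm_cmult norm_exp_vline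
      by (simp add: cmod_vline_square)
  qed
  also have "\<dots> \<le> exp (\<omega> * t) * c * pi / \<omega>"
    using \<omega> N c by (intro integral_inverse_sum_squares_le) auto
  finally show ?thesis .
qed

lemma continuous_on_R_vline:
  "0 < \<omega> \<Longrightarrow> continuous_on S g \<Longrightarrow> continuous_on S (\<lambda>y. R (vline \<omega> y) (g y))"
  by (intro continuous_on_R continuous_intros) (auto simp: vline_nonzero)

lemma norm_R2_vline_le:
  assumes "0 < \<omega>"
  shows "norm (R (vline \<omega> y) (R (vline \<omega> y) x)) \<le> M\<^sup>2 * norm x / (cmod (vline \<omega> y))\<^sup>2"
proof -
  let ?z = "vline \<omega> y"
  have "norm (R ?z (R ?z x)) \<le> M / cmod ?z * norm (R ?z x)" by (rule norm_R_vline_le[OF assms])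
  also have "\<dots> \<le> M / cmod ?z * (M / cmod ?z * norm x)"
    using M_ge_1 by (intro mult_left_mono norm_R_vline_le[OF assms]) auto
  finally show ?thesis by (simp add: power2_eq_square)
qed

text \<open>One power of |z|^-1 is given up in exchange for \<open>norm (R 0 x)\<close> in place of
  \<open>norm x\<close>: the innermost factor is rewritten by \<open>R_eq_R_R_0\<close>, and both
  resulting terms are of order |z|^-2. This exchange is the source of the smoothing bound.\<close>

lemma norm_R3_vline_le:
  assumes "0 < \<omega>"
  shows "norm (R (vline \<omega> y) (R (vline \<omega> y) (R (vline \<omega> y) x))) \<le> 2 * M ^ 3 * norm (R 0 x) / (cmod (vline \<omega> y))\<^sup>2"
proof -
  let ?z = "vline \<omega> y" and ?u = "R 0 x"
  have z: "Re ?z \<le> 0" "?z \<noteq> 0" using assms by (auto simp: vline_nonzero)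
  interpret bounded_linear "R ?z" by (rule R_bounded_linear[OF z(1)])
  have "R ?z (R ?z (R ?z x)) = R ?z (R ?z ?u) - ?z *\<^sub>C R ?z (R ?z (R ?z ?u))"
    by (subst (3) R_eq_R_R_0[OF z(1)]) (simp add: diff R_cmult[OF z(1)])
  also have "norm \<dots> \<le> M\<^sup>2 * norm ?u / (cmod ?z)\<^sup>2 + cmod ?z * (M\<^sup>2 * norm (R ?z ?u) / (cmod ?z)\<^sup>2)"
    by (intro order_trans[OF norm_triangle_ineq4] add_mono norm_R2_vline_le[OF assms],
        unfold norm_cmult, intro mult_left_mono norm_R2_vline_le[OF assms] norm_ge_zero)
  also have "cmod ?z * (M\<^sup>2 * norm (R ?z ?u) / (cmod ?z)\<^sup>2) = M\<^sup>2 * (cmod ?z * norm (R ?z ?u)) / (cmod ?z)\<^sup>2"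
    by simp
  also have "M\<^sup>2 * norm ?u / (cmod ?z)\<^sup>2 + \<dots> \<le> M ^ 3 * norm ?u / (cmod ?z)\<^sup>2 + M\<^sup>2 * (M * norm ?u) / (cmod ?z)\<^sup>2"
    using M_ge_1 R_bound[OF z(1), of ?u]
    by (intro add_mono divide_right_mono mult_right_mono mult_left_mono power_increasing) auto
  also have "\<dots> = 2 * M ^ 3 * norm ?u / (cmod ?z)\<^sup>2"
    by (simp add: power2_eq_square power3_eq_cube mult.assoc add_divide_distrib[symmetric])
  finally show ?thesis .
qed

section \<open>Bounds for the semigroup\<close>

lemma E_bounds_R_0:
  assumes t: "0 < t"
  shows "norm (E t (R 0 v)) \<le> exp 1 * M\<^sup>2 * norm (R 0 v)"
    and "t * norm (E t (R 0 v)) \<le> 2 * exp 1 * M ^ 3 * norm (R 0 (R 0 v))"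
proof -
  \<comment> \<open>With this choice |exp(-zt)| = e on the line, and the factor pi/\<omega> = pi t
    from the absolutely convergent integral cancels one factor t gained by parts.\<close>
  define \<omega> where "\<omega> = 1 / t"
  have \<omega>: "0 < \<omega>" and \<omega>t: "\<omega> * t = 1" using t by (auto simp: \<omega>_def)
  define w where "w = R 0 v"
  define e where "e y = exp (- vline \<omega> y * complex_of_real t)" for y
  define Y where "Y n = integral {- real n..real n} (\<lambda>y. e y *\<^sub>C R (vline \<omega> y) w)" for n
  define Y2 where "Y2 n = integral {- real n..real n} (\<lambda>y. e y *\<^sub>C R (vline \<omega> y) (R (vline \<omega> y) w))" for n
  have "Y \<longlonglongrightarrow> (- 2 * pi) *\<^sub>R E t w"
    unfolding Y_def e_def w_def by (rule inverse_laplace_tendsto[OF \<omega> t])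
  then have Y: "(\<lambda>n. norm (Y n)) \<longlonglongrightarrow> 2 * pi * norm (E t w)"
    using tendsto_norm[of Y "(- 2 * pi) *\<^sub>R E t w"] by simp
  have R1: "((\<lambda>y. R (vline \<omega> y) w) has_vector_derivative - \<i> *\<^sub>C R (vline \<omega> y) (R (vline \<omega> y) w)) (at y within S)" if "y \<in> S" for y S
    using R_has_vector_derivative[OF vline_has_vector_derivative has_vector_derivative_const[of w], of S \<omega> y] that \<omega>
    by (simp add: vline_nonzero linear_0[OF bounded_linear.linear[OF R_bounded_linear]] cmult.minus_left)
  have R2: "((\<lambda>y. R (vline \<omega> y) (R (vline \<omega> y) w)) has_vector_derivative
      (- 2 * \<i>) *\<^sub>C R (vline \<omega> y) (R (vline \<omega> y) (R (vline \<omega> y) w))) (at y within S)" if "y \<in> S" for y S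
  proof -
    let ?z = "vline \<omega> y"
    have "R ?z (- \<i> *\<^sub>C R ?z (R ?z w)) - \<i> *\<^sub>C R ?z (R ?z (R ?z w)) = (- 2 * \<i>) *\<^sub>C R ?z (R ?z (R ?z w))"
      using \<omega> by (simp add: R_cmult cmult.diff_left[symmetric])
    then show ?thesis
      using R_has_vector_derivative[OF vline_has_vector_derivative R1, of y S \<omega>] that \<omega> by (simp add: vline_nonzero)
  qed
  have bY: "t * norm (Y n) \<le> 2 * exp 1 * M * norm w / real n + norm (Y2 n)" if "0 < n" for n
  proof -
    have "t * norm (Y n) \<le> exp (\<omega> * t) * (norm (R (vline \<omega> (real n)) w) + norm (R (vline \<omega> (- real n)) w))
      + norm (integral {- real n..real n} (\<lambda>y. e y *\<^sub>C (- \<i> *\<^sub>C R (vline \<omega> y) (R (vline \<omega> y) w))))"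
      unfolding Y_def e_def
      by (intro oscillatory_by_parts R1 cmult.continuous_on continuous_intros continuous_on_R_vline \<omega>) (use t in auto)
    also have "integral {- real n..real n} (\<lambda>y. e y *\<^sub>C (- \<i> *\<^sub>C R (vline \<omega> y) (R (vline \<omega> y) w))) = - \<i> *\<^sub>C Y2 n"
    proof -
      have "(\<lambda>y. e y *\<^sub>C R (vline \<omega> y) (R (vline \<omega> y) w)) integrable_on {- real n..real n}"
        unfolding e_def
        by (intro integrable_continuous_real cmult.continuous_on continuous_intros continuous_on_R_vline \<omega>)
      from integral_linear[OF this cmult.bounded_linear_right[of "- \<i>"]]
      show ?thesis by (simp add: Y2_def comp_def cmult_cmult mult.commute)
    qed
    also have "norm (- \<i> *\<^sub>C Y2 n) = norm (Y2 n)" by (simp add: norm_cmult)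
    also have "exp (\<omega> * t) * (norm (R (vline \<omega> (real n)) w) + norm (R (vline \<omega> (- real n)) w)) \<le> exp 1 * (M / real n * norm w + M / real n * norm w)"
    proof -
      have "norm (R (vline \<omega> y) w) \<le> M / real n * norm w" if "\<bar>y\<bar> = real n" for y
      proof -
        have "real n \<le> cmod (vline \<omega> y)" using abs_Im_le_cmod[of "vline \<omega> y"] that by simp
        then have "M / cmod (vline \<omega> y) * norm w \<le> M / real n * norm w"
          using M_ge_1 \<open>0 < n\<close> by (intro mult_right_mono divide_left_mono mult_pos_pos) auto
        then show ?thesis using norm_R_vline_le[OF \<omega>, of y w] by linarith
      qed
      then show ?thesis unfolding \<omega>t by (intro mult_left_mono add_mono) auto
    qed
    finally show ?thesis by (simp add: mult_ac add_divide_distrib[symmetric])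
  qed
  have bY2: "norm (Y2 n) \<le> exp 1 * (M\<^sup>2 * norm w) * pi * t" for n
  proof -
    have "norm (Y2 n) \<le> exp (\<omega> * t) * (M\<^sup>2 * norm w) * pi / \<omega>"
      unfolding Y2_def e_def
      by (intro norm_integral_exp_vline_le norm_R2_vline_le \<omega> continuous_on_R_vline continuous_on_const) auto
    then show ?thesis unfolding \<omega>t by (simp add: \<omega>_def)
  qed
  \<comment> \<open>A factor 2 comes from differentiating R^2 and another from
    \<open>norm_R3_vline_le\<close>; divided by the 2 pi of the inversion formula they leave the
    constant 2 e M^3.\<close>
  have bY2': "t * norm (Y2 n) \<le> 2 * exp 1 * M\<^sup>2 * norm w / (real n)\<^sup>2 + 2 * (exp 1 * (2 * M ^ 3 * norm (R 0 w)) * pi * t)" if "0 < n" for n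
  proof -
    let ?R3 = "\<lambda>y. R (vline \<omega> y) (R (vline \<omega> y) (R (vline \<omega> y) w))"
    have "t * norm (Y2 n) \<le> exp (\<omega> * t) * (norm (R (vline \<omega> (real n)) (R (vline \<omega> (real n)) w)) + norm (R (vline \<omega> (- real n)) (R (vline \<omega> (- real n)) w)))
      + norm (integral {- real n..real n} (\<lambda>y. e y *\<^sub>C ((- 2 * \<i>) *\<^sub>C ?R3 y)))"
      unfolding Y2_def e_def
      by (intro oscillatory_by_parts R2 cmult.continuous_on continuous_intros continuous_on_R_vline \<omega>) (use t in auto)
    also have "integral {- real n..real n} (\<lambda>y. e y *\<^sub>C ((- 2 * \<i>) *\<^sub>C ?R3 y)) = (- 2 * \<i>) *\<^sub>C integral {- real n..real n} (\<lambda>y. e y *\<^sub>C ?R3 y)"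
    proof -
      have "(\<lambda>y. e y *\<^sub>C ?R3 y) integrable_on {- real n..real n}"
        unfolding e_def
        by (intro integrable_continuous_real cmult.continuous_on continuous_intros continuous_on_R_vline \<omega>)
      from integral_linear[OF this cmult.bounded_linear_right[of "- 2 * \<i>"]]
      show ?thesis by (simp add: comp_def cmult_cmult mult.commute)
    qed
    also have "norm ((- 2 * \<i>) *\<^sub>C integral {- real n..real n} (\<lambda>y. e y *\<^sub>C ?R3 y)) \<le> 2 * (exp 1 * (2 * M ^ 3 * norm (R 0 w)) * pi * t)"
    proof -
      have "norm (integral {- real n..real n} (\<lambda>y. e y *\<^sub>C ?R3 y)) \<le> exp (\<omega> * t) * (2 * M ^ 3 * norm (R 0 w)) * pi / \<omega>"
        unfolding e_def using M_ge_1
        by (intro norm_integral_exp_vline_le norm_R3_vline_le \<omega> continuous_on_R_vline continuous_on_const) auto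
      then show ?thesis unfolding \<omega>t by (simp add: \<omega>_def norm_cmult norm_mult mult_ac)
    qed
    also have "exp (\<omega> * t) * (norm (R (vline \<omega> (real n)) (R (vline \<omega> (real n)) w)) + norm (R (vline \<omega> (- real n)) (R (vline \<omega> (- real n)) w)))
      \<le> exp 1 * (M\<^sup>2 * norm w / (real n)\<^sup>2 + M\<^sup>2 * norm w / (real n)\<^sup>2)"
    proof -
      have "norm (R (vline \<omega> y) (R (vline \<omega> y) w)) \<le> M\<^sup>2 * norm w / (real n)\<^sup>2" if "\<bar>y\<bar> = real n" for y
      proof -
        have "real n \<le> cmod (vline \<omega> y)" using abs_Im_le_cmod[of "vline \<omega> y"] that by simp
        then have "M\<^sup>2 * norm w / (cmod (vline \<omega> y))\<^sup>2 \<le> M\<^sup>2 * norm w / (real n)\<^sup>2"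
          using M_ge_1 \<open>0 < n\<close> by (intro divide_left_mono power_mono mult_pos_pos) auto
        then show ?thesis using norm_R2_vline_le[OF \<omega>, of y w] by linarith
      qed
      then show ?thesis unfolding \<omega>t by (intro mult_left_mono add_mono) auto
    qed
    finally show ?thesis by (simp add: mult_ac add_divide_distrib[symmetric])
  qed
  \<comment> \<open>The end point terms vanish as the segment grows, so only the integrals enter the
    final bounds.\<close>
  have lim1: "(\<lambda>n. 2 * exp 1 * M * norm w / real n) \<longlonglongrightarrow> 0" by (rule lim_const_over_n)
  have "t * (2 * pi * norm (E t w)) \<le> 0 + exp 1 * (M\<^sup>2 * norm w) * pi * t"
  proof (rule LIMSEQ_le)
    show "(\<lambda>n. t * norm (Y n)) \<longlonglongrightarrow> t * (2 * pi * norm (E t w))" by (rule tendsto_mult_left[OF Y])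
    show "(\<lambda>n. 2 * exp 1 * M * norm w / real n + exp 1 * (M\<^sup>2 * norm w) * pi * t) \<longlonglongrightarrow> 0 + exp 1 * (M\<^sup>2 * norm w) * pi * t"
      by (rule tendsto_add[OF lim1 tendsto_const])
    show "\<exists>N. \<forall>n\<ge>N. t * norm (Y n) \<le> 2 * exp 1 * M * norm w / real n + exp 1 * (M\<^sup>2 * norm w) * pi * t"
    proof (intro exI[of _ 1] allI impI)
      fix n :: nat assume "1 \<le> n"
      then show "t * norm (Y n) \<le> 2 * exp 1 * M * norm w / real n + exp 1 * (M\<^sup>2 * norm w) * pi * t"
        using bY[of n] bY2[of n] by simp
    qed
  qed
  then have "(t * pi) * (2 * norm (E t w)) \<le> (t * pi) * (exp 1 * (M\<^sup>2 * norm w))" by (simp add: mult_ac)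
  then have "2 * norm (E t w) \<le> exp 1 * (M\<^sup>2 * norm w)" using t by (simp add: mult_le_cancel_left)
  then show "norm (E t (R 0 v)) \<le> exp 1 * M\<^sup>2 * norm (R 0 v)"
    using norm_ge_zero[of "E t w"] unfolding w_def mult.assoc by linarith
  have lim2: "(\<lambda>n. 2 * exp 1 * M\<^sup>2 * norm w / (real n)\<^sup>2) \<longlonglongrightarrow> 0"
    by (rule tendsto_divide_0[OF tendsto_const])
       (auto intro!: filterlim_at_top_imp_at_infinity filterlim_pow_at_top filterlim_real_sequentially)
  let ?c = "2 * (exp 1 * (2 * M ^ 3 * norm (R 0 w)) * pi * t)"
  have "t * (t * (2 * pi * norm (E t w))) \<le> t * 0 + (0 + ?c)"
  proof (rule LIMSEQ_le)
    show "(\<lambda>n. t * (t * norm (Y n))) \<longlonglongrightarrow> t * (t * (2 * pi * norm (E t w)))" by (intro tendsto_mult_left Y)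
    show "(\<lambda>n. t * (2 * exp 1 * M * norm w / real n) + (2 * exp 1 * M\<^sup>2 * norm w / (real n)\<^sup>2 + ?c)) \<longlonglongrightarrow> t * 0 + (0 + ?c)"
      by (intro tendsto_add tendsto_mult_left lim1 lim2 tendsto_const)
    show "\<exists>N. \<forall>n\<ge>N. t * (t * norm (Y n)) \<le> t * (2 * exp 1 * M * norm w / real n) + (2 * exp 1 * M\<^sup>2 * norm w / (real n)\<^sup>2 + ?c)"
    proof (intro exI[of _ 1] allI impI)
      fix n :: nat assume "1 \<le> n"
      then have "t * (t * norm (Y n)) \<le> t * (2 * exp 1 * M * norm w / real n + norm (Y2 n))"
        using t bY[of n] by (intro mult_left_mono) auto
      then show "t * (t * norm (Y n)) \<le> t * (2 * exp 1 * M * norm w / real n) + (2 * exp 1 * M\<^sup>2 * norm w / (real n)\<^sup>2 + ?c)"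
        using bY2'[of n] \<open>1 \<le> n\<close> by (simp add: distrib_left)
    qed
  qed
  then have "(2 * pi * t) * (t * norm (E t w)) \<le> (2 * pi * t) * (2 * exp 1 * M ^ 3 * norm (R 0 w))" by (simp add: mult_ac)
  then show "t * norm (E t (R 0 v)) \<le> 2 * exp 1 * M ^ 3 * norm (R 0 (R 0 v))"
    using t by (simp add: mult_le_cancel_left w_def)
qed

text \<open>Extends bounds from the range of \<open>R 0\<close> to the range of \<open>E 0\<close>,
  and then to all vectors because \<open>E t\<close> absorbs \<open>E 0\<close>.\<close>

lemma range_R_0_approx:
  obtains v where "(\<lambda>n. R 0 (v n)) \<longlonglongrightarrow> E 0 x"
proof -
  have "E 0 x \<in> closure (range (R 0))" using range_E_0_subset by auto
  then obtain g where g: "\<And>n. g n \<in> range (R 0)" "g \<longlonglongrightarrow> E 0 x"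
    by (auto simp: closure_sequential)
  then have "\<forall>n. \<exists>v. g n = R 0 v" by blast
  then obtain v where "\<And>n. g n = R 0 (v n)" by metis
  then have "g = (\<lambda>n. R 0 (v n))" by auto
  then show thesis using g(2) that[of v] by simp
qed

text \<open>One constant for both bounds: 2 e M^3 is the smoothing constant, and it dominates e M^2
  times the extra M that bounds \<open>E 0\<close>. It depends on M only, so two semigroups with the
  same M share it.\<close>

definition growth_const :: real where "growth_const = 2 * exp 1 * M ^ 3"

lemma growth_const_ge_1: "1 \<le> growth_const"
proof -
  have "1 \<le> exp (1::real)" by simp
  moreover have "1 \<le> M ^ 3" using M_ge_1 by (rule one_le_power)
  ultimately show ?thesis unfolding growth_const_def using mult_mono[of 1 "exp 1" 1 "M ^ 3"] by simp
qed

lemma norm_E_le: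
  assumes t: "0 \<le> t"
  shows "norm (E t x) \<le> growth_const * norm x"
proof (cases "t = 0")
  case True
  have "M \<le> M ^ 3" using M_ge_1 power_increasing[of 1 3 M] by simp
  moreover have "M ^ 3 \<le> growth_const"
    unfolding growth_const_def using M_ge_1 mult_right_mono[of 1 "2 * exp 1" "M ^ 3"] exp_ge_add_one_self[of 1] by simp
  ultimately have "M * norm x \<le> growth_const * norm x" by (intro mult_right_mono) auto
  then show ?thesis using norm_E_0[of x] True by simp
next
  case False
  then have t: "0 < t" using t by simp
  interpret Et: bounded_linear "E t" using t by (intro E_bounded_linear) auto
  obtain v where v: "(\<lambda>n. R 0 (v n)) \<longlonglongrightarrow> E 0 x" by (rule range_R_0_approx)
  have "norm (E t (E 0 x)) \<le> exp 1 * M\<^sup>2 * norm (E 0 x)"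
  proof (rule LIMSEQ_le)
    show "(\<lambda>n. norm (E t (R 0 (v n)))) \<longlonglongrightarrow> norm (E t (E 0 x))"
      by (intro tendsto_norm Et.tendsto v)
    show "(\<lambda>n. exp 1 * M\<^sup>2 * norm (R 0 (v n))) \<longlonglongrightarrow> exp 1 * M\<^sup>2 * norm (E 0 x)"
      by (intro tendsto_mult_left tendsto_norm v)
  qed (use E_bounds_R_0(1)[OF t] in blast)
  also have "\<dots> \<le> exp 1 * M\<^sup>2 * (M * norm x)"
    using norm_E_0[of x] by (intro mult_left_mono) auto
  also have "\<dots> \<le> growth_const * norm x"
    using M_ge_1 by (simp add: growth_const_def power2_eq_square power3_eq_cube mult_ac)
  finally show ?thesis using t by (simp add: E_E_0)
qed

lemma norm_E_smoothing:
  assumes t: "0 < t"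
  shows "norm (E t x) \<le> growth_const / t * norm (R 0 x)"
proof -
  interpret Et: bounded_linear "E t" using t by (intro E_bounded_linear) auto
  interpret R0: bounded_linear "R 0" by (rule R_bounded_linear) simp
  obtain v where v: "(\<lambda>n. R 0 (v n)) \<longlonglongrightarrow> E 0 x" by (rule range_R_0_approx)
  have "t * norm (E t (E 0 x)) \<le> growth_const * norm (R 0 (E 0 x))"
  proof (rule LIMSEQ_le)
    show "(\<lambda>n. t * norm (E t (R 0 (v n)))) \<longlonglongrightarrow> t * norm (E t (E 0 x))"
      by (intro tendsto_mult_left tendsto_norm Et.tendsto v)
    show "(\<lambda>n. growth_const * norm (R 0 (R 0 (v n)))) \<longlonglongrightarrow> growth_const * norm (R 0 (E 0 x))"
      by (intro tendsto_mult_left tendsto_norm R0.tendsto v)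
  qed (use E_bounds_R_0(2)[OF t] in \<open>auto simp: growth_const_def\<close>)
  then show ?thesis using t by (simp add: E_E_0 R_0_E_0 field_simps)
qed

end

section \<open>Comparison of two semigroups\<close>

text \<open>\<open>E\<close> is the exact semigroup and \<open>F\<close> the discrete one composed
  with its projection, so \<open>E 0\<close> is the identity while \<open>F 0\<close> is not. The
  role of \<open>\<kappa>\<close> is C h^r, and the common M gives both the same growth
  constant.\<close>

locale resolvent_semigroup_pair =
  X: resolvent_semigroup E R M + Y: resolvent_semigroup F Q M
  for E :: "real \<Rightarrow> 'a::cbanach \<Rightarrow> 'a" and R :: "complex \<Rightarrow> 'a \<Rightarrow> 'a"
    and F :: "real \<Rightarrow> 'a \<Rightarrow> 'a" and Q :: "complex \<Rightarrow> 'a \<Rightarrow> 'a" and M :: real +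
  fixes \<kappa> :: real
  assumes E_0_id: "E 0 x = x"
    and R_0_diff_le: "norm (R 0 x - Q 0 x) \<le> \<kappa> * norm x"
    and \<kappa>_nonneg: "0 \<le> \<kappa>"
begin

abbreviation C where "C \<equiv> X.growth_const"

lemmas norm_F_le = Y.norm_E_le
lemmas norm_F_smoothing = Y.norm_E_smoothing

lemma C_nonneg: "0 \<le> C"
  using X.growth_const_ge_1 by simp

lemma approx_R_0:
  obtains v where "(\<lambda>n. R 0 (v n)) \<longlonglongrightarrow> x"
  using X.range_R_0_approx[of x] by (auto simp: E_0_id)

lemma norm_F_E_mixed:
  assumes "0 \<le> s" "0 \<le> s'"
  shows "norm (F s' (R 0 (E s v) - Q 0 (E s v))) \<le> C * \<kappa> * norm (E s v)"
proof -
  have "norm (F s' (R 0 (E s v) - Q 0 (E s v))) \<le> C * norm (R 0 (E s v) - Q 0 (E s v))"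
    using assms by (intro norm_F_le)
  also have "\<dots> \<le> C * (\<kappa> * norm (E s v))" by (intro mult_left_mono R_0_diff_le C_nonneg)
  finally show ?thesis by (simp add: mult.assoc)
qed

text \<open>The derivative of \<open>s \<mapsto> F (t - s) (Q 0 (E s (R 0 v)))\<close> contains \<open>R 0 - Q 0\<close> as a factor.\<close>

lemma twisted_product_diff_le:
  assumes ab: "0 \<le> a" "a \<le> t" and K: "\<And>s. s \<in> {a..t} \<Longrightarrow> norm (E s v) \<le> K"
  shows "norm (Q 0 (E t (R 0 v)) - F (t - a) (Q 0 (E a (R 0 v)))) \<le> C * \<kappa> * K * (t - a)"
proof -
  have "norm (F (t - t) (Q 0 (E t (R 0 v))) - F (t - a) (Q 0 (E a (R 0 v)))) \<le> C * \<kappa> * K * (t - a)"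
  proof (rule norm_diff_le_vector_derivative_bound[OF ab(2)])
    fix s assume s: "s \<in> {a..t}"
    interpret Fs: bounded_linear "F (t - s)" using s by (intro Y.E_bounded_linear) auto
    have "((\<lambda>s. E s (R 0 v)) has_vector_derivative E s v) (at s within {a..t})"
      by (rule has_vector_derivative_within_subset[OF X.E_R_0_has_vector_derivative]) (use s ab in auto)
    then show "((\<lambda>s. F (t - s) (Q 0 (E s (R 0 v)))) has_vector_derivative F (t - s) (Q 0 (E s v)) - F (t - s) (E s (R 0 v))) (at s within {a..t})"
      by (rule Y.E_reverse_R_0_has_vector_derivative[OF _ s])
    have "norm (F (t - s) (Q 0 (E s v)) - F (t - s) (E s (R 0 v))) = norm (F (t - s) (R 0 (E s v) - Q 0 (E s v)))"
      using s ab by (simp add: Fs.diff X.E_R_0 norm_minus_commute)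
    also have "\<dots> \<le> C * \<kappa> * norm (E s v)" using s ab by (intro norm_F_E_mixed) auto
    also have "\<dots> \<le> C * \<kappa> * K" using s by (intro mult_left_mono K) (auto intro!: mult_nonneg_nonneg C_nonneg \<kappa>_nonneg)
    finally show "norm (F (t - s) (Q 0 (E s v)) - F (t - s) (E s (R 0 v))) \<le> C * \<kappa> * K" .
  qed
  then show ?thesis by (simp add: Y.E_0_R_0)
qed

definition G where "G t x = E t x - F t x"

lemma G_bounded_linear: "0 \<le> t \<Longrightarrow> bounded_linear (G t)"
  unfolding G_def by (intro bounded_linear_sub X.E_bounded_linear Y.E_bounded_linear)

lemma norm_G_le: "0 \<le> t \<Longrightarrow> norm (G t x) \<le> 2 * C * norm x"
  unfolding G_def using X.norm_E_le[of t x] norm_F_le[of t x] norm_triangle_ineq4[of "E t x" "F t x"] by simp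

text \<open>With \<tau> = t/2 the error is cut at \<open>F 0 (E t (R 0 y))\<close> and
  \<open>F \<tau> (E \<tau> (R 0 y))\<close>. The pieces are the projection error, the second half
  of the time interval and the first half. On each half a factor 1/\<tau> from smoothing removes an
  excess \<open>R 0\<close> or \<open>Q 0\<close>, and the length \<tau> of the half compensates
  it.\<close>

lemma norm_G_R_0_le:
  assumes t: "0 \<le> t"
  shows "norm (G t (R 0 y)) \<le> 6 * C ^ 3 * \<kappa> * norm y"
proof -
  interpret P: bounded_linear "F 0" by (rule Y.E_bounded_linear) simp
  define D where "D x = R 0 x - Q 0 x" for x
  define \<tau> where "\<tau> = t / 2"
  have \<tau>: "0 \<le> \<tau>" "\<tau> \<le> t" and t2: "\<tau> + \<tau> = t" using t by (auto simp: \<tau>_def)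
  interpret F\<tau>: bounded_linear "F \<tau>" using \<tau> by (intro Y.E_bounded_linear) auto
  interpret Ft: bounded_linear "F t" using t by (intro Y.E_bounded_linear) auto
  interpret Q0: bounded_linear "Q 0" by (rule Y.R_bounded_linear) simp
  let ?e = "C * \<kappa> * norm y"
  have e0: "0 \<le> ?e" by (intro mult_nonneg_nonneg C_nonneg \<kappa>_nonneg norm_ge_zero)
  have FD: "norm (F s' (D (E s y))) \<le> C * ?e" if "0 \<le> s" "0 \<le> s'" for s s'
  proof -
    have "norm (F s' (D (E s y))) \<le> C * \<kappa> * norm (E s y)" unfolding D_def by (rule norm_F_E_mixed[OF that])
    also have "\<dots> \<le> C * \<kappa> * (C * norm y)"
      by (intro mult_left_mono X.norm_E_le that mult_nonneg_nonneg C_nonneg \<kappa>_nonneg)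
    finally show ?thesis by (simp add: mult_ac)
  qed
  \<comment> \<open>\<open>F 0\<close> fixes the range of \<open>Q 0\<close>, so replacing
    \<open>R 0\<close> by \<open>Q 0\<close> makes the projection error a matter of D alone.\<close>
  have 1: "norm (E t (R 0 y) - F 0 (E t (R 0 y))) \<le> ?e + C * ?e"
  proof -
    have "E t (R 0 y) - F 0 (E t (R 0 y)) = D (E t y) - F 0 (D (E t y))"
      using t by (simp add: D_def X.E_R_0 P.diff Y.E_0_R_0)
    also have "norm \<dots> \<le> norm (D (E t y)) + norm (F 0 (D (E t y)))" by (rule norm_triangle_ineq4)
    also have "norm (D (E t y)) \<le> \<kappa> * norm (E t y)" unfolding D_def by (rule R_0_diff_le)
    also have "\<dots> \<le> \<kappa> * (C * norm y)" using t by (intro mult_left_mono X.norm_E_le \<kappa>_nonneg)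
    finally show ?thesis using FD[OF t order_refl] by (simp add: mult_ac)
  qed
  \<comment> \<open>Smoothing by the outer \<open>F \<tau>\<close> introduces \<open>Q 0\<close>,
    which turns the difference into a twisted product over [0,\<tau>]. The case \<tau> = 0 stands
    apart because of the division by \<tau>.\<close>
  have 2: "norm (F \<tau> (E \<tau> (R 0 y)) - F t (R 0 y)) \<le> C\<^sup>2 * ?e"
  proof (cases "\<tau> = 0")
    case True
    then have "F \<tau> (E \<tau> (R 0 y)) - F t (R 0 y) = 0" using t2 by (simp add: E_0_id)
    then show ?thesis using e0 by simp
  next
    case False
    then have \<tau>0: "0 < \<tau>" using \<tau> by simp
    have "F \<tau> (E \<tau> (R 0 y)) - F t (R 0 y) = F \<tau> (E \<tau> (R 0 y) - F \<tau> (R 0 y))"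
      using Y.E_add[of \<tau> \<tau>] \<tau> t2 by (simp add: F\<tau>.diff)
    also have "norm \<dots> \<le> C / \<tau> * norm (Q 0 (E \<tau> (R 0 y) - F \<tau> (R 0 y)))" by (rule norm_F_smoothing[OF \<tau>0])
    also have "Q 0 (E \<tau> (R 0 y) - F \<tau> (R 0 y)) = Q 0 (E \<tau> (R 0 y)) - F (\<tau> - 0) (Q 0 (E 0 (R 0 y)))"
      using \<tau> by (simp add: Q0.diff Y.E_R_0 E_0_id)
    also have "C / \<tau> * norm \<dots> \<le> C / \<tau> * (C * \<kappa> * (C * norm y) * (\<tau> - 0))"
      using \<tau> by (intro mult_left_mono twisted_product_diff_le X.norm_E_le divide_nonneg_nonneg C_nonneg) auto
    also have "\<dots> = C\<^sup>2 * ?e" using \<tau>0 by (simp add: power2_eq_square)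
    finally show ?thesis .
  qed
  \<comment> \<open>Exchanging \<open>R 0\<close> for \<open>Q 0\<close> at both ends costs two
    terms with D. What remains is the twisted product over [\<tau>,t], where smoothing of
    \<open>E\<close> at times s \<ge> \<tau> bounds it first on \<open>R 0 v\<close> and then, by
    density, on every vector.\<close>
  have 3: "norm (F 0 (E t (R 0 y)) - F \<tau> (E \<tau> (R 0 y))) \<le> 3 * (C * ?e)"
  proof -
    have q: "norm (Q 0 (E t x) - F \<tau> (Q 0 (E \<tau> x))) \<le> C * (C * \<kappa> * norm x)" for x
    proof -
      interpret Et: bounded_linear "E t" using t by (intro X.E_bounded_linear)
      interpret E\<tau>: bounded_linear "E \<tau>" using \<tau> by (intro X.E_bounded_linear)
      obtain v where v: "(\<lambda>n. R 0 (v n)) \<longlonglongrightarrow> x" by (rule approx_R_0)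
      have "norm (Q 0 (E t (R 0 v)) - F \<tau> (Q 0 (E \<tau> (R 0 v)))) \<le> C * (C * \<kappa> * norm (R 0 v))" for v
      proof (cases "\<tau> = 0")
        case True
        then have "Q 0 (E t (R 0 v)) - F \<tau> (Q 0 (E \<tau> (R 0 v))) = 0" using t2 by (simp add: Y.E_0_R_0)
        then show ?thesis by (simp add: C_nonneg \<kappa>_nonneg)
      next
        case False
        then have \<tau>0: "0 < \<tau>" using \<tau> by simp
        have "norm (Q 0 (E t (R 0 v)) - F (t - \<tau>) (Q 0 (E \<tau> (R 0 v)))) \<le> C * \<kappa> * (C / \<tau> * norm (R 0 v)) * (t - \<tau>)"
        proof (rule twisted_product_diff_le[OF \<tau>])
          fix s assume s: "s \<in> {\<tau>..t}"
          have "norm (E s v) \<le> C / s * norm (R 0 v)" using s \<tau>0 by (intro X.norm_E_smoothing) auto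
          also have "\<dots> \<le> C / \<tau> * norm (R 0 v)"
            using s \<tau>0 by (intro mult_right_mono divide_left_mono C_nonneg mult_pos_pos) auto
          finally show "norm (E s v) \<le> C / \<tau> * norm (R 0 v)" .
        qed
        moreover have "t - \<tau> = \<tau>" using t2 by simp
        ultimately show ?thesis using \<tau>0 by (simp add: mult_ac)
      qed
      then show ?thesis
        by (intro LIMSEQ_le[OF tendsto_norm[OF tendsto_diff[OF Q0.tendsto[OF Et.tendsto[OF v]] F\<tau>.tendsto[OF Q0.tendsto[OF E\<tau>.tendsto[OF v]]]]]
            tendsto_mult_left[OF tendsto_mult_left[OF tendsto_norm[OF v]]]]) auto
    qed
    have "F 0 (E t (R 0 y)) - F \<tau> (E \<tau> (R 0 y)) = F 0 (D (E t y)) - F \<tau> (D (E \<tau> y)) + (Q 0 (E t y) - F \<tau> (Q 0 (E \<tau> y)))"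
      using t \<tau> by (simp add: D_def X.E_R_0 P.diff F\<tau>.diff Y.E_0_R_0)
    also have "norm \<dots> \<le> (C * ?e + C * ?e) + C * (C * \<kappa> * norm y)"
      using t \<tau> by (intro norm_triangle_le add_mono q order_trans[OF norm_triangle_ineq4] FD) auto
    finally show ?thesis by (simp add: mult_ac)
  qed
  have "G t (R 0 y) = (E t (R 0 y) - F 0 (E t (R 0 y))) + (F 0 (E t (R 0 y)) - F \<tau> (E \<tau> (R 0 y))) + (F \<tau> (E \<tau> (R 0 y)) - F t (R 0 y))"
    by (simp add: G_def)
  also have "norm \<dots> \<le> (?e + C * ?e) + 3 * (C * ?e) + C\<^sup>2 * ?e"
    by (intro norm_triangle_le add_mono 1 2 3)
  \<comment> \<open>Every power of C is raised to the second, which is possible since C \<ge> 1; the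
    count 1 + 1 + 3 + 1 gives the 6.\<close>
  also have "\<dots> \<le> C\<^sup>2 * ?e + C\<^sup>2 * ?e + 3 * (C\<^sup>2 * ?e) + C\<^sup>2 * ?e"
  proof -
    have "C * ?e \<le> C\<^sup>2 * ?e" using X.growth_const_ge_1 power_increasing[of 1 2 C] e0 by (intro mult_right_mono) auto
    moreover have "1 * ?e \<le> C\<^sup>2 * ?e" using X.growth_const_ge_1 e0 by (intro mult_right_mono one_le_power) auto
    ultimately show ?thesis by linarith
  qed
  finally show ?thesis by (simp add: power2_eq_square power3_eq_cube mult_ac)
qed

text \<open>From G(2\<tau>) = G(\<tau>)E(\<tau>) + F(\<tau>)G(\<tau>). In each term the semigroup
  factor smooths, yielding 1/\<tau> and a spare \<open>R 0\<close> or \<open>Q 0\<close> next to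
  \<open>G \<tau>\<close>, so that \<open>norm_G_R_0_le\<close> applies.\<close>

lemma norm_G_smoothing:
  assumes t: "0 < t"
  shows "t * norm (G t x) \<le> 28 * C ^ 4 * \<kappa> * norm x"
proof -
  define \<tau> where "\<tau> = t / 2"
  have \<tau>: "0 < \<tau>" "0 \<le> \<tau>" and t2: "t = \<tau> + \<tau>" using t by (auto simp: \<tau>_def)
  interpret F\<tau>: bounded_linear "F \<tau>" using \<tau> by (intro Y.E_bounded_linear) auto
  interpret E\<tau>: bounded_linear "E \<tau>" using \<tau> by (intro X.E_bounded_linear) auto
  interpret G\<tau>: bounded_linear "G \<tau>" using \<tau> by (intro G_bounded_linear) auto
  interpret Q0: bounded_linear "Q 0" by (rule Y.R_bounded_linear) simp
  define K where "K = 6 * C ^ 3 * \<kappa>"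
  have K0: "0 \<le> K" unfolding K_def by (intro mult_nonneg_nonneg zero_le_power C_nonneg \<kappa>_nonneg) auto
  have 1: "\<tau> * norm (G \<tau> (E \<tau> x)) \<le> C * K * norm x"
  proof -
    obtain v where v: "(\<lambda>n. R 0 (v n)) \<longlonglongrightarrow> x" by (rule approx_R_0)
    \<comment> \<open>\<open>R 0\<close> is first moved left through \<open>E \<tau>\<close> to
      apply the previous bound, and then recovered on v by smoothing.\<close>
    have "\<tau> * norm (G \<tau> (E \<tau> (R 0 v))) \<le> C * K * norm (R 0 v)" for v
    proof -
      have "norm (G \<tau> (E \<tau> (R 0 v))) \<le> K * norm (E \<tau> v)"
        unfolding K_def X.E_R_0[OF \<tau>(2)] by (rule norm_G_R_0_le[OF \<tau>(2)])
      also have "\<dots> \<le> K * (C / \<tau> * norm (R 0 v))" by (intro mult_left_mono X.norm_E_smoothing \<tau> K0)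
      finally show ?thesis using \<tau> by (simp add: field_simps)
    qed
    then show ?thesis
      by (intro LIMSEQ_le[OF tendsto_mult_left[OF tendsto_norm[OF G\<tau>.tendsto[OF E\<tau>.tendsto[OF v]]]] tendsto_mult_left[OF tendsto_norm[OF v]]]) auto
  qed
  have 2: "\<tau> * norm (F \<tau> (G \<tau> x)) \<le> C * ((2 * C * \<kappa> + K) * norm x)"
  proof -
    \<comment> \<open>\<open>Q 0\<close> on the left of \<open>G \<tau>\<close> is exchanged for
      \<open>R 0\<close> on the right, with two errors containing \<open>R 0 - Q 0\<close>.\<close>
    have "Q 0 (G \<tau> x) = G \<tau> (R 0 x) - (R 0 (E \<tau> x) - Q 0 (E \<tau> x)) + F \<tau> (R 0 x - Q 0 x)"
      using \<tau> by (simp add: G_def Q0.diff F\<tau>.diff X.E_R_0 Y.E_R_0)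
    also have "norm \<dots> \<le> (K * norm x + \<kappa> * (C * norm x)) + C * (\<kappa> * norm x)"
    proof (rule order_trans[OF norm_triangle_ineq], rule add_mono, rule order_trans[OF norm_triangle_ineq4], rule add_mono)
      show "norm (G \<tau> (R 0 x)) \<le> K * norm x" unfolding K_def by (rule norm_G_R_0_le[OF \<tau>(2)])
      show "norm (R 0 (E \<tau> x) - Q 0 (E \<tau> x)) \<le> \<kappa> * (C * norm x)"
        by (intro order_trans[OF R_0_diff_le] mult_left_mono X.norm_E_le \<tau> \<kappa>_nonneg)
      show "norm (F \<tau> (R 0 x - Q 0 x)) \<le> C * (\<kappa> * norm x)"
        by (intro order_trans[OF norm_F_le] mult_left_mono R_0_diff_le \<tau> C_nonneg)
    qed
    also have "\<dots> = (2 * C * \<kappa> + K) * norm x" by (simp add: algebra_simps)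
    finally have "C * norm (Q 0 (G \<tau> x)) \<le> C * ((2 * C * \<kappa> + K) * norm x)" by (intro mult_left_mono C_nonneg)
    moreover have "\<tau> * norm (F \<tau> (G \<tau> x)) \<le> C * norm (Q 0 (G \<tau> x))"
      using norm_F_smoothing[OF \<tau>(1), of "G \<tau> x"] \<tau> by (simp add: field_simps)
    ultimately show ?thesis by linarith
  qed
  have "G t x = G \<tau> (E \<tau> x) + F \<tau> (G \<tau> x)"
    unfolding t2 G_def X.E_add[OF \<tau>(2) \<tau>(2)] Y.E_add[OF \<tau>(2) \<tau>(2)] F\<tau>.diff by simp
  then have "norm (G t x) \<le> norm (G \<tau> (E \<tau> x)) + norm (F \<tau> (G \<tau> x))" using norm_triangle_ineq by simp
  then have "t * norm (G t x) \<le> t * (norm (G \<tau> (E \<tau> x)) + norm (F \<tau> (G \<tau> x)))"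
    using t by (intro mult_left_mono) auto
  also have "\<dots> = 2 * (\<tau> * norm (G \<tau> (E \<tau> x)) + \<tau> * norm (F \<tau> (G \<tau> x)))" by (simp add: t2 algebra_simps)
  also have "\<dots> \<le> 2 * (C * K * norm x + C * ((2 * C * \<kappa> + K) * norm x))" using 1 2 by simp
  \<comment> \<open>The four terms with K = 6 C^3 \<kappa> give 24, the commutation errors give
    4.\<close>
  also have "\<dots> = 24 * C ^ 4 * \<kappa> * norm x + 4 * C\<^sup>2 * (\<kappa> * norm x)"
    by (simp add: K_def algebra_simps power2_eq_square power3_eq_cube power4_eq_xxxx)
  also have "\<dots> \<le> 24 * C ^ 4 * \<kappa> * norm x + 4 * C ^ 4 * (\<kappa> * norm x)"
    using X.growth_const_ge_1 \<kappa>_nonneg by (intro add_left_mono mult_right_mono mult_left_mono power_increasing) auto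
  finally show ?thesis by (simp add: algebra_simps)
qed

end

section \<open>Fractional powers\<close>

text \<open>The integral over the half-line need not converge absolutely; the truncation, beyond any
  prescribed \<tau>, comes from the definition of the gauge integral on unbounded sets.\<close>

lemma integral_halfline_approx:
  fixes f :: "real \<Rightarrow> 'a::banach"
  assumes f: "f integrable_on {0..}" and e: "0 < e"
  obtains N where "\<tau> \<le> N" "f integrable_on {0..N}" "norm (integral {0..N} f - integral {0..} f) < e"
proof -
  have "(f has_integral integral {0..} f) {0..}" using f by (rule integrable_integral)
  then obtain B where B: "\<And>a b. (\<lambda>x. if x \<in> {0..} then f x else 0) integrable_on cbox a b"
      "\<And>a b. ball 0 B \<subseteq> cbox a b \<Longrightarrow> norm (integral (cbox a b) (\<lambda>x. if x \<in> {0..} then f x else 0) - integral {0..} f) < e"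
    using e unfolding has_integral_alt'[of f _ "{0..}"] by blast
  define N where "N = max \<tau> (max 0 B)"
  have "cbox (- N) N \<inter> {0..} = {0..N}" by (auto simp: N_def)
  moreover have "ball 0 B \<subseteq> cbox (- N) N" by (auto simp: N_def ball_def dist_real_def)
  ultimately have "norm (integral {0..N} f - integral {0..} f) < e" "f integrable_on {0..N}"
    using B(2)[of "- N" N] B(1)[of "- N" N]
    by (simp_all only: integral_restrict_Int integrable_restrict_Int Int_commute[of "{0..}"])
  then show thesis using that[of N] by (simp add: N_def)
qed

text \<open>The pole of Gamma at 0 cancels 1/\<alpha>: through Gamma(\<alpha>+1) = \<alpha>
  Gamma(\<alpha>) the quotient extends continuously to the compact interval [0,1]. The summand 3
  stems from the integration by parts in \<open>moment_inequality\<close>.\<close>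

lemma inverse_Gamma_factor_bounded:
  "\<exists>K>0. \<forall>\<alpha>\<in>{0<..1::real}. (1 / \<alpha> + 3) / Gamma \<alpha> \<le> K"
proof -
  have "continuous_on {0..1::real} (\<lambda>\<alpha>. (1 + 3 * \<alpha>) * rGamma (\<alpha> + 1))"
    by (intro continuous_intros continuous_on_compose2[OF continuous_on_rGamma[of UNIV]]) auto
  then have "bounded ((\<lambda>\<alpha>. (1 + 3 * \<alpha>) * rGamma (\<alpha> + 1)) ` {0..1::real})"
    by (intro compact_imp_bounded compact_continuous_image compact_Icc)
  then obtain K where K: "K > 0" "\<And>\<alpha>. \<alpha> \<in> {0..1::real} \<Longrightarrow> norm ((1 + 3 * \<alpha>) * rGamma (\<alpha> + 1)) \<le> K"
    unfolding bounded_pos by blast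
  have "(1 / \<alpha> + 3) / Gamma \<alpha> \<le> K" if "\<alpha> \<in> {0<..1}" for \<alpha> :: real
  proof -
    have "(1 / \<alpha> + 3) / Gamma \<alpha> = (1 + 3 * \<alpha>) * rGamma (\<alpha> + 1)"
      using that rGamma_plus1[of \<alpha>, symmetric]
      by (simp add: divide_inverse rGamma_inverse_Gamma[symmetric] algebra_simps)
    then show ?thesis using K(2)[of \<alpha>] that by (simp add: abs_le_iff)
  qed
  then show ?thesis using K(1) by blast
qed

context resolvent_semigroup
begin

text \<open>Split at \<open>\<tau> = b / a\<close>; integrating by parts on \<open>{\<tau>..}\<close> avoids the factor \<open>1 / (1 - \<alpha>)\<close> that
would destroy uniformity as \<open>\<alpha> \<rightarrow> 1\<close>.  No convergence is needed: a divergent integral is \<open>0\<close>.\<close>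

lemma moment_inequality:
  fixes G :: "'a \<Rightarrow> 'a"
  assumes G: "bounded_linear G" and a: "0 < a" "\<And>x. norm (G x) \<le> a * norm x"
    and b: "0 < b" "\<And>x. norm (G (R 0 x)) \<le> b * norm x" and \<alpha>: "0 < \<alpha>" "\<alpha> \<le> 1"
  shows "norm (G (integral {0..} (\<lambda>s. s powr (\<alpha> - 1) *\<^sub>R E s y)))
    \<le> growth_const * (1 / \<alpha> + 3) * (a powr (1 - \<alpha>) * b powr \<alpha>) * norm y"
proof -
  interpret G: bounded_linear G by (rule G)
  define f where "f s = s powr (\<alpha> - 1) *\<^sub>R E s y" for s
  define K where "K = growth_const * (1 / \<alpha> + 3) * (a powr (1 - \<alpha>) * b powr \<alpha>) * norm y"
  define \<tau> where "\<tau> = b / a"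
  have \<tau>: "0 < \<tau>" using a b by (simp add: \<tau>_def)
  have C0: "0 \<le> growth_const" using growth_const_ge_1 by simp
  have C2: "growth_const * (1 / \<alpha> + 3) \<ge> 0" using C0 \<alpha> by (intro mult_nonneg_nonneg) auto
  have K0: "0 \<le> K" unfolding K_def by (rule mult_nonneg_nonneg[OF mult_nonneg_nonneg[OF C2]]) auto
  \<comment> \<open>The cut is where a \<tau>^\<alpha>, the size of the inner part, equals b
    \<tau>^(\<alpha>-1), the size of the outer part.\<close>
  have a\<tau>: "a * \<tau> powr \<alpha> = a powr (1 - \<alpha>) * b powr \<alpha>"
    using a b by (simp add: \<tau>_def powr_divide powr_diff)
  have b\<tau>: "b * \<tau> powr (\<alpha> - 1) = a powr (1 - \<alpha>) * b powr \<alpha>"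
    using a b by (simp add: \<tau>_def powr_divide powr_diff)
  have finite: "norm (G (integral {0..N} f)) \<le> K" if N: "\<tau> \<le> N" "f integrable_on {0..N}" for N
  proof -
    have i: "f integrable_on {0..\<tau>}" "f integrable_on {\<tau>..N}"
      using N \<tau> by (auto intro: integrable_on_subinterval[OF N(2)])
    have 1: "norm (G (integral {0..\<tau>} f)) \<le> growth_const / \<alpha> * (a powr (1 - \<alpha>) * b powr \<alpha>) * norm y"
    proof -
      have p: "((\<lambda>s. s powr (\<alpha> - 1) * (a * (growth_const * norm y))) has_integral \<tau> powr (\<alpha> - 1 + 1) / (\<alpha> - 1 + 1) * (a * (growth_const * norm y))) {0..\<tau>}"
        using \<alpha> \<tau> by (intro has_integral_mult_left has_integral_powr_from_0) auto
      have "G (integral {0..\<tau>} f) = integral {0..\<tau>} (G \<circ> f)" by (rule integral_linear[OF i(1) G, symmetric])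
      also have "norm \<dots> \<le> integral {0..\<tau>} (\<lambda>s. s powr (\<alpha> - 1) * (a * (growth_const * norm y)))"
      proof (rule integral_norm_bound_integral)
        show "(G \<circ> f) integrable_on {0..\<tau>}" by (rule integrable_linear[OF i(1) G])
        show "(\<lambda>s. s powr (\<alpha> - 1) * (a * (growth_const * norm y))) integrable_on {0..\<tau>}" using p by blast
        fix s assume "s \<in> {0..\<tau>}"
        then have "norm (G (E s y)) \<le> a * (growth_const * norm y)"
          using a by (intro order_trans[OF a(2)] mult_left_mono norm_E_le) auto
        then show "norm ((G \<circ> f) s) \<le> s powr (\<alpha> - 1) * (a * (growth_const * norm y))"
          by (simp add: f_def G.scaleR mult_left_mono)
      qed
      also have "\<dots> = \<tau> powr (\<alpha> - 1 + 1) / (\<alpha> - 1 + 1) * (a * (growth_const * norm y))" using p by (rule integral_unique)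
      also have "\<dots> = growth_const / \<alpha> * (a * \<tau> powr \<alpha>) * norm y" by simp
      finally show ?thesis unfolding a\<tau> .
    qed
    have 2: "norm (G (integral {\<tau>..N} f)) \<le> growth_const * 3 * (a powr (1 - \<alpha>) * b powr \<alpha>) * norm y"
    proof -
      define c where "c = b * (growth_const * norm y)"
      have c0: "0 \<le> c" unfolding c_def using b C0 by (intro mult_nonneg_nonneg) auto
      define H where "H s = s powr (\<alpha> - 1) *\<^sub>R G (E s (R 0 y))" for s
      define k where "k s = ((\<alpha> - 1) * s powr (\<alpha> - 2)) *\<^sub>R G (E s (R 0 y))" for s
      have GR: "norm (G (E s (R 0 y))) \<le> c" if "0 \<le> s" for s
        unfolding c_def E_R_0[OF that] using b that by (intro order_trans[OF b(2)] mult_left_mono norm_E_le) auto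
      have powr_deriv: "((\<lambda>s. s powr (\<alpha> - 1)) has_real_derivative (\<alpha> - 1) * s powr (\<alpha> - 2)) (at s within {\<tau>..N})" if "s \<in> {\<tau>..N}" for s
        using that \<tau> by (auto intro!: derivative_eq_intros)
      \<comment> \<open>\<open>E s (R 0 y)\<close> is a primitive of \<open>E s y\<close>, and on it
        G obeys the better bound b. The derivative thus falls on the power of s.\<close>
      have FTC: "((\<lambda>s. s powr (\<alpha> - 1) *\<^sub>R G (E s y) + k s) has_integral H N - H \<tau>) {\<tau>..N}"
      proof (rule fundamental_theorem_of_calculus[OF N(1)])
        fix s assume s: "s \<in> {\<tau>..N}"
        have "((\<lambda>s. E s (R 0 y)) has_vector_derivative E s y) (at s within {\<tau>..N})"
          by (rule has_vector_derivative_within_subset[OF E_R_0_has_vector_derivative]) (use s \<tau> in auto)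
        then have "((\<lambda>s. G (E s (R 0 y))) has_vector_derivative G (E s y)) (at s within {\<tau>..N})"
          by (rule G.has_vector_derivative)
        with powr_deriv[OF s] show "(H has_vector_derivative s powr (\<alpha> - 1) *\<^sub>R G (E s y) + k s) (at s within {\<tau>..N})"
          unfolding H_def k_def by (rule has_vector_derivative_scaleR)
      qed
      have "((\<lambda>s. G (f s)) has_integral G (integral {\<tau>..N} f)) {\<tau>..N}"
        using has_integral_linear[OF integrable_integral[OF i(2)] G] by (simp add: comp_def)
      then have "((\<lambda>s. s powr (\<alpha> - 1) *\<^sub>R G (E s y)) has_integral G (integral {\<tau>..N} f)) {\<tau>..N}"
        by (simp add: f_def G.scaleR)
      from has_integral_diff[OF FTC this]
      have k: "(k has_integral H N - H \<tau> - G (integral {\<tau>..N} f)) {\<tau>..N}" by simp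
      \<comment> \<open>As \<alpha> \<le> 1, the derivative of the power has constant sign, so its
        absolute value integrates exactly to the drop of s^(\<alpha>-1), at most
        \<tau>^(\<alpha>-1). No division by 1 - \<alpha> occurs.\<close>
      have q: "((\<lambda>s. - ((\<alpha> - 1) * s powr (\<alpha> - 2)) * c) has_integral (- (N powr (\<alpha> - 1)) - - (\<tau> powr (\<alpha> - 1))) * c) {\<tau>..N}"
        by (intro has_integral_mult_left fundamental_theorem_of_calculus[OF N(1)])
           (use powr_deriv in \<open>auto simp: has_real_derivative_iff_has_vector_derivative[symmetric] intro!: DERIV_minus\<close>)
      have "norm (H N - H \<tau> - G (integral {\<tau>..N} f)) \<le> (- (N powr (\<alpha> - 1)) - - (\<tau> powr (\<alpha> - 1))) * c"
      proof -
        have "norm (integral {\<tau>..N} k) \<le> integral {\<tau>..N} (\<lambda>s. - ((\<alpha> - 1) * s powr (\<alpha> - 2)) * c)"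
        proof (rule integral_norm_bound_integral)
          fix s assume s: "s \<in> {\<tau>..N}"
          have "norm (k s) = - ((\<alpha> - 1) * s powr (\<alpha> - 2)) * norm (G (E s (R 0 y)))"
            using \<alpha> by (simp add: k_def abs_mult mult_minus_left[symmetric] del: mult_minus_left)
          also have "\<dots> \<le> - ((\<alpha> - 1) * s powr (\<alpha> - 2)) * c"
            using \<alpha> s \<tau> by (intro mult_left_mono GR) (auto simp: mult_nonpos_nonneg)
          finally show "norm (k s) \<le> - ((\<alpha> - 1) * s powr (\<alpha> - 2)) * c" .
        qed (use k q in blast)+
        then show ?thesis using k q by (simp only: integral_unique)
      qed
      also have "\<dots> \<le> \<tau> powr (\<alpha> - 1) * c" using c0 by (intro mult_right_mono) auto
      finally have A: "norm (H N - H \<tau> - G (integral {\<tau>..N} f)) \<le> \<tau> powr (\<alpha> - 1) * c" .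
      have B: "norm (H s) \<le> \<tau> powr (\<alpha> - 1) * c" if "\<tau> \<le> s" for s
      proof -
        have "norm (H s) \<le> s powr (\<alpha> - 1) * c" using that \<tau> by (simp add: H_def mult_left_mono GR)
        also have "\<dots> \<le> \<tau> powr (\<alpha> - 1) * c"
          using that \<tau> \<alpha> c0 by (intro mult_right_mono powr_mono2') auto
        finally show ?thesis .
      qed
      have "G (integral {\<tau>..N} f) = H N - H \<tau> - (H N - H \<tau> - G (integral {\<tau>..N} f))" by simp
      then have "norm (G (integral {\<tau>..N} f)) \<le> norm (H N) + norm (H \<tau>) + norm (H N - H \<tau> - G (integral {\<tau>..N} f))"
        by (metis norm_triangle_ineq4 norm_triangle_le_diff add_right_mono order_trans)
      \<comment> \<open>Two boundary terms and one integral, each at most \<tau>^(\<alpha>-1)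
        c.\<close>
      also have "\<dots> \<le> 3 * (\<tau> powr (\<alpha> - 1) * c)" using A B[of N] B[of \<tau>] N by simp
      also have "\<dots> = growth_const * 3 * (b * \<tau> powr (\<alpha> - 1)) * norm y" by (simp add: c_def)
      finally show ?thesis unfolding b\<tau> .
    qed
    have "integral {0..N} f = integral {0..\<tau>} f + integral {\<tau>..N} f"
      using \<tau> N by (intro Henstock_Kurzweil_Integration.integral_combine[symmetric]) auto
    then have "norm (G (integral {0..N} f)) \<le> norm (G (integral {0..\<tau>} f)) + norm (G (integral {\<tau>..N} f))"
      by (simp add: G.add norm_triangle_ineq)
    also have "\<dots> \<le> K" using 1 2 by (simp add: K_def algebra_simps)
    finally show ?thesis .
  qed
  have "norm (G (integral {0..} f)) \<le> K"
  proof (cases "f integrable_on {0..}")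
    case False
    then show ?thesis using K0 by (simp add: not_integrable_integral G.zero)
  next
    case True
    show ?thesis
    proof (rule field_le_epsilon)
      fix e :: real assume "0 < e"
      then have "0 < e / a" using a by simp
      then obtain N where N: "\<tau> \<le> N" "f integrable_on {0..N}" "norm (integral {0..N} f - integral {0..} f) < e / a"
        using integral_halfline_approx[OF True] by blast
      have "G (integral {0..} f) = G (integral {0..N} f) - G (integral {0..N} f - integral {0..} f)" by (simp add: G.diff)
      also have "norm \<dots> \<le> K + a * (e / a)"
      proof (rule order_trans[OF norm_triangle_ineq4], rule add_mono)
        show "norm (G (integral {0..N} f)) \<le> K" by (rule finite[OF N(1,2)])
        show "norm (G (integral {0..N} f - integral {0..} f)) \<le> a * (e / a)"
          by (rule order_trans[OF a(2)], rule mult_left_mono) (use N(3) a(1) in auto)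
      qed
      finally show "norm (G (integral {0..} f)) \<le> K + e" using a by simp
    qed
  qed
  then show ?thesis by (simp add: f_def[abs_def] K_def)
qed

end

section \<open>Generators\<close>

lemma nonpos_Re_not_in_sector:
  assumes "\<delta> < pi / 2" "Re z \<le> 0"
  shows "z \<notin> sector \<delta>"
proof
  assume z: "z \<in> sector \<delta>"
  then have "cos (Arg z) > 0"
    using assms by (intro cos_gt_zero_pi) (auto simp: sector_def)
  moreover have "Re z = cmod z * cos (Arg z)"
    using arg_cong[OF Arg_eq[of z], of Re] z by (simp add: sector_def Re_exp)
  ultimately show False using z assms by (simp add: sector_def mult_le_0_iff)
qed

text \<open>Serves both problems: V the whole space with p the identity, and V = \<open>Xh h\<close>
  with p = \<open>\<pi> h\<close>. Composition with p makes every operator act on the whole space,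
  and K \<ge> 1 bounds p in either case.\<close>

locale generator_with_projection =
  fixes V D :: "'a::cbanach set" and A :: "'a \<Rightarrow> 'a" and S :: "real \<Rightarrow> 'a \<Rightarrow> 'a" and p :: "'a \<Rightarrow> 'a"
    and lam \<delta> M K :: real
  assumes V: "csubspace V" and p: "clinear_op UNIV V p" and p_le: "\<And>x. norm (p x) \<le> K * norm x"
    and p_id: "\<And>x. x \<in> V \<Longrightarrow> p x = x" and K: "1 \<le> K" and M: "1 \<le> M" and \<delta>: "\<delta> < pi / 2"
    and A: "clinear_op D V A" and dense: "V \<subseteq> closure D"
    and spec: "spectrum_op V D (\<lambda>x. lam *\<^sub>R x + A x) \<subseteq> sector \<delta>"
    and res: "\<And>z x. z \<notin> sector \<delta> \<Longrightarrow> x \<in> V \<Longrightarrow> cmod z * norm (resolvent D (\<lambda>x. lam *\<^sub>R x + A x) z x) \<le> M * norm x"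
    and S: "generates_semigroup V D (\<lambda>x. - A x) S"
begin

abbreviation B where "B \<equiv> \<lambda>x. lam *\<^sub>R x + A x"
abbreviation R where "R \<equiv> \<lambda>z x. resolvent D B z (p x)"
abbreviation E where "E \<equiv> \<lambda>t x. exp (- lam * t) *\<^sub>R S t (p x)"

lemma p_in: "p x \<in> V" and p_add: "p (x + y) = p x + p y" and p_cmult: "p (c *\<^sub>C x) = c *\<^sub>C p x"
  using p by (auto simp: clinear_op_def)

lemma D_sub: "D \<subseteq> V" using S by (auto simp: generates_semigroup_def)

lemma D_closed: "csubspace D" using A by (simp add: clinear_op_def)

lemma D_add: "x \<in> D \<Longrightarrow> y \<in> D \<Longrightarrow> x + y \<in> D" and D_cmult: "x \<in> D \<Longrightarrow> c *\<^sub>C x \<in> D"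
  using D_closed by (auto simp: csubspace_def)

lemma V_add: "x \<in> V \<Longrightarrow> y \<in> V \<Longrightarrow> x + y \<in> V" and V_cmult: "x \<in> V \<Longrightarrow> c *\<^sub>C x \<in> V"
  using V by (auto simp: csubspace_def)

lemma V_scaleR: "x \<in> V \<Longrightarrow> r *\<^sub>R x \<in> V"
  using V_cmult[of x "complex_of_real r"] by (simp add: cmult_of_real)

lemma B_add: "x \<in> D \<Longrightarrow> y \<in> D \<Longrightarrow> B (x + y) = B x + B y" and B_cmult: "x \<in> D \<Longrightarrow> B (c *\<^sub>C x) = c *\<^sub>C B x"
  using A by (auto simp: clinear_op_def cmult_add_right cmult_scaleR_right scaleR_add_right)

lemma B_in: "x \<in> D \<Longrightarrow> B x \<in> V"
  using A D_sub by (auto simp: clinear_op_def intro!: V_add V_scaleR)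

lemma in_resolvent_set:
  assumes "Re z \<le> 0"
  shows "bij_betw (\<lambda>x. z *\<^sub>C x - B x) D V" "bounded_on V (resolvent D B z)"
  using spec nonpos_Re_not_in_sector[OF \<delta> assms] by (auto simp: spectrum_op_def resolvent_set_def resolvent_def)

lemma resolvent_in: "Re z \<le> 0 \<Longrightarrow> x \<in> V \<Longrightarrow> resolvent D B z x \<in> D"
  unfolding resolvent_def using in_resolvent_set(1)[of z] by (metis bij_betw_imp_surj_on inv_into_into)

lemma resolvent_eq: "Re z \<le> 0 \<Longrightarrow> x \<in> V \<Longrightarrow> z *\<^sub>C resolvent D B z x - B (resolvent D B z x) = x"
  unfolding resolvent_def using in_resolvent_set(1)[of z]
  by (metis (no_types, lifting) bij_betw_imp_surj_on f_inv_into_f)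

lemma resolvent_unique: "Re z \<le> 0 \<Longrightarrow> u \<in> D \<Longrightarrow> z *\<^sub>C u - B u = x \<Longrightarrow> resolvent D B z x = u"
  unfolding resolvent_def using in_resolvent_set(1)[of z]
  by (auto simp: bij_betw_def intro!: inv_into_f_eq)

lemma resolvent_add:
  assumes "Re z \<le> 0" "x \<in> V" "y \<in> V"
  shows "resolvent D B z (x + y) = resolvent D B z x + resolvent D B z y"
proof (rule resolvent_unique[OF assms(1)])
  show "resolvent D B z x + resolvent D B z y \<in> D" using assms by (intro D_add resolvent_in)
  show "z *\<^sub>C (resolvent D B z x + resolvent D B z y) - B (resolvent D B z x + resolvent D B z y) = x + y"
    unfolding B_add[OF resolvent_in[OF assms(1,2)] resolvent_in[OF assms(1,3)]] cmult_add_right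
      add_diff_add resolvent_eq[OF assms(1,2)] resolvent_eq[OF assms(1,3)] ..
qed

lemma resolvent_cmult:
  assumes "Re z \<le> 0" "x \<in> V"
  shows "resolvent D B z (c *\<^sub>C x) = c *\<^sub>C resolvent D B z x"
proof (rule resolvent_unique[OF assms(1)])
  show "c *\<^sub>C resolvent D B z x \<in> D" using assms by (intro D_cmult resolvent_in)
  have *: "z *\<^sub>C c *\<^sub>C resolvent D B z x = c *\<^sub>C z *\<^sub>C resolvent D B z x" by (simp add: cmult_cmult mult.commute)
  show "z *\<^sub>C (c *\<^sub>C resolvent D B z x) - B (c *\<^sub>C resolvent D B z x) = c *\<^sub>C x"
    unfolding B_cmult[OF resolvent_in[OF assms]] * cmult.diff_right[symmetric] resolvent_eq[OF assms] ..
qed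

lemma bounded_linearI_cmult:
  assumes "\<And>x y. f (x + y) = f x + f y" "\<And>c x. f (c *\<^sub>C x) = c *\<^sub>C (f x :: 'a)" "\<And>x. norm (f x) \<le> L * norm (x :: 'a)"
  shows "bounded_linear f"
proof (rule bounded_linear_intro)
  show "f (r *\<^sub>R x) = r *\<^sub>R f x" for r x using assms(2)[of "complex_of_real r" x] by (simp add: cmult_of_real)
  show "norm (f x) \<le> norm x * L" for x using assms(3)[of x] by (simp add: mult.commute)
qed (rule assms(1))

lemma S_on_subspace:
  assumes "0 \<le> t" "x \<in> V"
  shows "S t x \<in> V" "y \<in> V \<Longrightarrow> S t (x + y) = S t x + S t y" "S t (c *\<^sub>C x) = c *\<^sub>C S t x"
  using S assms by (auto simp: generates_semigroup_def clinear_op_def)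

lemma S_p_bounded_linear:
  assumes "0 \<le> t"
  shows "bounded_linear (\<lambda>x. S t (p x))"
proof -
  have "bounded_on V (S t)" using S assms by (simp add: generates_semigroup_def)
  then obtain L where L: "\<And>x. x \<in> V \<Longrightarrow> norm (S t x) \<le> L * norm x"
    by (auto simp: bounded_on_def)
  show ?thesis
  proof (rule bounded_linearI_cmult)
    fix x
    have "norm (S t (p x)) \<le> \<bar>L\<bar> * norm (p x)"
      using L[OF p_in[of x]] mult_right_mono[OF abs_ge_self norm_ge_zero, of L "p x"] by linarith
    also have "\<dots> \<le> \<bar>L\<bar> * (K * norm x)" by (intro mult_left_mono p_le) auto
    finally show "norm (S t (p x)) \<le> (\<bar>L\<bar> * K) * norm x" by simp
  qed (use assms in \<open>simp_all add: p_add p_cmult S_on_subspace p_in\<close>)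
qed

lemma R_p_bounded_linear:
  assumes z: "Re z \<le> 0"
  shows "bounded_linear (R z)"
proof -
  obtain L where L: "\<And>x. x \<in> V \<Longrightarrow> norm (resolvent D B z x) \<le> L * norm x"
    using in_resolvent_set(2)[OF z] by (auto simp: bounded_on_def)
  show ?thesis
  proof (rule bounded_linearI_cmult)
    fix x
    have "norm (R z x) \<le> \<bar>L\<bar> * norm (p x)"
      using L[OF p_in[of x]] mult_right_mono[OF abs_ge_self norm_ge_zero, of L "p x"] by linarith
    also have "\<dots> \<le> \<bar>L\<bar> * (K * norm x)" by (intro mult_left_mono p_le) auto
    finally show "norm (R z x) \<le> (\<bar>L\<bar> * K) * norm x" by simp
  qed (use z in \<open>simp_all only: p_add p_cmult resolvent_add resolvent_cmult p_in\<close>)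
qed

text \<open>\<open>S t\<close> commutes with the difference quotients of the semigroup. Taking the
  limit inside calls for a bounded linear map on the whole space, hence \<open>S t\<close> composed
  with p, where p is the identity on V.\<close>

lemma S_commutes_with_generator:
  assumes t: "0 \<le> t" and u: "u \<in> D"
  shows "S t u \<in> D" "B (S t u) = S t (B u)"
proof -
  interpret St: bounded_linear "\<lambda>x. S t (p x)" by (rule S_p_bounded_linear[OF t])
  have uV: "u \<in> V" using u D_sub by auto
  have "((\<lambda>h. (1 / h) *\<^sub>R (S h u - u)) \<longlongrightarrow> - A u) (at_right 0)"
    using S u by (auto simp: generates_semigroup_def)
  then have "((\<lambda>h. S t (p ((1 / h) *\<^sub>R (S h u - u)))) \<longlongrightarrow> S t (p (- A u))) (at_right 0)"
    by (rule St.tendsto)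
  moreover have "\<forall>\<^sub>F h in at_right 0. S t (p ((1 / h) *\<^sub>R (S h u - u))) = (1 / h) *\<^sub>R (S h (S t u) - S t u)"
    using eventually_at_right_less[of 0]
  proof eventually_elim
    case (elim h)
    have that: "0 < h" by (rule elim)
    have "S h (S t u) = S t (S h u)"
      using S t uV that unfolding generates_semigroup_def by (metis add.commute less_imp_le)
    then show ?case using that t uV by (simp add: St.scaleR St.diff p_id S_on_subspace)
  qed
  ultimately have lim: "((\<lambda>h. (1 / h) *\<^sub>R (S h (S t u) - S t u)) \<longlongrightarrow> S t (p (- A u))) (at_right 0)"
    by (rule Lim_transform_eventually)
  then show SD: "S t u \<in> D"
    using S S_on_subspace(1)[OF t uV] unfolding generates_semigroup_def by blast
  then have "((\<lambda>h. (1 / h) *\<^sub>R (S h (S t u) - S t u)) \<longlongrightarrow> - A (S t u)) (at_right 0)"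
    using S by (auto simp: generates_semigroup_def)
  then have "- A (S t u) = S t (p (- A u))"
    using lim by (rule tendsto_unique[OF trivial_limit_at_right_real])
  moreover have "A u \<in> V" using A u by (simp add: clinear_op_def)
  moreover have "S t (p (lam *\<^sub>R u + A u)) = lam *\<^sub>R S t (p u) + S t (p (A u))"
    by (simp add: St.add St.scaleR)
  moreover have "S t (p (- A u)) = - S t (p (A u))" by (rule St.neg)
  ultimately show "B (S t u) = S t (B u)"
    using p_id[OF B_in[OF u]] p_id[OF uV] p_id[of "A u"] by simp
qed

text \<open>Every estimate on V is applied to \<open>p x\<close>, so M grows to M K. The damping
  exp(-\<lambda>t) is what makes -(\<lambda>+A), whose resolvent is bounded on the left half-plane,
  the generator.\<close>

lemma resolvent_semigroup: "resolvent_semigroup E R (M * K)"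
proof (rule resolvent_semigroup.intro)
  have MK: "M \<le> M * K" "K \<le> M * K" using M K by auto
  show "1 \<le> M * K" using MK M by linarith
  show bl: "bounded_linear (E t)" if "0 \<le> t" for t
    by (rule bounded_linear_const_scaleR[OF S_p_bounded_linear[OF that]])
  show "E t (c *\<^sub>C x) = c *\<^sub>C E t x" if "0 \<le> t" for t c x
    using that by (simp add: p_cmult S_on_subspace p_in cmult_scaleR_right)
  have Epx: "p (E t x) = E t x" if "0 \<le> t" for t x
    using that by (intro p_id V_scaleR S_on_subspace p_in)
  have SpS: "S s (p (r *\<^sub>R x)) = r *\<^sub>R S s (p x)" if "0 \<le> s" for s r x
    by (rule linear_scale[OF bounded_linear.linear[OF S_p_bounded_linear[OF that]]])
  show "E (s + t) x = E s (E t x)" if "0 \<le> s" "0 \<le> t" for s t x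
  proof -
    have "S (s + t) (p x) = S s (S t (p x))" using S that p_in by (simp add: generates_semigroup_def)
    moreover have "p (S t (p x)) = S t (p x)" using that by (intro p_id S_on_subspace p_in)
    ultimately show ?thesis
      using that by (simp add: SpS exp_add[symmetric] algebra_simps)
  qed
  have S0: "S 0 (p x) = p x" for x using S p_in by (simp add: generates_semigroup_def)
  have exp_lim: "((\<lambda>t. exp (- lam * t)) \<longlongrightarrow> 1) (at_right 0)"
    by (auto intro!: tendsto_eq_intros)
  show "((\<lambda>t. E t x) \<longlongrightarrow> E 0 x) (at_right 0)" for x
  proof -
    have "((\<lambda>t. S t (p x)) \<longlongrightarrow> p x) (at_right 0)" using S p_in by (simp add: generates_semigroup_def)
    from tendsto_scaleR[OF exp_lim this] show ?thesis by (simp add: S0)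
  qed
  show "norm (E 0 x) \<le> M * K * norm x" for x
    using p_le[of x] mult_right_mono[OF MK(2) norm_ge_zero[of x]] by (simp add: S0)
  show "bounded_linear (R z)" if "Re z \<le> 0" for z by (rule R_p_bounded_linear[OF that])
  show "cmod z * norm (R z x) \<le> M * K * norm x" if "Re z \<le> 0" for z x
  proof -
    have "cmod z * norm (R z x) \<le> M * norm (p x)"
      by (intro res nonpos_Re_not_in_sector[OF \<delta> that] p_in)
    also have "\<dots> \<le> M * (K * norm x)" using M by (intro mult_left_mono p_le) auto
    finally show ?thesis by simp
  qed
  show Rc: "R z (c *\<^sub>C x) = c *\<^sub>C R z x" if "Re z \<le> 0" for z c x
    using that by (simp only: p_cmult resolvent_cmult p_in)
  have RV: "R z x \<in> V" if "Re z \<le> 0" for z x using resolvent_in[OF that p_in] D_sub by blast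
  show "R z x - R w x = (w - z) *\<^sub>C R z (R w x)" if z: "Re z \<le> 0" and w: "Re w \<le> 0" for z w x
  proof -
    define u where "u = R w x"
    define v where "v = resolvent D B z u"
    have u: "u \<in> D" "u \<in> V" unfolding u_def using resolvent_in[OF w p_in] D_sub by auto
    have v: "v \<in> D" "z *\<^sub>C v - B v = u" unfolding v_def using resolvent_in[OF z u(2)] resolvent_eq[OF z u(2)] by auto
    \<comment> \<open>The resolvent identity by uniqueness: applying z - B to u gives
      \<open>p x\<close> plus (z - w)u, and applying it to v gives u.\<close>
    have "R z x = u + (w - z) *\<^sub>C v"
    proof (rule resolvent_unique[OF z])
      show "u + (w - z) *\<^sub>C v \<in> D" using u v by (intro D_add D_cmult)
      have "z *\<^sub>C (u + (w - z) *\<^sub>C v) - B (u + (w - z) *\<^sub>C v) = (z *\<^sub>C u - B u) + (w - z) *\<^sub>C (z *\<^sub>C v - B v)"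
        unfolding B_add[OF u(1) D_cmult[OF v(1)]] B_cmult[OF v(1)] cmult_add_right cmult.diff_right
        by (simp add: cmult_cmult mult.commute)
      also have "\<dots> = w *\<^sub>C u - B u" unfolding v(2) by (simp add: cmult.diff_left)
      also have "\<dots> = p x" unfolding u_def by (rule resolvent_eq[OF w p_in])
      finally show "z *\<^sub>C (u + (w - z) *\<^sub>C v) - B (u + (w - z) *\<^sub>C v) = p x" .
    qed
    then show ?thesis using p_id[OF u(2)] by (simp add: u_def v_def)
  qed
  show "E t (R 0 x) = R 0 (E t x)" if t: "0 \<le> t" for t x
  proof -
    define u where "u = R 0 x"
    have u: "u \<in> D" "u \<in> V" "- B u = p x"
      unfolding u_def using resolvent_in[OF _ p_in, of 0 x] D_sub resolvent_eq[OF _ p_in, of 0 x] by (auto simp: cmult.zero_left)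
    have "resolvent D B 0 (S t (p x)) = S t u"
    proof (rule resolvent_unique)
      show "S t u \<in> D" by (rule S_commutes_with_generator[OF t u(1)])
      have "- S t (B u) = S t (- B u)"
        using S_on_subspace(3)[OF t B_in[OF u(1)], of "-1"] by (simp add: cmult.minus_left)
      then show "0 *\<^sub>C S t u - B (S t u) = S t (p x)"
        unfolding S_commutes_with_generator(2)[OF t u(1)] u(3)[symmetric] by (simp add: cmult.zero_left)
    qed simp
    moreover have "resolvent D B 0 (exp (- lam * t) *\<^sub>R S t (p x)) = exp (- lam * t) *\<^sub>R resolvent D B 0 (S t (p x))"
      using resolvent_cmult[of 0 "S t (p x)" "complex_of_real (exp (- lam * t))"] S_on_subspace(1)[OF t p_in]
      unfolding cmult_of_real by simp
    ultimately show ?thesis unfolding Epx[OF t] using p_id[OF u(2)] by (simp add: u_def)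
  qed
  show "R 0 (E 0 x) = R 0 x" for x by (simp add: S0 p_id p_in)
  show "((\<lambda>t. (1 / t) *\<^sub>R (E t (R 0 x) - R 0 x)) \<longlongrightarrow> E 0 x) (at_right 0)" for x
  proof -
    define u where "u = R 0 x"
    have u: "u \<in> D" "u \<in> V" "- B u = p x"
      unfolding u_def using resolvent_in[OF _ p_in, of 0 x] D_sub resolvent_eq[OF _ p_in, of 0 x] by (auto simp: cmult.zero_left)
    have "((\<lambda>t. (1 / t) *\<^sub>R (S t u - u)) \<longlongrightarrow> - A u) (at_right 0)"
      using S u(1) by (auto simp: generates_semigroup_def)
    \<comment> \<open>Product rule at 0: the derivative of exp(-\<lambda>t) S(t)u is -\<lambda>u -
      Au, which is -Bu = \<open>p x\<close>.\<close>
    note 1 = tendsto_scaleR[OF exp_lim this]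
    have "((\<lambda>t. exp (- lam * t)) has_real_derivative - lam) (at 0)"
      by (auto intro!: derivative_eq_intros)
    then have "((\<lambda>t. (exp (- lam * t) - 1) / t) \<longlongrightarrow> - lam) (at_right 0)"
      by (auto simp: has_field_derivative_iff intro: filterlim_mono[OF _ order_refl at_le])
    from tendsto_add[OF 1 tendsto_scaleR[OF this tendsto_const[of u]]]
    have "((\<lambda>t. exp (- lam * t) *\<^sub>R (1 / t) *\<^sub>R (S t u - u) + ((exp (- lam * t) - 1) / t) *\<^sub>R u) \<longlongrightarrow> p x) (at_right 0)"
      by (simp add: u(3)[symmetric] algebra_simps)
    moreover have "exp (- lam * t) *\<^sub>R (1 / t) *\<^sub>R (S t u - u) + ((exp (- lam * t) - 1) / t) *\<^sub>R u
        = (1 / t) *\<^sub>R (exp (- lam * t) *\<^sub>R S t u - u)" for t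
    proof -
      have "exp (- lam * t) *\<^sub>R (1 / t) *\<^sub>R (S t u - u) + ((exp (- lam * t) - 1) / t) *\<^sub>R u
        = (1 / t) *\<^sub>R (exp (- lam * t) *\<^sub>R (S t u - u) + (exp (- lam * t) - 1) *\<^sub>R u)"
        by (simp add: scaleR_add_right)
      then show ?thesis by (simp add: algebra_simps)
    qed
    ultimately show ?thesis using p_id[OF u(2)] by (simp add: S0 u_def)
  qed
  show "range (E 0) \<subseteq> closure (range (R 0))"
  proof -
    \<comment> \<open>The range of \<open>R 0\<close> contains the domain, so density of D in V
      carries over.\<close>
    have "D \<subseteq> range (R 0)"
    proof
      fix u assume u: "u \<in> D"
      have "- B u \<in> V" using V_cmult[OF B_in[OF u], of "-1"] by (simp add: cmult.minus_left)
      then have "R 0 (- B u) = u" using u by (simp add: p_id resolvent_unique cmult.zero_left)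
      then show "u \<in> range (R 0)" by (metis rangeI)
    qed
    then have "V \<subseteq> closure (range (R 0))" using dense closure_mono by blast
    then show ?thesis using p_in by (auto simp: S0)
  qed
qed

text \<open>Links the approximation hypothesis, stated with the inverse of \<lambda>+A, to
  \<open>R 0\<close>; the sign disappears in the norm of a difference.\<close>

lemma inv_into_B_eq: "inv_into D B (p x) = - R 0 x"
proof -
  have u: "R 0 x \<in> D" "- B (R 0 x) = p x"
    using resolvent_in[OF _ p_in, of 0 x] resolvent_eq[OF _ p_in, of 0 x] by (auto simp: cmult.zero_left)
  have inj: "inj_on (\<lambda>x. 0 *\<^sub>C x - B x) D" using in_resolvent_set(1)[of 0] by (simp add: bij_betw_def)
  have "inj_on B D"
  proof (rule inj_onI)
    fix x y assume "x \<in> D" "y \<in> D" "B x = B y"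
    moreover from this have "0 *\<^sub>C x - B x = 0 *\<^sub>C y - B y" by (simp only: cmult.zero_left)
    ultimately show "x = y" using inj_onD[OF inj] by blast
  qed
  moreover have "- R 0 x \<in> D" "B (- R 0 x) = p x"
    using D_cmult[OF u(1), of "-1"] B_cmult[OF u(1), of "-1"] u(2) by (simp_all add: cmult.minus_left)
  ultimately show ?thesis by (intro inv_into_f_eq)
qed

end

section \<open>The error estimate\<close>

text \<open>Both hypotheses together bound X by L min(1, m/t) n, and min(1, q) \<le> q^\<nu> for 0
  \<le> \<nu> \<le> 1.\<close>

lemma le_interpolated:
  fixes L X m n t \<nu> :: real
  assumes "X \<le> L * n" "t * X \<le> L * m * n" "0 < t" "0 < m" "0 \<le> L" "0 \<le> n" "0 \<le> \<nu>" "\<nu> \<le> 1"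
  shows "X \<le> L * (m / t) powr \<nu> * n"
proof (cases "m / t \<ge> 1")
  case True
  then have "1 \<le> (m / t) powr \<nu>" using assms by (intro ge_one_powr_ge_zero) auto
  then have "L * 1 * n \<le> L * (m / t) powr \<nu> * n" using assms by (intro mult_right_mono mult_left_mono) auto
  then show ?thesis using assms by simp
next
  case False
  have "(m / t) powr 1 \<le> (m / t) powr \<nu>" using assms False by (intro powr_mono') auto
  then have "L * (m / t) * n \<le> L * (m / t) powr \<nu> * n" using assms by (intro mult_right_mono mult_left_mono) auto
  moreover have "X \<le> L * (m / t) * n" using assms by (simp add: field_simps)
  ultimately show ?thesis by simp
qed

text \<open>The power of t stands on the left because it is singular at t = 0 when \<rho> <
  \<theta>; there \<open>powr\<close> returns 0 and the claim is trivial. For \<theta> = \<rho> the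
  conditional supplies the value 1 in place of \<open>0 powr 0 = 0\<close>, so at t = 0 this case
  bounds the projection error itself. A single C precedes all exponents, which calls for the
  uniformity in \<alpha> of the moment inequality.\<close>

theorem theorem2p1:
  fixes A :: "'a::cbanach \<Rightarrow> 'a" and DA :: "'a set"
    and Xh :: "real \<Rightarrow> 'a set" and \<pi> :: "real \<Rightarrow> 'a \<Rightarrow> 'a" and Ah :: "real \<Rightarrow> 'a \<Rightarrow> 'a"
    and S :: "real \<Rightarrow> 'a \<Rightarrow> 'a" and Sh :: "real \<Rightarrow> real \<Rightarrow> 'a \<Rightarrow> 'a"
    and lam \<delta> M r T :: real
  assumes T: "T > 0"
    and Xh: "\<And>h. 0 < h \<Longrightarrow> h < 1 \<Longrightarrow> closed (Xh h) \<and> csubspace (Xh h)"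
    and pi_lin: "\<And>h. 0 < h \<Longrightarrow> h < 1 \<Longrightarrow> clinear_op UNIV (Xh h) (\<pi> h) \<and> bounded_on UNIV (\<pi> h)"
    and pi_unif: "\<exists>K. \<forall>h. 0 < h \<and> h < 1 \<longrightarrow> (\<forall>x. norm (\<pi> h x) \<le> K * norm x)"
    and pi_id: "\<And>h x. 0 < h \<Longrightarrow> h < 1 \<Longrightarrow> x \<in> Xh h \<Longrightarrow> \<pi> h x = x"
    and A_lin: "clinear_op DA UNIV A" and A_closed: "closed_op DA A"
    and A_dense: "closure DA = UNIV"
    and lam: "lam \<ge> 0" and \<delta>: "0 < \<delta>" "\<delta> < pi / 2" and M: "M \<ge> 1"
    and A_spec: "spectrum_op UNIV DA (\<lambda>x. lam *\<^sub>R x + A x) \<subseteq> sector \<delta>"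
    and A_res: "\<And>z x. z \<notin> sector \<delta> \<Longrightarrow>
        cmod z * norm (resolvent DA (\<lambda>x. lam *\<^sub>R x + A x) z x) \<le> M * norm x"
    and Ah_lin: "\<And>h. 0 < h \<Longrightarrow> h < 1 \<Longrightarrow> clinear_op (Xh h) (Xh h) (Ah h)"
    and Ah_spec: "\<And>h. 0 < h \<Longrightarrow> h < 1 \<Longrightarrow>
        spectrum_op (Xh h) (Xh h) (\<lambda>x. lam *\<^sub>R x + Ah h x) \<subseteq> sector \<delta>"
    and Ah_res: "\<And>h z x. 0 < h \<Longrightarrow> h < 1 \<Longrightarrow> z \<notin> sector \<delta> \<Longrightarrow> x \<in> Xh h \<Longrightarrow>
        cmod z * norm (resolvent (Xh h) (\<lambda>x. lam *\<^sub>R x + Ah h x) z x) \<le> M * norm x"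
    and r: "r > 0"
    and approx: "\<exists>C>0. \<forall>h x. 0 < h \<and> h < 1 \<longrightarrow>
        norm (inv_into DA (\<lambda>y. lam *\<^sub>R y + A y) x
              - inv_into (Xh h) (\<lambda>y. lam *\<^sub>R y + Ah h y) (\<pi> h x)) \<le> C * h powr r * norm x"
    and S: "generates_semigroup UNIV DA (\<lambda>x. - A x) S"
    and Sh: "\<And>h. 0 < h \<Longrightarrow> h < 1 \<Longrightarrow> generates_semigroup (Xh h) (Xh h) (\<lambda>x. - Ah h x) (Sh h)"
  shows "\<exists>C>0. \<forall>x \<theta> \<rho> t h.
      x \<in> frac_dom S lam (\<rho> / r) \<and> 0 \<le> \<theta> \<and> \<theta> \<le> r \<and> 0 \<le> \<rho> \<and> \<rho> \<le> \<theta>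
      \<and> 0 \<le> t \<and> t \<le> T \<and> 0 < h \<and> h < 1 \<longrightarrow>
      (if \<theta> = \<rho> then 1 else t powr ((\<theta> - \<rho>) / r)) * norm (S t x - Sh h t (\<pi> h x))
        \<le> C * h powr \<theta> * norm (frac_pow S lam (\<rho> / r) x)"
proof -
  obtain K0 where K0: "\<And>h x. 0 < h \<Longrightarrow> h < 1 \<Longrightarrow> norm (\<pi> h x) \<le> K0 * norm x"
    using pi_unif by blast
  \<comment> \<open>The maximum with 1 lets the same K bound the identity, so the exact and the
    discrete problem share the constant M K.\<close>
  define K where "K = max 1 K0"
  have K1: "1 \<le> K" by (simp add: K_def)
  have K: "norm (\<pi> h x) \<le> K * norm x" if "0 < h" "h < 1" for h x
    using K0[OF that, of x] mult_right_mono[of K0 K "norm x"] by (simp add: K_def)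
  have x_le: "norm x \<le> K * norm x" for x :: 'a
    using mult_right_mono[OF K1 norm_ge_zero[of x]] by simp
  obtain C0 where C0: "0 < C0" "\<And>h x. 0 < h \<Longrightarrow> h < 1 \<Longrightarrow>
        norm (inv_into DA (\<lambda>y. lam *\<^sub>R y + A y) x
              - inv_into (Xh h) (\<lambda>y. lam *\<^sub>R y + Ah h y) (\<pi> h x)) \<le> C0 * h powr r * norm x"
    using approx by blast
  interpret X: generator_with_projection UNIV DA A S "\<lambda>x. x" lam \<delta> M K
    by unfold_locales
       (use A_lin A_dense A_spec A_res S K1 M \<delta> x_le in \<open>auto simp: csubspace_def clinear_op_def\<close>)
  let ?growth_const = "resolvent_semigroup.growth_const (M * K)"
  have pair: "resolvent_semigroup_pair X.E X.R
      (\<lambda>t x. exp (- lam * t) *\<^sub>R Sh h t (\<pi> h x)) (\<lambda>z x. resolvent (Xh h) (\<lambda>x. lam *\<^sub>R x + Ah h x) z (\<pi> h x)) (M * K) (C0 * h powr r)"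
    if h: "0 < h" "h < 1" for h
  proof -
    interpret Y: generator_with_projection "Xh h" "Xh h" "Ah h" "Sh h" "\<pi> h" lam \<delta> M K
    proof (unfold_locales)
      show "csubspace (Xh h)" using Xh[OF h] by simp
      show "clinear_op UNIV (Xh h) (\<pi> h)" using pi_lin[OF h] by simp
      show "norm (\<pi> h x) \<le> K * norm x" for x by (rule K[OF h])
      show "\<pi> h x = x" if "x \<in> Xh h" for x by (rule pi_id[OF h that])
      show "Xh h \<subseteq> closure (Xh h)" by (rule closure_subset)
    qed (fact K1 M \<delta>(2) Ah_lin[OF h] Ah_spec[OF h] Ah_res[OF h] Sh[OF h])+
    show ?thesis
    proof (intro resolvent_semigroup_pair.intro X.resolvent_semigroup Y.resolvent_semigroup resolvent_semigroup_pair_axioms.intro)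
      show "X.E 0 x = x" for x using S by (simp add: generates_semigroup_def)
      show "norm (X.R 0 x - Y.R 0 x) \<le> C0 * h powr r * norm x" for x
        using C0(2)[OF h, of x] X.inv_into_B_eq[of x] Y.inv_into_B_eq[of x] by (simp add: norm_minus_commute)
      show "0 \<le> C0 * h powr r" using C0 by simp
    qed
  qed
  interpret XS: resolvent_semigroup X.E X.R "M * K" by (rule X.resolvent_semigroup)
  \<comment> \<open>One constant above the three bounds for G, with \<kappa> = C0 h^r and the factor
    h^r taken out.\<close>
  define L where "L = 2 * ?growth_const + 6 * ?growth_const ^ 3 * C0 + 28 * ?growth_const ^ 4 * C0"
  have growth_const: "1 \<le> ?growth_const" by (rule XS.growth_const_ge_1)
  have L: "2 * ?growth_const \<le> L" "6 * ?growth_const ^ 3 * C0 \<le> L" "28 * ?growth_const ^ 4 * C0 \<le> L" "0 < L"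
    using C0(1) growth_const by (auto simp: L_def add_pos_nonneg)
  define G where "G h t x = X.E t x - exp (- lam * t) *\<^sub>R Sh h t (\<pi> h x)" for h t x
  have G_lin: "bounded_linear (G h t)" and G_le: "norm (G h t x) \<le> L * norm x"
    and G_R: "norm (G h t (X.R 0 x)) \<le> L * h powr r * norm x"
    and G_smooth: "t * norm (G h t x) \<le> L * h powr r * norm x"
    if h: "0 < h" "h < 1" and t: "0 \<le> t" for h t x
  proof -
    interpret P: resolvent_semigroup_pair X.E X.R "\<lambda>t x. exp (- lam * t) *\<^sub>R Sh h t (\<pi> h x)"
      "\<lambda>z x. resolvent (Xh h) (\<lambda>x. lam *\<^sub>R x + Ah h x) z (\<pi> h x)" "M * K" "C0 * h powr r"
      by (rule pair[OF h])
    have G: "G h t = P.G t" for t by (rule ext) (simp only: G_def P.G_def)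
    show "bounded_linear (G h t)" unfolding G by (rule P.G_bounded_linear[OF t])
    show "norm (G h t x) \<le> L * norm x"
      unfolding G using P.norm_G_le[OF t, of x] mult_right_mono[OF L(1) norm_ge_zero[of x]] by linarith
    have hp: "0 \<le> h powr r * norm x" by simp
    show "norm (G h t (X.R 0 x)) \<le> L * h powr r * norm x"
      unfolding G using P.norm_G_R_0_le[OF t, of x] mult_right_mono[OF L(2) hp] by (simp add: mult.assoc)
    show "t * norm (G h t x) \<le> L * h powr r * norm x"
    proof (cases "t = 0")
      case True
      then show ?thesis using L(4) by simp
    next
      case False
      then have "0 < t" using t by simp
      then show ?thesis
        unfolding G using P.norm_G_smoothing[of t x] mult_right_mono[OF L(3) hp] by (simp add: mult.assoc)
    qed
  qed
  obtain KG where KG: "0 < KG" "\<And>\<alpha>. \<alpha> \<in> {0<..1::real} \<Longrightarrow> (1 / \<alpha> + 3) / Gamma \<alpha> \<le> KG"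
    using inverse_Gamma_factor_bounded by blast
  \<comment> \<open>The summand 1 covers \<alpha> = 0, where the fractional power is the
    identity.\<close>
  define K2 where "K2 = 1 + ?growth_const * KG"
  have K2: "1 \<le> K2" "?growth_const * KG \<le> K2" using growth_const KG(1) by (auto simp: K2_def)
  have frac: "norm (H x) \<le> K2 * (a powr (1 - \<alpha>) * b powr \<alpha>) * norm (frac_pow S lam \<alpha> x)"
    if H: "bounded_linear H" and a: "0 < a" "\<And>x. norm (H x) \<le> a * norm x"
      and b: "0 < b" "\<And>x. norm (H (X.R 0 x)) \<le> b * norm x" and \<alpha>: "0 \<le> \<alpha>" "\<alpha> \<le> 1"
      and x: "x \<in> frac_dom S lam \<alpha>" for H :: "'a \<Rightarrow> 'a" and a b \<alpha> x
  proof (cases "\<alpha> = 0")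
    case True
    have "a * norm x \<le> K2 * (a * norm x)" using K2(1) a(1) mult_right_mono[of 1 K2 "a * norm x"] by simp
    then have "norm (H x) \<le> K2 * (a * norm x)" using a(2)[of x] by linarith
    then show ?thesis using True a(1) b(1) by (simp add: frac_pow_def mult.assoc)
  next
    case False
    interpret H: bounded_linear H by (rule H)
    \<comment> \<open>\<open>y\<close> is a preimage of x under the negative power, available
      because x lies in its range.\<close>
    define y where "y = frac_pow S lam \<alpha> x"
    have "x = frac_neg S lam \<alpha> y"
      using x False by (simp add: y_def frac_pow_def frac_dom_def f_inv_into_f)
    also have "\<dots> = (1 / Gamma \<alpha>) *\<^sub>R integral {0..} (\<lambda>s. s powr (\<alpha> - 1) *\<^sub>R X.E s y)"
      by (simp add: frac_neg_def)
    finally have "norm (H x) = (1 / Gamma \<alpha>) * norm (H (integral {0..} (\<lambda>s. s powr (\<alpha> - 1) *\<^sub>R X.E s y)))"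
      using False \<alpha> by (simp add: H.scaleR Gamma_real_pos less_imp_le)
    also have "\<dots> \<le> (1 / Gamma \<alpha>) * (?growth_const * (1 / \<alpha> + 3) * (a powr (1 - \<alpha>) * b powr \<alpha>) * norm y)"
      using False \<alpha> by (intro mult_left_mono XS.moment_inequality[OF H a b]) (auto intro!: less_imp_le Gamma_real_pos)
    also have "\<dots> = ?growth_const * ((1 / \<alpha> + 3) / Gamma \<alpha>) * (a powr (1 - \<alpha>) * b powr \<alpha>) * norm y" by simp
    also have "\<dots> \<le> ?growth_const * KG * (a powr (1 - \<alpha>) * b powr \<alpha>) * norm y"
      using False \<alpha> growth_const by (intro mult_right_mono mult_left_mono KG(2)) auto
    also have "\<dots> \<le> K2 * (a powr (1 - \<alpha>) * b powr \<alpha>) * norm y"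
      by (intro mult_right_mono K2(2)) auto
    finally show ?thesis by (simp add: y_def)
  qed
  have main: "(if \<theta> = \<rho> then 1 else t powr ((\<theta> - \<rho>) / r)) * norm (G h t x)
        \<le> K2 * L * h powr \<theta> * norm (frac_pow S lam (\<rho> / r) x)"
    if x: "x \<in> frac_dom S lam (\<rho> / r)" and \<theta>: "\<theta> \<le> r" and \<rho>: "0 \<le> \<rho>" "\<rho> \<le> \<theta>"
      and t: "0 \<le> t" and h: "0 < h" "h < 1" for x \<theta> \<rho> t h
  proof -
    define \<alpha> where "\<alpha> = \<rho> / r"
    define y where "y = frac_pow S lam \<alpha> x"
    have \<alpha>: "0 \<le> \<alpha>" "\<alpha> \<le> 1" using r \<rho> \<theta> by (auto simp: \<alpha>_def)
    have hr: "0 < h powr r" using h by simp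
    have b: "0 < L * h powr r" using hr L(4) by simp
    have h\<alpha>: "(h powr r) powr \<alpha> = h powr \<rho>" using r by (simp add: powr_powr \<alpha>_def)
    have L\<alpha>: "L powr (1 - \<alpha>) * L powr \<alpha> = L" using L(4) by (simp add: powr_add[symmetric])
    \<comment> \<open>For \<theta> = \<rho> the bound G = O(1) is used in place of smoothing; for t
      = 0 below that line the left side is 0.\<close>
    consider "\<theta> = \<rho>" | "\<theta> \<noteq> \<rho>" "t = 0" | "\<rho> < \<theta>" "0 < t" using t \<rho> by linarith
    then show ?thesis
    proof cases
      case 1
      have "norm (G h t x) \<le> K2 * (L powr (1 - \<alpha>) * (L * h powr r) powr \<alpha>) * norm y"
        unfolding y_def using x
        by (intro frac G_lin G_le G_R h t L(4) b \<alpha>) (simp add: \<alpha>_def)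
      also have "L powr (1 - \<alpha>) * (L * h powr r) powr \<alpha> = L * h powr \<rho>"
        using L(4) hr by (simp add: powr_mult h\<alpha> mult.assoc[symmetric] L\<alpha>)
      finally show ?thesis using 1 by (simp add: y_def \<alpha>_def mult.assoc)
    next
      case 2
      have "0 \<le> K2 * L * h powr \<theta> * norm (frac_pow S lam (\<rho> / r) x)"
        using K2(1) L(4) by (intro mult_nonneg_nonneg) auto
      then show ?thesis using 2 by simp
    next
      case 3
      \<comment> \<open>Chosen so that \<nu>(1 - \<alpha>) = (\<theta> - \<rho>)/r: the moment
        inequality raises the bound on G to the power 1 - \<alpha>. The denominator is positive
        since \<rho> < \<theta> \<le> r, and \<theta> \<le> r is exactly \<nu> \<le> 1.\<close>
      define \<nu> where "\<nu> = (\<theta> - \<rho>) / (r - \<rho>)"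
      define \<beta> where "\<beta> = (\<theta> - \<rho>) / r"
      have "\<rho> < r" using 3 \<theta> by simp
      then have \<nu>: "0 \<le> \<nu>" "\<nu> \<le> 1" using 3 \<theta> by (auto simp: \<nu>_def)
      have \<nu>\<alpha>: "\<nu> * (1 - \<alpha>) = \<beta>" using \<open>\<rho> < r\<close> r by (simp add: \<nu>_def \<alpha>_def \<beta>_def field_simps)
      define q where "q = h powr r / t"
      have q: "0 < q" using hr 3 by (simp add: q_def)
      have a: "0 < L * q powr \<nu>" using q L(4) by simp
      have "norm (G h t x) \<le> L * q powr \<nu> * norm x" for x
        unfolding q_def
        by (rule le_interpolated[OF G_le[OF h t] G_smooth[OF h t] 3(2) hr]) (use L(4) \<nu> in auto)
      then have "norm (G h t x) \<le> K2 * ((L * q powr \<nu>) powr (1 - \<alpha>) * (L * h powr r) powr \<alpha>) * norm y"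
        unfolding y_def using x
        by (intro frac G_lin G_R h t a b \<alpha>) (simp_all add: \<alpha>_def)
      also have "(L * q powr \<nu>) powr (1 - \<alpha>) * (L * h powr r) powr \<alpha> = L * (q powr \<beta> * h powr \<rho>)"
      proof -
        have "(L * q powr \<nu>) powr (1 - \<alpha>) * (L * h powr r) powr \<alpha>
          = (L powr (1 - \<alpha>) * L powr \<alpha>) * ((q powr \<nu>) powr (1 - \<alpha>) * (h powr r) powr \<alpha>)"
          using L(4) q hr by (simp add: powr_mult)
        then show ?thesis unfolding L\<alpha> h\<alpha> by (simp add: powr_powr \<nu>\<alpha>)
      qed
      finally have "t powr \<beta> * norm (G h t x) \<le> t powr \<beta> * (K2 * (L * (q powr \<beta> * h powr \<rho>)) * norm y)"
        by (intro mult_left_mono) auto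
      also have "\<dots> = K2 * L * ((t powr \<beta> * q powr \<beta>) * h powr \<rho>) * norm y" by simp
      \<comment> \<open>The weight cancels the singularity of q = h^r/t and leaves
        h^(\<theta>-\<rho>), which the factor h^\<rho> from the fractional power completes to
        h^\<theta>.\<close>
      also have "t powr \<beta> * q powr \<beta> = h powr (\<theta> - \<rho>)"
      proof -
        have "t powr \<beta> * q powr \<beta> = (h powr r) powr \<beta>"
          using 3 hr by (simp add: powr_mult[symmetric] q_def)
        then show ?thesis using r by (simp add: powr_powr \<beta>_def)
      qed
      also have "h powr (\<theta> - \<rho>) * h powr \<rho> = h powr \<theta>" by (simp add: powr_add[symmetric])
      finally show ?thesis using 3 by (simp add: \<beta>_def y_def \<alpha>_def)
    qed
  qed
  \<comment> \<open>Removing the damping costs exp(\<lambda>T), the only dependence of the constant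
    on T.\<close>
  have S_G: "norm (S t x - Sh h t (\<pi> h x)) \<le> exp (lam * T) * norm (G h t x)" if t: "0 \<le> t" "t \<le> T" for t x h
  proof -
    have "S t x - Sh h t (\<pi> h x) = exp (lam * t) *\<^sub>R G h t x"
      by (simp add: G_def scaleR_diff_right exp_add[symmetric])
    then have "norm (S t x - Sh h t (\<pi> h x)) = exp (lam * t) * norm (G h t x)" by simp
    also have "\<dots> \<le> exp (lam * T) * norm (G h t x)"
      using t lam by (intro mult_right_mono) (auto intro!: mult_left_mono)
    finally show ?thesis .
  qed
  show ?thesis
  proof (intro exI[of _ "exp (lam * T) * (K2 * L)"] conjI allI impI)
    show "0 < exp (lam * T) * (K2 * L)" using K2(1) L(4) by simp
  next
    fix x :: 'a and \<theta> \<rho> t h :: real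
    assume *: "x \<in> frac_dom S lam (\<rho> / r) \<and> 0 \<le> \<theta> \<and> \<theta> \<le> r \<and> 0 \<le> \<rho> \<and> \<rho> \<le> \<theta>
      \<and> 0 \<le> t \<and> t \<le> T \<and> 0 < h \<and> h < 1"
    let ?w = "if \<theta> = \<rho> then 1 else t powr ((\<theta> - \<rho>) / r)"
    have "?w * norm (S t x - Sh h t (\<pi> h x)) \<le> ?w * (exp (lam * T) * norm (G h t x))"
      using * by (intro mult_left_mono S_G) auto
    also have "\<dots> = exp (lam * T) * (?w * norm (G h t x))" by simp
    also have "\<dots> \<le> exp (lam * T) * (K2 * L * h powr \<theta> * norm (frac_pow S lam (\<rho> / r) x))"
      using * by (intro mult_left_mono main) auto
    finally show "?w * norm (S t x - Sh h t (\<pi> h x)) \<le> exp (lam * T) * (K2 * L) * h powr \<theta> * norm (frac_pow S lam (\<rho> / r) x)"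
      by (simp add: mult.assoc)
  qed
qed

end
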